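(* Consider the three-node half-duplex relay network with channel training and overlapped amplify-and-forward (AF) relaying described in the context, with parameters $m>2$, $0<\alpha\le 1/2$, $\delta_s,\delta_r\in(0,1)$, $P_s,P_r,N_0>0$ and $\sigma_{sd},\sigma_{sr},\sigma_{rd}>0$. Let $w_{sd},w_{sr},w_{rd}$ be i.i.d. $\mathcal{CN}(0,1)$, and put $A=\sigma_{sd}^2\delta_s mP_s+N_0$, $B=\sigma_{rd}^2\delta_r mP_r+N_0$, $$D=(m-2)AB N_0+\frac{(1-\delta_r)mP_r\sigma_{rd}^2N_0A}{\alpha}+(1-\delta_s)mP_s\sigma_{sd}^2N_0B,$$ $$a=\frac{\delta_s(1-\delta_s)m^2P_s^2\sigma_{sd}^4}{(1-\delta_s)mP_s\sigma_{sd}^2N_0+(m-2)(\sigma_{sd}^2\delta_smP_s+N_0)N_0}|w_{sd}|^2,$$ $$c=\frac{\delta_s(1-\delta_s)m^2P_s^2\sigma_{sr}^4}{(1-\delta_s)mP_s\sigma_{sr}^2N_0+(m-2)(\sigma_{sr}^2\delta_smP_s+N_0)N_0}|w_{sr}|^2,$$ $$b=\frac{\delta_s(1-\delta_s)m^2P_s^2\sigma_{sd}^4\,B}{D}|w_{sd}|^2,\qquad d=\frac{\delta_r(1-\delta_r)m^2P_r^2\sigma_{rd}^4\,A/\alpha}{D}|w_{rd}|^2 .$$ Then the following rate is achievable for the AF transmission scheme (i.e., it is a lower bound on its capacity, per symbol): $$I_{low}=\frac1m E\Big\{(1-2\alpha)(m-2)\log(1+a)+(m-2)\alpha\log\big(1+a+f(c,d)+q(a,b,c,d)\big)\Big\},$$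 where $f(x,y)=\frac{xy}{1+x+y}$, $q(a,b,c,d)=\frac{(1+a)b(1+c)}{1+c+d}$, and the expectation is over $w_{sd},w_{sr},w_{rd}$.
   Context: Notation: $\mathcal{CN}(\mu,\sigma^2)$ denotes a proper complex Gaussian variable with mean $\mu$ and variance $\sigma^2$. $\log$ is to a fixed base (base 2 for rates in bits). Channel: a source, a relay and a destination. The source-relay, source-destination and relay-destination fading coefficients $h_{sr}\sim\mathcal{CN}(0,\sigma_{sr}^2)$, $h_{sd}\sim\mathcal{CN}(0,\sigma_{sd}^2)$, $h_{rd}\sim\mathcal{CN}(0,\sigma_{rd}^2)$ are independent, constant over blocks of $m$ symbols, and take independent realizations in different blocks. No node knows their realizations a priori. All noise samples are independent $\mathcal{CN}(0,N_0)$. Per block, the source and relay satisfy $\|\mathbf x_{s,t}\|^2+E\|\mathbf x_s\|^2\le mP_s$ and $\|\mathbf x_{r,t}\|^2+E\|\mathbf x_r\|^2\le mP_r$, where $\mathbf x_{s,t},\mathbf x_{r,t}$ are training signals and $\mathbf x_s,\mathbf x_r$ are data vectors. Training: in the first symbol of each block the source sends a pilot of energy $\delta_s mP_s$, from which the relay and destination form MMSE estimates $\hat h_{sr},\hat h_{sd}$; in the second symbol the relay sends a pilot of energy $\delta_r mP_r$, from which the destination forms the MMSE estimate $\hat h_{rd}$. For instance $\hat h_{sr}=\frac{\sigma_{sr}^2\sqrt{\delta_smP_s}}{\sigma_{sr}^2\delta_smP_s+N_0}y_{r,t}$ with $y_{r,t}=h_{sr}\sqrt{\delta_s m P_s}+n_r$,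 and $h_{sr}=\hat h_{sr}+\tilde h_{sr}$ with $\mathrm{var}(\tilde h_{sr})=\frac{\sigma_{sr}^2N_0}{\sigma_{sr}^2\delta_smP_s+N_0}$; the others are similar. Data phase (remaining $m-2$ symbols; the vector dimensions $(1-2\alpha)(m-2)$ and $\alpha(m-2)$ are assumed to be integers): the source sends $\mathbf x_s=[\mathbf x_{s1}^T,\mathbf x_{s21}^T,\mathbf x_{s22}^T]^T$ with respective dimensions $(1-2\alpha)(m-2)$, $\alpha(m-2)$, $\alpha(m-2)$, and the relay sends $\mathbf x_r$ of dimension $\alpha(m-2)$. The received signals are $\mathbf y_{d1}=h_{sd}\mathbf x_{s1}+\mathbf n_d$, $\mathbf y_r=h_{sr}\mathbf x_{s21}+\mathbf n_r$ (relay), $\mathbf y_{d2}=h_{sd}\mathbf x_{s21}+\mathbf n_d$, $\mathbf y_d^r=h_{sd}\mathbf x_{s22}+h_{rd}\mathbf x_r+\mathbf n_d^r$ (destination). The data vectors have independent entries of equal energy, with $E\{\mathbf x_s\mathbf x_s^\dagger\}=\frac{(1-\delta_s)mP_s}{m-2}\mathbf I$ and $E\{\mathbf x_r\mathbf x_r^\dagger\}=\frac{(1-\delta_r)mP_r}{(m-2)\alpha}\mathbf I$. AF: the relay transmits a scaled version of its received vector, $\mathbf x_r=\beta\mathbf y_r$, with $\beta$ chosen (given $\hat h_{sr}$) so that $E\{\mathbf x_r\mathbf x_r^\dagger\}=\frac{(1-\delta_r)mP_r}{(m-2)\alpha}\mathbf I$ holds. Achievability is in the usual sense of reliable communication with coding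 over many blocks, with the channel estimates available at the decoder; equivalently, $I_{low}$ lower-bounds the supremum over admissible inputs of $\frac1m$ times the mutual information between $\mathbf x_s$ and $(\mathbf y_{d1},\mathbf y_{d2},\mathbf y_d^r)$ conditional on $\hat h_{sr},\hat h_{sd},\hat h_{rd}$. *)

theory Defs
  imports "HOL-Probability.Probability"
begin

text \<open>Proper complex Gaussian law: independent real and imaginary parts, each carrying half of
  the variance \<open>v\<close>; \<^const>\<open>normal_density\<close> takes the standard deviation.\<close>

definition complex_gaussian :: "complex \<Rightarrow> real \<Rightarrow> complex measure" where
  "complex_gaussian \<mu> v =
     distr (density lborel (\<lambda>x. ennreal (normal_density (Re \<mu>) (sqrt (v / 2)) x)) \<Otimes>\<^sub>M
            density lborel (\<lambda>x. ennreal (normal_density (Im \<mu>) (sqrt (v / 2)) x)))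
       borel (\<lambda>(x, y). Complex x y)"

datatype link = SR | SD | RD

record relay_net =
  block_len :: nat
  overlap :: real             (* \<alpha> *)
  src_train_frac :: real      (* \<delta>_s *)
  rel_train_frac :: real      (* \<delta>_r *)
  src_power :: real
  rel_power :: real
  noise_var :: real           (* N_0 *)
  fading_sd :: "link \<Rightarrow> real" (* standard deviations: h_l has variance (fading_sd l)^2 *)

definition data_len :: "relay_net \<Rightarrow> nat" where
  "data_len p = block_len p - 2"

text \<open>Dimensions of \<open>x\<^sub>s\<^sub>1\<close> and of \<open>x\<^sub>s\<^sub>2\<^sub>1\<close>, \<open>x\<^sub>s\<^sub>2\<^sub>2\<close>, \<open>x\<^sub>r\<close>; they are meant to be used only when
  the products inside the floors are integers, so that no rounding takes place.\<close>

definition dim1 :: "relay_net \<Rightarrow> nat" where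
  "dim1 p = nat \<lfloor>(1 - 2 * overlap p) * (real (block_len p) - 2)\<rfloor>"

definition dim2 :: "relay_net \<Rightarrow> nat" where
  "dim2 p = nat \<lfloor>overlap p * (real (block_len p) - 2)\<rfloor>"

definition src_symbol_energy :: "relay_net \<Rightarrow> real" where
  "src_symbol_energy p =
     (1 - src_train_frac p) * real (block_len p) * src_power p / (real (block_len p) - 2)"

definition rel_symbol_energy :: "relay_net \<Rightarrow> real" where
  "rel_symbol_energy p =
     (1 - rel_train_frac p) * real (block_len p) * rel_power p /
     ((real (block_len p) - 2) * overlap p)"

fun pilot_energy :: "relay_net \<Rightarrow> link \<Rightarrow> real" where
  "pilot_energy p SR = src_train_frac p * real (block_len p) * src_power p"
| "pilot_energy p SD = src_train_frac p * real (block_len p) * src_power p"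
| "pilot_energy p RD = rel_train_frac p * real (block_len p) * rel_power p"

text \<open>An outcome of one block is \<open>(x, h, n\<^sub>r, n\<^sub>d)\<close>: source data vector, fading coefficients, and noise
  at the relay and at the destination. Noise is indexed by the symbol time \<open>t < m\<close>: times 0 and 1
  are the pilots of source and relay, and data entry \<open>i\<close> of the source is sent at time \<open>2 + i\<close>.\<close>

type_synonym outcome = "(nat \<Rightarrow> complex) \<times> (link \<Rightarrow> complex) \<times> (nat \<Rightarrow> complex) \<times> (nat \<Rightarrow> complex)"

definition block_space :: "relay_net \<Rightarrow> (nat \<Rightarrow> complex) measure \<Rightarrow> outcome measure" where
  "block_space p P =
     P \<Otimes>\<^sub>M (\<Pi>\<^sub>M l\<in>UNIV. complex_gaussian 0 ((fading_sd p l)\<^sup>2)) \<Otimes>\<^sub>M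
     (\<Pi>\<^sub>M t\<in>{..<block_len p}. complex_gaussian 0 (noise_var p)) \<Otimes>\<^sub>M
     (\<Pi>\<^sub>M t\<in>{..<block_len p}. complex_gaussian 0 (noise_var p))"

text \<open>Training: the source pilot is heard by relay and destination at time 0, the relay pilot by the
  destination at time 1.\<close>

fun pilot_noise :: "link \<Rightarrow> outcome \<Rightarrow> complex" where
  "pilot_noise SR (x, h, nr, nd) = nr 0"
| "pilot_noise SD (x, h, nr, nd) = nd 0"
| "pilot_noise RD (x, h, nr, nd) = nd 1"

definition pilot_obs :: "relay_net \<Rightarrow> link \<Rightarrow> outcome \<Rightarrow> complex" where
  "pilot_obs p l \<omega> =
     (case \<omega> of (x, h, nr, nd) \<Rightarrow> h l * complex_of_real (sqrt (pilot_energy p l))) + pilot_noise l \<omega>"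

definition mmse_est :: "relay_net \<Rightarrow> link \<Rightarrow> outcome \<Rightarrow> complex" where
  "mmse_est p l \<omega> =
     complex_of_real ((fading_sd p l)\<^sup>2 * sqrt (pilot_energy p l) /
       ((fading_sd p l)\<^sup>2 * pilot_energy p l + noise_var p)) * pilot_obs p l \<omega>"

definition mmse_ests :: "relay_net \<Rightarrow> outcome \<Rightarrow> (link \<Rightarrow> complex)" where
  "mmse_ests p \<omega> = (\<lambda>l. mmse_est p l \<omega>)"

text \<open>Data phase. The relay gain \<open>g\<close> is a function of the relay's channel estimate.\<close>

definition y_r :: "relay_net \<Rightarrow> nat \<Rightarrow> outcome \<Rightarrow> complex" where
  "y_r p i = (\<lambda>(x, h, nr, nd). h SR * x (dim1 p + i) + nr (2 + dim1 p + i))"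

definition x_r :: "relay_net \<Rightarrow> (complex \<Rightarrow> real) \<Rightarrow> nat \<Rightarrow> outcome \<Rightarrow> complex" where
  "x_r p g i \<omega> = complex_of_real (g (mmse_est p SR \<omega>)) * y_r p i \<omega>"

definition y_d1 :: "relay_net \<Rightarrow> outcome \<Rightarrow> (nat \<Rightarrow> complex)" where
  "y_d1 p = (\<lambda>(x, h, nr, nd). \<lambda>i\<in>{..<dim1 p}. h SD * x i + nd (2 + i))"

definition y_d2 :: "relay_net \<Rightarrow> outcome \<Rightarrow> (nat \<Rightarrow> complex)" where
  "y_d2 p = (\<lambda>(x, h, nr, nd). \<lambda>i\<in>{..<dim2 p}. h SD * x (dim1 p + i) + nd (2 + dim1 p + i))"

definition y_dr :: "relay_net \<Rightarrow> (complex \<Rightarrow> real) \<Rightarrow> outcome \<Rightarrow> (nat \<Rightarrow> complex)" where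
  "y_dr p g \<omega> = (case \<omega> of (x, h, nr, nd) \<Rightarrow>
     (\<lambda>i\<in>{..<dim2 p}. h SD * x (dim1 p + dim2 p + i) + h RD * x_r p g i \<omega>
        + nd (2 + dim1 p + dim2 p + i)))"

definition admissible_input :: "relay_net \<Rightarrow> (nat \<Rightarrow> complex) measure \<Rightarrow> bool" where
  "admissible_input p P \<longleftrightarrow>
     prob_space P \<and> sets P = sets (\<Pi>\<^sub>M i\<in>{..<data_len p}. (borel :: complex measure)) \<and>
     prob_space.indep_vars P (\<lambda>_. borel) (\<lambda>i x. x i) {..<data_len p} \<and>
     (\<forall>i<data_len p. \<forall>j<data_len p.
        integrable P (\<lambda>x. x i * cnj (x j)) \<and>
        (\<integral>x. x i * cnj (x j) \<partial>P) = (if i = j then complex_of_real (src_symbol_energy p) else 0)) \<and>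
     pilot_energy p SD + (\<integral>x. (\<Sum>i<data_len p. (cmod (x i))\<^sup>2) \<partial>P)
       \<le> real (block_len p) * src_power p"

text \<open>The gain is such that \<open>E{x\<^sub>r x\<^sub>r\<^sup>\<dagger>}\<close>, conditionally on the relay's estimate, is the prescribed
  multiple of the identity. Conditional expectations exist in the library for real functions only,
  hence the split into real and imaginary parts.\<close>

definition admissible_gain :: "relay_net \<Rightarrow> (nat \<Rightarrow> complex) measure \<Rightarrow> (complex \<Rightarrow> real) \<Rightarrow> bool" where
  "admissible_gain p P g \<longleftrightarrow>
     (let \<Omega> = block_space p P; F = vimage_algebra (space \<Omega>) (mmse_est p SR) borel in
     g \<in> borel_measurable borel \<and> (\<forall>z. 0 \<le> g z) \<and>
     (\<forall>i<dim2 p. \<forall>j<dim2 p.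
        integrable \<Omega> (\<lambda>\<omega>. x_r p g i \<omega> * cnj (x_r p g j \<omega>)) \<and>
        (AE \<omega> in \<Omega>. real_cond_exp \<Omega> F (\<lambda>\<omega>. Re (x_r p g i \<omega> * cnj (x_r p g j \<omega>))) \<omega>
           = (if i = j then rel_symbol_energy p else 0)) \<and>
        (AE \<omega> in \<Omega>. real_cond_exp \<Omega> F (\<lambda>\<omega>. Im (x_r p g i \<omega> * cnj (x_r p g j \<omega>))) \<omega> = 0)) \<and>
     pilot_energy p RD + (\<integral>\<omega>. (\<Sum>i<dim2 p. (cmod (x_r p g i \<omega>))\<^sup>2) \<partial>\<Omega>)
       \<le> real (block_len p) * rel_power p)"

text \<open>Per-symbol information rate \<open>1/m I(x\<^sub>s; y\<^sub>d\<^sub>1, y\<^sub>d\<^sub>2, y\<^sub>d\<^sup>r | estimates)\<close> in logarithms to base \<open>b\<close>.\<close>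

definition af_rate ::
    "real \<Rightarrow> relay_net \<Rightarrow> (nat \<Rightarrow> complex) measure \<Rightarrow> (complex \<Rightarrow> real) \<Rightarrow> real" where
  "af_rate b p P g = 1 / real (block_len p) *
     prob_space.conditional_mutual_information (block_space p P) b
       (\<Pi>\<^sub>M i\<in>{..<data_len p}. borel)
       ((\<Pi>\<^sub>M i\<in>{..<dim1 p}. borel) \<Otimes>\<^sub>M (\<Pi>\<^sub>M i\<in>{..<dim2 p}. borel) \<Otimes>\<^sub>M (\<Pi>\<^sub>M i\<in>{..<dim2 p}. borel))
       (\<Pi>\<^sub>M l\<in>UNIV. borel)
       fst (\<lambda>\<omega>. (y_d1 p \<omega>, y_d2 p \<omega>, y_dr p g \<omega>)) (mmse_ests p)"

definition af_capacity :: "real \<Rightarrow> relay_net \<Rightarrow> ereal" where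
  "af_capacity b p =
     (SUP (P, g) \<in> {(P, g). admissible_input p P \<and> admissible_gain p P g}. ereal (af_rate b p P g))"

end

theory Submission
  imports Defs
begin

text \<open>The data are i.i.d. Gaussian. If \<open>R > 0\<close> satisfies \<open>\<integral>R(x, v) P(dx) \<le> 1\<close> for every \<open>v\<close>, then Gibbs'
  inequality gives \<open>I(X; V) \<ge> E log R(X, V)\<close>. We take for \<open>R\<close> the posterior-to-prior ratio of the data in
  the fictitious channel in which the noise and everything caused by the estimation errors are replaced
  by Gaussian noise, independent of the data and with the same variance given the estimates. Then \<open>log R\<close>
  is quadratic in the data and the observations, so that its conditional mean involves only second
  moments, and these are the same in the true channel. Factoring the posterior by the chain rule into
  scalar linear MMSE estimates, one obtains the sum of the expectations of \<open>log (prior variance / MMSE)\<close>;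
  for the two symbols that share the slot of the relay, the product of the two ratios is exactly
  \<open>1 + a + f(c, d) + q(a, b, c, d)\<close>.

  Mutual information is a Bochner integral of the logarithm of a Radon-Nikodym derivative and would be
  \<open>0\<close> if that were not integrable. Integrability follows from the explicit density of the law of data
  and observations, given fading, pilots and relay noise, relative to pure destination noise.\<close>

section \<open>Complex Gaussian laws\<close>

text \<open>The density of the decoder's observation is intractable: the fading and the relay noise
  are hidden, and the forwarded signal contains products of three Gaussians. Two devices avoid it.
  For integrability, a more informed decoder is considered, which sees the hidden quantities too;
  for it the received block is destination noise translated by a known mean. Absolute continuity and
  integrability of the information density then pass down to the actual decoder. For moments, each
  pair (fading, pilot noise) is traded for (estimation error, estimate). The pair is jointly
  Gaussian, so error and estimate are independent; conditioning on the estimates becomes an inner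
  integral of a product measure, and the non-Gaussian noise a sum of orthogonal monomials. The
  conditional mutual information is the difference of I(x; y, estimates) and I(x; estimates). The
  latter is 0, so the bound is applied with V = (y, estimates). In each shared slot the relayed
  symbol is estimated first, with the overlapping symbol counted as noise, and the overlapping one
  afterwards with the relayed one known. Hence only scalar estimates occur and no
  determinants.\<close>

lemma lborel_complex_eq_distr:
  "(lborel :: complex measure) = distr (lborel \<Otimes>\<^sub>M lborel) borel (\<lambda>(x, y). Complex x y)"
proof (rule lborel_eqI)
  fix l u :: complex assume le: "\<And>b. b \<in> Basis \<Longrightarrow> l \<bullet> b \<le> u \<bullet> b"
  have [measurable]: "(\<lambda>(x, y). Complex x y) \<in> lborel \<Otimes>\<^sub>M lborel \<rightarrow>\<^sub>M borel"
    unfolding Complex_eq by measurable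
  have "(\<lambda>(x, y). Complex x y) -` box l u \<inter> space (lborel \<Otimes>\<^sub>M lborel) =
      box (Re l) (Re u) \<times> box (Im l) (Im u)"
    by (auto simp: box_def Basis_complex_def space_pair_measure)
  moreover have "Re l \<le> Re u" "Im l \<le> Im u"
    using le[of 1] le[of \<i>] by (auto simp: Basis_complex_def)
  ultimately show "emeasure (distr (lborel \<Otimes>\<^sub>M lborel) borel (\<lambda>(x, y). Complex x y)) (box l u) = (\<Prod>b\<in>Basis. (u - l) \<bullet> b)"
    by (subst emeasure_distr)
      (auto simp: lborel.emeasure_pair_measure_Times Basis_complex_def ennreal_mult)
qed auto

definition cg_density :: "complex \<Rightarrow> real \<Rightarrow> complex \<Rightarrow> real" where
  "cg_density \<mu> v z = exp (- (cmod (z - \<mu>))\<^sup>2 / v) / (pi * v)"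

lemma cg_density_measurable[measurable]:
  assumes "f \<in> borel_measurable M" "g \<in> borel_measurable M" "h \<in> borel_measurable M"
  shows "(\<lambda>x. cg_density (f x) (g x) (h x)) \<in> borel_measurable M"
  using assms unfolding cg_density_def by measurable

lemma cg_density_pos: "0 < v \<Longrightarrow> 0 < cg_density \<mu> v z"
  by (simp add: cg_density_def)

lemma cg_density_nonneg[simp]: "0 < v \<Longrightarrow> 0 \<le> cg_density \<mu> v z"
  using cg_density_pos[of v \<mu> z] by simp

lemma sets_complex_gaussian[simp, measurable_cong]: "sets (complex_gaussian \<mu> v) = sets borel"
  by (simp add: complex_gaussian_def)

lemma space_complex_gaussian[simp]: "space (complex_gaussian \<mu> v) = UNIV"
  by (simp add: complex_gaussian_def)

lemma prob_space_complex_gaussian: 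
  assumes "0 < v" shows "prob_space (complex_gaussian \<mu> v)"
proof -
  have [measurable]: "(\<lambda>(x, y). Complex x y) \<in> borel \<Otimes>\<^sub>M borel \<rightarrow>\<^sub>M borel"
    unfolding Complex_eq by measurable
  interpret r: prob_space "density lborel (\<lambda>x. ennreal (normal_density (Re \<mu>) (sqrt (v / 2)) x))"
    using assms by (intro prob_space_normal_density) auto
  interpret i: prob_space "density lborel (\<lambda>x. ennreal (normal_density (Im \<mu>) (sqrt (v / 2)) x))"
    using assms by (intro prob_space_normal_density) auto
  interpret p: pair_prob_space "density lborel (\<lambda>x. ennreal (normal_density (Re \<mu>) (sqrt (v / 2)) x))"
     "density lborel (\<lambda>x. ennreal (normal_density (Im \<mu>) (sqrt (v / 2)) x))" ..
  show ?thesis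
    unfolding complex_gaussian_def by (intro p.prob_space_distr) measurable
qed

text \<open>Each part has variance v / 2, hence exponent -x^2 / v and normaliser 1 / sqrt (pi v);
  the two exponents add up to a squared modulus.\<close>

lemma complex_gaussian_eq_density:
  assumes "0 < v"
  shows "complex_gaussian \<mu> v = density lborel (cg_density \<mu> v)"
proof -
  have [measurable]: "(\<lambda>(x, y). Complex x y) \<in> lborel \<Otimes>\<^sub>M lborel \<rightarrow>\<^sub>M borel"
    unfolding Complex_eq by measurable
  interpret i: prob_space "density lborel (\<lambda>x. ennreal (normal_density (Im \<mu>) (sqrt (v / 2)) x))"
    using assms by (intro prob_space_normal_density) auto
  have eq: "normal_density (Re \<mu>) (sqrt (v / 2)) x * normal_density (Im \<mu>) (sqrt (v / 2)) y =
      cg_density \<mu> v (Complex x y)" for x y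
    using assms
    by (simp add: normal_density_def cg_density_def cmod_power2 exp_add[symmetric]
        field_simps real_sqrt_mult[symmetric])
  have "density lborel (\<lambda>x. ennreal (normal_density (Re \<mu>) (sqrt (v / 2)) x)) \<Otimes>\<^sub>M
        density lborel (\<lambda>x. ennreal (normal_density (Im \<mu>) (sqrt (v / 2)) x)) =
        density (lborel \<Otimes>\<^sub>M lborel) (\<lambda>(x, y). ennreal (cg_density \<mu> v (Complex x y)))"
    by (subst pair_measure_density)
      (auto simp: lborel.sigma_finite_measure_axioms i.sigma_finite_measure_axioms
         ennreal_mult[symmetric] eq)
  then show ?thesis
    unfolding complex_gaussian_def
    by (subst lborel_complex_eq_distr, subst density_distr) (auto simp: split_beta')
qed

lemma nn_integral_cg_density:
  assumes "0 < v" shows "(\<integral>\<^sup>+z. cg_density \<mu> v z \<partial>lborel) = 1"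
proof -
  interpret prob_space "density lborel (cg_density \<mu> v)"
    using prob_space_complex_gaussian[OF assms, of \<mu>] complex_gaussian_eq_density[OF assms] by simp
  show ?thesis using emeasure_space_1 by (simp add: emeasure_density)
qed

lemma nn_integral_complex_gaussian:
  fixes f :: "complex \<Rightarrow> ennreal"
  assumes "0 < v" and [measurable]: "f \<in> borel_measurable borel"
  shows "(\<integral>\<^sup>+z. f z \<partial>complex_gaussian \<mu> v) = (\<integral>\<^sup>+z. cg_density \<mu> v z * f z \<partial>lborel)"
  unfolding complex_gaussian_eq_density[OF assms(1)] by (subst nn_integral_density) auto

text \<open>The Jacobian of a real scaling is a square because the complex plane has real dimension
  two.\<close>

lemma nn_integral_complex_affine:
  fixes f :: "complex \<Rightarrow> ennreal"
  assumes [measurable]: "f \<in> borel_measurable borel" and "k \<noteq> 0"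
  shows "(\<integral>\<^sup>+z. f z \<partial>lborel) = ennreal (k\<^sup>2) * (\<integral>\<^sup>+z. f (t + complex_of_real k * z) \<partial>lborel)"
  by (subst lborel_affine[OF assms(2), of t])
     (simp add: nn_integral_density nn_integral_distr nn_integral_cmult scaleR_conv_of_real)

lemma distr_complex_gaussian_affine:
  assumes "0 < v" "k \<noteq> 0"
  shows "distr (complex_gaussian \<mu> v) borel (\<lambda>z. t + complex_of_real k * z) = complex_gaussian (t + k * \<mu>) (k\<^sup>2 * v)"
proof (rule measure_eqI)
  fix A :: "complex set" assume "A \<in> sets (distr (complex_gaussian \<mu> v) borel (\<lambda>z. t + complex_of_real k * z))"
  then have A[measurable]: "A \<in> sets borel" by simp
  have eq: "ennreal (k\<^sup>2) * (ennreal (cg_density (t + k * \<mu>) (k\<^sup>2 * v) (t + k * z)) * indicator A (t + k * z)) =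
      ennreal (cg_density \<mu> v z) * indicator A (t + k * z)" for z :: complex
  proof -
    have "t + k * z - (t + k * \<mu>) = k * (z - \<mu>)"
      by (simp add: algebra_simps)
    then have "cmod (t + k * z - (t + k * \<mu>)) = \<bar>k\<bar> * cmod (z - \<mu>)"
      by (simp only: norm_mult norm_of_real)
    then show ?thesis
      using assms by (auto simp: cg_density_def power_mult_distrib ennreal_mult[symmetric] split: split_indicator)
  qed
  have "emeasure (complex_gaussian (t + k * \<mu>) (k\<^sup>2 * v)) A =
      (\<integral>\<^sup>+z. indicator A z \<partial>complex_gaussian (t + k * \<mu>) (k\<^sup>2 * v))"
    by simp
  also have "\<dots> = (\<integral>\<^sup>+z. indicator A (t + k * z) \<partial>complex_gaussian \<mu> v)"
    using assms
    apply (simp add: nn_integral_complex_gaussian del: nn_integral_indicator)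
    apply (subst nn_integral_complex_affine[where k=k and t=t])
    apply (simp_all add: nn_integral_cmult[symmetric] eq del: nn_integral_indicator)
    done
  also have "\<dots> = emeasure (distr (complex_gaussian \<mu> v) borel (\<lambda>z. t + complex_of_real k * z)) A"
    by (subst nn_integral_indicator[symmetric], simp)
       (simp add: nn_integral_distr del: nn_integral_indicator)
  finally show "emeasure (distr (complex_gaussian \<mu> v) borel (\<lambda>z. t + complex_of_real k * z)) A =
      emeasure (complex_gaussian (t + k * \<mu>) (k\<^sup>2 * v)) A" ..
qed simp

text \<open>Cameron-Martin formula in one complex dimension: translating the noise is a change of
  density. The likelihood ratio \<open>noise_ratio\<close> is a product of such factors.\<close>

lemma nn_integral_complex_gaussian_shift:
  fixes f :: "complex \<Rightarrow> ennreal"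
  assumes "0 < v" and [measurable]: "f \<in> borel_measurable borel"
  shows "(\<integral>\<^sup>+z. f (z + \<mu>) \<partial>complex_gaussian 0 v) = 
    (\<integral>\<^sup>+z. f z * exp (((cmod z)\<^sup>2 - (cmod (z - \<mu>))\<^sup>2) / v) \<partial>complex_gaussian 0 v)"
proof -
  have "complex_gaussian \<mu> v = distr (complex_gaussian 0 v) borel (\<lambda>z. z + \<mu>)"
    using distr_complex_gaussian_affine[OF assms(1), of 1 0 \<mu>] by (simp add: add.commute)
  then have "(\<integral>\<^sup>+z. f (z + \<mu>) \<partial>complex_gaussian 0 v) = (\<integral>\<^sup>+z. f z \<partial>complex_gaussian \<mu> v)"
    by (simp add: nn_integral_distr)
  also have "\<dots> = (\<integral>\<^sup>+z. cg_density 0 v z * (f z * exp (((cmod z)\<^sup>2 - (cmod (z - \<mu>))\<^sup>2) / v)) \<partial>lborel)"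
  proof -
    have "cg_density \<mu> v z = cg_density 0 v z * exp (((cmod z)\<^sup>2 - (cmod (z - \<mu>))\<^sup>2) / v)" for z
      using assms by (simp add: cg_density_def exp_add[symmetric] diff_divide_distrib)
    then show ?thesis using assms(1)
      by (simp add: nn_integral_complex_gaussian ennreal_mult' mult.assoc mult.left_commute mult.commute)
  qed
  finally show ?thesis by (simp add: nn_integral_complex_gaussian assms(1))
qed


text \<open>A Gaussian density over the prior density, integrated against the prior: the
  normalisation of one factor of \<open>test_density\<close>, whatever the posterior mean
  \<open>m\<close> and variance \<open>C\<close>.\<close>

lemma nn_integral_complex_gaussian_reweight:
  assumes "0 < C" "0 < E"
  shows "(\<integral>\<^sup>+z. ennreal (cg_density m C z / cg_density 0 E z) \<partial>complex_gaussian 0 E) = 1"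
proof -
  have "cg_density 0 E z * (cg_density m C z / cg_density 0 E z) = cg_density m C z" for z
    using cg_density_pos[OF assms(2), of 0 z] by simp
  then show ?thesis
    using assms cg_density_pos[OF assms(2), THEN less_imp_le]
    by (simp add: nn_integral_complex_gaussian ennreal_mult'[symmetric] nn_integral_cg_density)
qed

section \<open>Moments of complex Gaussian laws\<close>

lemma nn_integral_normal_square:
  assumes "0 < \<sigma>"
  shows "(\<integral>\<^sup>+x. ennreal (x\<^sup>2) \<partial>density lborel (\<lambda>x. ennreal (normal_density 0 \<sigma> x))) = ennreal (\<sigma>\<^sup>2)"
proof -
  have "has_bochner_integral lborel (\<lambda>x. normal_density 0 \<sigma> x * x\<^sup>2) (\<sigma>\<^sup>2)"
    using normal_moment_even[OF assms, of 0 1] assms by simp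
  then have "(\<integral>\<^sup>+x. ennreal (normal_density 0 \<sigma> x * x\<^sup>2) \<partial>lborel) = ennreal (\<sigma>\<^sup>2)"
    by (subst nn_integral_eq_integral) (auto simp: has_bochner_integral_iff)
  then show ?thesis
    by (simp add: nn_integral_density ennreal_mult'')
qed

lemma nn_integral_complex_gaussian_square:
  assumes "0 < v"
  shows "(\<integral>\<^sup>+z. ennreal ((cmod z)\<^sup>2) \<partial>complex_gaussian 0 v) = ennreal v"
proof -
  define N where "N = density lborel (\<lambda>x. ennreal (normal_density 0 (sqrt (v / 2)) x))"
  have [measurable_cong, simp]: "sets N = sets borel" by (simp add: N_def)
  interpret N: prob_space N
    using assms unfolding N_def by (intro prob_space_normal_density) auto
  have sq: "(\<integral>\<^sup>+x. ennreal (x\<^sup>2) \<partial>N) = ennreal (v / 2)"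
    unfolding N_def using assms by (subst nn_integral_normal_square) auto
  have [measurable]: "(\<lambda>(x, y). Complex x y) \<in> borel \<Otimes>\<^sub>M borel \<rightarrow>\<^sub>M borel"
    unfolding Complex_eq by measurable
  have "(\<integral>\<^sup>+z. ennreal ((cmod z)\<^sup>2) \<partial>complex_gaussian 0 v) =
      (\<integral>\<^sup>+x. \<integral>\<^sup>+y. ennreal (x\<^sup>2) + ennreal (y\<^sup>2) \<partial>N \<partial>N)"
    unfolding complex_gaussian_def N_def[symmetric] zero_complex.simps
    by (subst nn_integral_distr, simp, simp, subst N.nn_integral_fst[symmetric])
       (auto simp: cmod_power2 ennreal_plus[symmetric] simp del: ennreal_plus)
  also have "\<dots> = ennreal (v / 2) + ennreal (v / 2)"
    by (simp add: nn_integral_add sq N.emeasure_space_1)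
  also have "\<dots> = ennreal v"
    using assms by (simp add: ennreal_plus[symmetric] del: ennreal_plus)
  finally show ?thesis .
qed

lemma integrable_complex_gaussian_square:
  assumes "0 < v"
  shows "integrable (complex_gaussian 0 v) (\<lambda>z. (cmod z)\<^sup>2)"
    "(\<integral>z. (cmod z)\<^sup>2 \<partial>complex_gaussian 0 v) = v"
proof -
  have "has_bochner_integral (complex_gaussian 0 v) (\<lambda>z. (cmod z)\<^sup>2) v"
    using assms by (intro has_bochner_integral_nn_integral nn_integral_complex_gaussian_square) auto
  then show "integrable (complex_gaussian 0 v) (\<lambda>z. (cmod z)\<^sup>2)"
    "(\<integral>z. (cmod z)\<^sup>2 \<partial>complex_gaussian 0 v) = v"
    by (auto simp: has_bochner_integral_iff)
qed

lemma integrable_complex_gaussian_id: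
  assumes "0 < v"
  shows "integrable (complex_gaussian 0 v) (\<lambda>z. z)"
proof -
  interpret prob_space "complex_gaussian 0 v" by (rule prob_space_complex_gaussian[OF assms])
  have "integrable (complex_gaussian 0 v) (\<lambda>z. 1 + (cmod z)\<^sup>2)"
    using integrable_complex_gaussian_square[OF assms] by simp
  then show ?thesis
  proof (rule Bochner_Integration.integrable_bound)
    have "cmod z \<le> 1 + (cmod z)\<^sup>2" for z
      using zero_le_power2[of "cmod z - 1"] norm_ge_zero[of z]
      unfolding power2_diff by (simp only: power_one mult_1_right)
    then show "AE z in complex_gaussian 0 v. norm z \<le> norm (1 + (cmod z)\<^sup>2)" by simp
  qed simp
qed

text \<open>The law is invariant under a change of sign, so its mean equals its own
  negative.\<close>

lemma integral_complex_gaussian_id: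
  assumes "0 < v" shows "(\<integral>z. z \<partial>complex_gaussian 0 v) = 0"
proof -
  have "(\<integral>z. z \<partial>complex_gaussian 0 v) = (\<integral>z. z \<partial>distr (complex_gaussian 0 v) borel (\<lambda>z. - z))"
    using distr_complex_gaussian_affine[OF assms, of "-1" 0 0] by simp
  also have "\<dots> = - (\<integral>z. z \<partial>complex_gaussian 0 v)"
    by (subst integral_distr) auto
  finally show ?thesis by simp
qed

section \<open>Joint law of the MMSE error and the MMSE estimate\<close>

lemma nn_integral_complex_translate:
  fixes f :: "complex \<Rightarrow> ennreal"
  assumes [measurable]: "f \<in> borel_measurable borel"
  shows "(\<integral>\<^sup>+z. f z \<partial>lborel) = (\<integral>\<^sup>+z. f (t + z) \<partial>lborel)"
  using nn_integral_complex_affine[OF assms, of 1 t] by simp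

text \<open>Bayes' rule for a Gaussian pair: completing the square turns the prior of \<open>h\<close> times the
  likelihood of \<open>y = t h + n\<close> into the evidence of \<open>y\<close> times the posterior of \<open>h\<close>.\<close>

lemma cg_density_bayes:
  fixes s N t :: real and h y :: complex
  assumes "0 < s" "0 < N"
  defines "A \<equiv> s * t\<^sup>2 + N"
  shows "cg_density 0 s h * cg_density 0 N (y - t * h) =
    cg_density 0 A y * cg_density 0 (s * N / A) (h - s * t / A * y)"
proof -
  have A: "0 < A" unfolding A_def using assms by (simp add: add_nonneg_pos)
  define a b c d where "a = Re h" "b = Im h" "c = Re y" "d = Im y"
  have A2: "A - s * t\<^sup>2 = N" by (simp add: A_def)
  \<comment> \<open>The square is completed for one real coordinate; adding the identity for real
    and imaginary parts gives the exponents, and \<open>A * (s * N / A) = s * N\<close> matches the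
    normalisers.\<close>
  have real: "x\<^sup>2 / s + (u - t * x)\<^sup>2 / N = u\<^sup>2 / A + (x - s * t / A * u)\<^sup>2 / (s * N / A)" for x u :: real
  proof -
    have "(x - s * t / A * u)\<^sup>2 / (s * N / A) = (A * x - s * t * u)\<^sup>2 / (s * N * A)"
      using A assms(1,2) by (simp add: field_simps power2_eq_square)
    also have "\<dots> = x\<^sup>2 * A / (s * N) - 2 * x * t * u / N + s * t\<^sup>2 * u\<^sup>2 / (N * A)"
      using A assms(1,2) by (simp add: field_simps power2_eq_square)
    also have "s * t\<^sup>2 * u\<^sup>2 / (N * A) = u\<^sup>2 / N - u\<^sup>2 / A"
      using A assms(1,2) unfolding A_def by (simp add: field_simps power2_eq_square)
    also have "x\<^sup>2 * A / (s * N) = x\<^sup>2 * t\<^sup>2 / N + x\<^sup>2 / s"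
      using A assms(1,2) unfolding A_def by (simp add: field_simps power2_eq_square)
    finally have "(x - s * t / A * u)\<^sup>2 / (s * N / A) =
        x\<^sup>2 * t\<^sup>2 / N + x\<^sup>2 / s - 2 * x * t * u / N + (u\<^sup>2 / N - u\<^sup>2 / A)" .
    moreover have "(u - t * x)\<^sup>2 / N = u\<^sup>2 / N - 2 * x * t * u / N + x\<^sup>2 * t\<^sup>2 / N"
      using assms(2) by (simp add: field_simps power2_eq_square)
    ultimately show ?thesis by simp
  qed
  have *: "(cmod h)\<^sup>2 / s + (cmod (y - t * h))\<^sup>2 / N =
      (cmod y)\<^sup>2 / A + (cmod (h - s * t / A * y))\<^sup>2 / (s * N / A)"
    using real[of "Re h" "Re y"] real[of "Im h" "Im y"]
    by (simp add: cmod_power2 add_divide_distrib distrib_right)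
  have "A * (s * N / A) = s * N" using A by simp
  then show ?thesis
    unfolding cg_density_def diff_0_right
    by (simp only: times_divide_times_eq exp_add[symmetric] minus_divide_left[symmetric] minus_add_distrib[symmetric] *)
       (simp add: A[THEN less_imp_neq, symmetric] mult.left_commute mult.commute)
qed

text \<open>By \<open>cg_density_bayes\<close>, given the pilot observation \<open>y\<close> the law
  of \<open>h\<close> is Gaussian with mean \<open>k * y\<close> and a variance that does not
  involve \<open>y\<close>. Subtracting the mean leaves an error whose law is the same for all
  \<open>y\<close>: error and estimate are independent.\<close>

lemma distr_complex_gaussian_mmse:
  fixes s N t :: real
  assumes "0 < s" "0 < N" "0 < t"
  defines "A \<equiv> s * t\<^sup>2 + N" and "k \<equiv> s * t / (s * t\<^sup>2 + N)"
  shows "distr (complex_gaussian 0 s \<Otimes>\<^sub>M complex_gaussian 0 N) (borel \<Otimes>\<^sub>M borel)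
     (\<lambda>(h, n). (h - k * (t * h + n), k * (t * h + n))) =
    complex_gaussian 0 (s * N / A) \<Otimes>\<^sub>M complex_gaussian 0 (k\<^sup>2 * A)" (is "?L = ?R")
proof (rule measure_eqI)
  have A: "0 < A" unfolding A_def using assms by (simp add: add_nonneg_pos)
  have k: "k \<noteq> 0" "k = s * t / A" using A assms by (auto simp: A_def)
  interpret s: prob_space "complex_gaussian 0 s" using assms by (intro prob_space_complex_gaussian)
  interpret N: prob_space "complex_gaussian 0 N" using assms by (intro prob_space_complex_gaussian)
  interpret v: prob_space "complex_gaussian 0 (s * N / A)" using assms A by (intro prob_space_complex_gaussian) simp
  interpret e: prob_space "complex_gaussian 0 (k\<^sup>2 * A)" using k A by (intro prob_space_complex_gaussian) simp
  interpret ve: pair_prob_space "complex_gaussian 0 (s * N / A)" "complex_gaussian 0 (k\<^sup>2 * A)" ..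
  show "sets ?L = sets ?R" by (simp cong: sets_pair_measure_cong)
  fix S assume "S \<in> sets ?L"
  then have S[measurable]: "S \<in> sets (borel \<Otimes>\<^sub>M borel)" by simp
  define f :: "complex \<Rightarrow> complex \<Rightarrow> ennreal" where "f h y = indicator S (h, y)" for h y
  have f[measurable]: "(\<lambda>x. f (p x) (r x)) \<in> borel_measurable M"
    if [measurable]: "p \<in> borel_measurable M" "r \<in> borel_measurable M" for p r and M :: "'z measure"
    unfolding f_def by measurable
  define T K where "T = complex_of_real t" and "K = complex_of_real k"
  \<comment> \<open>Two translations: at fixed \<open>h\<close> the variable \<open>n\<close> gives
    way to \<open>y = T * h + n\<close>; in \<open>tr2\<close>, at fixed \<open>y\<close>, the
    variable \<open>h\<close> gives way to the error \<open>h - K * y\<close>.\<close>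
  have tr1: "(\<integral>\<^sup>+n. cg_density 0 N n * f (h - K * (T * h + n)) (K * (T * h + n)) \<partial>lborel) =
      (\<integral>\<^sup>+y. cg_density 0 N (y - T * h) * f (h - K * y) (K * y) \<partial>lborel)" for h
    by (subst (2) nn_integral_complex_translate[where t="T * h"]) simp_all
  have tr2: "(\<integral>\<^sup>+h. (cg_density 0 A y * cg_density 0 (s * N / A) (h - K * y)) * f (h - K * y) (K * y) \<partial>lborel) =
      (\<integral>\<^sup>+e. (cg_density 0 A y * cg_density 0 (s * N / A) e) * f e (K * y) \<partial>lborel)" for y
    by (subst nn_integral_complex_translate[where t="K * y"]) simp_all
  have "emeasure ?L S = (\<integral>\<^sup>+x. indicator S x \<partial>?L)" by simp
  also have "\<dots> = (\<integral>\<^sup>+h. \<integral>\<^sup>+n. f (h - K * (T * h + n)) (K * (T * h + n)) \<partial>complex_gaussian 0 N \<partial>complex_gaussian 0 s)"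
    unfolding f_def T_def K_def
    by (subst nn_integral_distr, measurable, subst N.nn_integral_fst[symmetric]) (auto simp: split_beta')
  also have "\<dots> = (\<integral>\<^sup>+h. cg_density 0 s h * (\<integral>\<^sup>+n. cg_density 0 N n * f (h - K * (T * h + n)) (K * (T * h + n)) \<partial>lborel) \<partial>lborel)"
    using assms(1,2) by (simp add: nn_integral_complex_gaussian)
  also have "\<dots> = (\<integral>\<^sup>+h. cg_density 0 s h * (\<integral>\<^sup>+y. cg_density 0 N (y - T * h) * f (h - K * y) (K * y) \<partial>lborel) \<partial>lborel)"
    by (simp only: tr1)
  also have "\<dots> = (\<integral>\<^sup>+h. \<integral>\<^sup>+y. (cg_density 0 s h * cg_density 0 N (y - T * h)) * f (h - K * y) (K * y) \<partial>lborel \<partial>lborel)"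
    using assms(1,2) by (simp add: nn_integral_cmult[symmetric] ennreal_mult mult.assoc)
  also have "\<dots> = (\<integral>\<^sup>+h. \<integral>\<^sup>+y. (cg_density 0 A y * cg_density 0 (s * N / A) (h - K * y)) * f (h - K * y) (K * y) \<partial>lborel \<partial>lborel)"
    unfolding cg_density_bayes[OF assms(1,2)] A_def[symmetric] K_def k(2) T_def by simp
  also have "\<dots> = (\<integral>\<^sup>+y. \<integral>\<^sup>+h. (cg_density 0 A y * cg_density 0 (s * N / A) (h - K * y)) * f (h - K * y) (K * y) \<partial>lborel \<partial>lborel)"
    by (rule lborel_pair.Fubini') measurable
  also have "\<dots> = (\<integral>\<^sup>+y. \<integral>\<^sup>+e. (cg_density 0 A y * cg_density 0 (s * N / A) e) * f e (K * y) \<partial>lborel \<partial>lborel)"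
    by (simp only: tr2)
  also have "\<dots> = (\<integral>\<^sup>+y. \<integral>\<^sup>+e. f e (K * y) \<partial>complex_gaussian 0 (s * N / A) \<partial>complex_gaussian 0 A)"
    using A assms(1,2) by (simp add: nn_integral_complex_gaussian nn_integral_cmult[symmetric] ennreal_mult mult.assoc)
  also have "\<dots> = (\<integral>\<^sup>+z. \<integral>\<^sup>+e. f e z \<partial>complex_gaussian 0 (s * N / A) \<partial>complex_gaussian 0 (k\<^sup>2 * A))"
    using distr_complex_gaussian_affine[OF A k(1), of 0 0, symmetric]
    by (simp add: nn_integral_distr K_def)
  also have "\<dots> = (\<integral>\<^sup>+x. indicator S x \<partial>?R)"
    by (subst ve.Fubini', simp, subst e.nn_integral_fst[symmetric]) (auto simp: f_def[abs_def])
  finally show "emeasure ?L S = emeasure ?R S"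
    by (simp cong: sets_pair_measure_cong)
qed

section \<open>A variational lower bound on mutual information\<close>

text \<open>This is \<open>ln x \<le> x - 1\<close> at \<open>x = u / s\<close>, multiplied by
  \<open>s\<close>: Gibbs' inequality before integration. It serves three times below, for the
  negative part of the information density, for its positive part, and for the comparison with
  \<open>R\<close>.\<close>

lemma mult_ln_le:
  fixes s u :: real
  assumes "0 \<le> s" "0 < u"
  shows "s * ln u \<le> s * ln s - s + u"
proof (cases "s = 0")
  case False
  then have s: "0 < s" using assms by simp
  have "s * ln (u / s) \<le> s * (u / s - 1)"
    using s assms by (intro mult_left_mono ln_le_minus_one) auto
  then show ?thesis
    using s assms by (simp add: ln_div right_diff_distrib)
qed (use assms in simp)

text \<open>\<open>W\<close> is a finer observation than \<open>\<zeta>(W)\<close>; its density \<open>s\<close> and the reference law \<open>\<rho>\<close> serve only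
  to make the information density integrable.\<close>

lemma (in information_space) mutual_information_ge_test_density:
  fixes s :: "'x \<times> 'w \<Rightarrow> real" and R :: "'x \<times> 'v \<Rightarrow> real"
  assumes [measurable]: "X \<in> M \<rightarrow>\<^sub>M S" "W \<in> M \<rightarrow>\<^sub>M U" "\<zeta> \<in> U \<rightarrow>\<^sub>M T"
    and \<rho>: "prob_space \<rho>" "sets \<rho> = sets U"
    and s[measurable]: "s \<in> borel_measurable (S \<Otimes>\<^sub>M U)" and s_pos: "\<And>z. 0 < s z"
    and law: "distr M (S \<Otimes>\<^sub>M U) (\<lambda>\<omega>. (X \<omega>, W \<omega>)) = density (distr M S X \<Otimes>\<^sub>M \<rho>) s"
    and int_s: "integrable M (\<lambda>\<omega>. ln (s (X \<omega>, W \<omega>)))"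
    and R[measurable]: "R \<in> borel_measurable (S \<Otimes>\<^sub>M T)" and R_pos: "\<And>z. 0 < R z"
    and R_le: "\<And>v. v \<in> space T \<Longrightarrow> (\<integral>\<^sup>+x. R (x, v) \<partial>distr M S X) \<le> 1"
    and int_R: "integrable M (\<lambda>\<omega>. ln (R (X \<omega>, \<zeta> (W \<omega>))))"
  shows "(\<integral>\<omega>. log b (R (X \<omega>, \<zeta> (W \<omega>))) \<partial>M) \<le> mutual_information b S T X (\<lambda>\<omega>. \<zeta> (W \<omega>))"
proof -
  define PX where "PX = distr M S X"
  define PV where "PV = distr M T (\<lambda>\<omega>. \<zeta> (W \<omega>))"
  define PW where "PW = distr M U W"
  define N where "N = distr M (S \<Otimes>\<^sub>M T) (\<lambda>\<omega>. (X \<omega>, \<zeta> (W \<omega>)))"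
  have [measurable_cong, simp]: "sets PX = sets S" "sets PV = sets T" "sets PW = sets U"
    "sets N = sets (S \<Otimes>\<^sub>M T)"
    by (simp_all add: PX_def PV_def PW_def N_def)
  note \<rho>(2)[measurable_cong, simp]
  have [simp]: "space PV = space T" "space PW = space U" "space \<rho> = space U"
    using sets_eq_imp_space_eq[OF \<rho>(2)] by (simp_all add: PV_def PW_def)
  interpret PX: prob_space PX unfolding PX_def by (rule prob_space_distr) simp
  interpret PV: prob_space PV unfolding PV_def by (rule prob_space_distr) simp
  interpret PW: prob_space PW unfolding PW_def by (rule prob_space_distr) simp
  interpret N: prob_space N unfolding N_def by (rule prob_space_distr) simp
  interpret \<rho>: prob_space \<rho> by fact
  interpret XV: pair_prob_space PX PV ..
  interpret X\<rho>: pair_prob_space PX \<rho> ..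
  interpret XW: pair_prob_space PX PW ..
  have law': "distr M (S \<Otimes>\<^sub>M U) (\<lambda>\<omega>. (X \<omega>, W \<omega>)) = density (PX \<Otimes>\<^sub>M \<rho>) s"
    using law by (simp add: PX_def)
  have nn_law: "(\<integral>\<^sup>+\<omega>. f (X \<omega>, W \<omega>) \<partial>M) = (\<integral>\<^sup>+w. \<integral>\<^sup>+x. ennreal (s (x, w)) * f (x, w) \<partial>PX \<partial>\<rho>)"
    if [measurable]: "f \<in> borel_measurable (S \<Otimes>\<^sub>M U)" for f :: "'x \<times> 'w \<Rightarrow> ennreal"
  proof -
    have "(\<integral>\<^sup>+\<omega>. f (X \<omega>, W \<omega>) \<partial>M) = (\<integral>\<^sup>+z. f z \<partial>distr M (S \<Otimes>\<^sub>M U) (\<lambda>\<omega>. (X \<omega>, W \<omega>)))"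
      by (simp add: nn_integral_distr)
    also have "\<dots> = (\<integral>\<^sup>+z. ennreal (s z) * f z \<partial>(PX \<Otimes>\<^sub>M \<rho>))"
      unfolding law' by (simp add: nn_integral_density)
    also have "\<dots> = (\<integral>\<^sup>+w. \<integral>\<^sup>+x. ennreal (s (x, w)) * f (x, w) \<partial>PX \<partial>\<rho>)"
      by (simp add: X\<rho>.nn_integral_snd[symmetric])
    finally show ?thesis .
  qed
  \<comment> \<open>The density of the fine observation \<open>W\<close> relative to
    \<open>\<rho>\<close>, obtained by integrating the data out of \<open>s\<close>.\<close>
  define t where "t w = (\<integral>\<^sup>+x. ennreal (s (x, w)) \<partial>PX)" for w
  have t[measurable]: "t \<in> borel_measurable U" unfolding t_def by measurable
  have nn_W: "(\<integral>\<^sup>+w. f w \<partial>PW) = (\<integral>\<^sup>+w. t w * f w \<partial>\<rho>)"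
    if [measurable]: "f \<in> borel_measurable U" for f :: "'w \<Rightarrow> ennreal"
  proof -
    have "(\<integral>\<^sup>+w. f w \<partial>PW) = (\<integral>\<^sup>+\<omega>. f (W \<omega>) \<partial>M)" by (simp add: PW_def nn_integral_distr)
    also have "\<dots> = (\<integral>\<^sup>+w. \<integral>\<^sup>+x. ennreal (s (x, w)) * f w \<partial>PX \<partial>\<rho>)"
      using nn_law[of "\<lambda>z. f (snd z)"] by simp
    also have "\<dots> = (\<integral>\<^sup>+w. t w * f w \<partial>\<rho>)"
    proof (rule nn_integral_cong)
      fix w assume "w \<in> space \<rho>"
      then have [measurable]: "w \<in> space U" by simp
      show "(\<integral>\<^sup>+x. ennreal (s (x, w)) * f w \<partial>PX) = t w * f w"
        unfolding t_def by (rule nn_integral_multc) measurable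
    qed
    finally show ?thesis .
  qed
  have PW: "PW = density \<rho> t"
  proof (rule measure_eqI)
    fix A assume "A \<in> sets PW"
    then have [measurable]: "A \<in> sets U" by simp
    show "emeasure PW A = emeasure (density \<rho> t) A"
      using nn_W[of "indicator A"] by (simp add: emeasure_density)
  qed simp
  \<comment> \<open>Since \<open>s\<close> is strictly positive, so is \<open>t\<close>; the law of
    \<open>W\<close> and \<open>\<rho>\<close> therefore have the same null sets.\<close>
  have t_pos: "0 < t w" if [measurable]: "w \<in> space U" for w
  proof (rule ccontr)
    assume "\<not> 0 < t w"
    then have "(\<integral>\<^sup>+x. ennreal (s (x, w)) \<partial>PX) = 0" by (simp add: t_def)
    then have "AE x in PX. ennreal (s (x, w)) = 0"
      by (subst (asm) nn_integral_0_iff_AE) measurable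
    moreover have "ennreal (s (x, w)) \<noteq> 0" for x using s_pos[of "(x, w)"] by simp
    ultimately have "AE x in PX. False" by simp
    then show False using PX.AE_False by simp
  qed
  have t_fin: "AE w in \<rho>. t w \<noteq> \<infinity>"
  proof (rule nn_integral_PInf_AE)
    show "(\<integral>\<^sup>+w. t w \<partial>\<rho>) \<noteq> \<infinity>"
      using nn_W[of "\<lambda>_. 1"] PW.emeasure_space_1 by simp
  qed simp
  have nn_V: "(\<integral>\<^sup>+v. f v \<partial>PV) = (\<integral>\<^sup>+w. f (\<zeta> w) \<partial>PW)"
    if [measurable]: "f \<in> borel_measurable T" for f :: "'v \<Rightarrow> ennreal"
    by (simp add: PV_def PW_def nn_integral_distr)

  \<comment> \<open>A null set of the product of the marginals has null sections at almost every
    \<open>v\<close>, hence at \<open>\<zeta> w\<close> for \<open>\<rho>\<close>-almost every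
    \<open>w\<close> because \<open>t > 0\<close>. Integrating these sections with the density
    \<open>s\<close> shows that the joint law does not charge the set.\<close>
  have ac: "absolutely_continuous (PX \<Otimes>\<^sub>M PV) N"
  proof (unfold absolutely_continuous_def, intro subsetI)
    fix A assume "A \<in> null_sets (PX \<Otimes>\<^sub>M PV)"
    then have "A \<in> sets (PX \<Otimes>\<^sub>M PV)" and A0: "emeasure (PX \<Otimes>\<^sub>M PV) A = 0" by auto
    then have A[measurable]: "A \<in> sets (S \<Otimes>\<^sub>M T)" by (simp cong: sets_pair_measure_cong)
    have "(\<integral>\<^sup>+w. (\<integral>\<^sup>+x. indicator A (x, \<zeta> w) \<partial>PX) \<partial>PW) = (\<integral>\<^sup>+v. (\<integral>\<^sup>+x. indicator A (x, v) \<partial>PX) \<partial>PV)"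
      by (subst nn_V) measurable
    also have "\<dots> = (\<integral>\<^sup>+z. indicator A z \<partial>(PX \<Otimes>\<^sub>M PV))"
      by (subst XV.nn_integral_snd) measurable
    also have "\<dots> = 0" using A0 by simp
    finally have "AE w in PW. (\<integral>\<^sup>+x. indicator A (x, \<zeta> w) \<partial>PX) = (0 :: ennreal)"
      by (subst (asm) nn_integral_0_iff_AE) measurable
    then have "AE w in \<rho>. 0 < t w \<longrightarrow> (\<integral>\<^sup>+x. indicator A (x, \<zeta> w) \<partial>PX) = (0 :: ennreal)"
      unfolding PW by (subst (asm) AE_density) auto
    then have "AE w in \<rho>. (\<integral>\<^sup>+x. ennreal (s (x, w)) * indicator A (x, \<zeta> w) \<partial>PX) = 0"
      using AE_space
    proof eventually_elim
      case (elim w)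
      then have w[measurable]: "w \<in> space U" by simp
      then have "AE x in PX. indicator A (x, \<zeta> w) = (0 :: ennreal)"
        using elim t_pos measurable_space[OF \<open>\<zeta> \<in> U \<rightarrow>\<^sub>M T\<close>, of w]
        by (subst (asm) nn_integral_0_iff_AE) auto
      then show ?case
        by (subst nn_integral_0_iff_AE) (use measurable_space[OF \<open>\<zeta> \<in> U \<rightarrow>\<^sub>M T\<close>, of w] in auto)
    qed
    then have "(\<integral>\<^sup>+w. \<integral>\<^sup>+x. ennreal (s (x, w)) * indicator A (x, \<zeta> w) \<partial>PX \<partial>\<rho>) = 0"
      by (subst nn_integral_0_iff_AE) measurable
    then have "(\<integral>\<^sup>+\<omega>. indicator A (X \<omega>, \<zeta> (W \<omega>)) \<partial>M) = 0"
      using nn_law[of "\<lambda>z. indicator A (fst z, \<zeta> (snd z))"] by simp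
    then have "(\<integral>\<^sup>+z. indicator A z \<partial>N) = 0"
      by (simp add: N_def nn_integral_distr del: nn_integral_indicator)
    then show "A \<in> null_sets N" by (auto simp: null_sets_def)
  qed

  \<comment> \<open>By \<open>XV.RN_deriv_finite\<close> the Radon-Nikodym derivative is finite
    almost everywhere, so passing to real values changes it only on a null set.\<close>
  define r where "r z = enn2real (RN_deriv (PX \<Otimes>\<^sub>M PV) N z)" for z
  have r[measurable]: "r \<in> borel_measurable (S \<Otimes>\<^sub>M T)"
  proof -
    have "r \<in> borel_measurable (PX \<Otimes>\<^sub>M PV)" unfolding r_def by measurable
    then show ?thesis by (simp cong: measurable_cong_sets sets_pair_measure_cong)
  qed
  have r_nn[simp]: "0 \<le> r z" for z by (simp add: r_def)
  have setsN: "sets N = sets (PX \<Otimes>\<^sub>M PV)" by (simp cong: sets_pair_measure_cong)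
  have N: "N = density (PX \<Otimes>\<^sub>M PV) r"
  proof -
    have "AE z in PX \<Otimes>\<^sub>M PV. RN_deriv (PX \<Otimes>\<^sub>M PV) N z \<noteq> \<infinity>"
      by (rule XV.RN_deriv_finite[OF N.sigma_finite_measure_axioms ac setsN])
    then have "density (PX \<Otimes>\<^sub>M PV) (RN_deriv (PX \<Otimes>\<^sub>M PV) N) = density (PX \<Otimes>\<^sub>M PV) r"
      by (intro density_cong) (auto simp: r_def less_top)
    then show ?thesis using XV.density_RN_deriv[OF ac setsN] by simp
  qed
  have nn_N: "(\<integral>\<^sup>+z. f z \<partial>N) = (\<integral>\<^sup>+z. ennreal (r z) * f z \<partial>(PX \<Otimes>\<^sub>M PV))"
    if [measurable]: "f \<in> borel_measurable (S \<Otimes>\<^sub>M T)" for f :: "'x \<times> 'v \<Rightarrow> ennreal"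
    unfolding N by (simp add: nn_integral_density)
  have nn_r: "(\<integral>\<^sup>+z. ennreal (r z) \<partial>(PX \<Otimes>\<^sub>M PV)) = 1"
    using nn_N[of "\<lambda>_. 1"] N.emeasure_space_1 by simp

  \<comment> \<open>The case \<open>u = 1\<close> of \<open>mult_ln_le\<close>. It bounds the
    negative part of the information density by 1 in expectation, whatever the joint law.\<close>
  have minus_le: "x * max 0 (- ln x) \<le> 1" if "0 \<le> x" for x :: real
    using mult_ln_le[OF that, of 1] that by (auto simp: max_def)
  have neg: "(\<integral>\<^sup>+z. ennreal (max 0 (- ln (r z))) \<partial>N) \<le> 1"
  proof -
    have "(\<integral>\<^sup>+z. ennreal (max 0 (- ln (r z))) \<partial>N) \<le> (\<integral>\<^sup>+z. 1 \<partial>(PX \<Otimes>\<^sub>M PV))"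
    proof (subst nn_N, measurable, rule nn_integral_mono)
      fix z
      have "ennreal (r z) * ennreal (max 0 (- ln (r z))) = ennreal (r z * max 0 (- ln (r z)))"
        by (rule ennreal_mult[symmetric]) auto
      also have "\<dots> \<le> ennreal 1" by (intro ennreal_leI minus_le) simp
      finally show "ennreal (r z) * ennreal (max 0 (- ln (r z))) \<le> 1" by simp
    qed
    then show ?thesis using XV.emeasure_space_1 by simp
  qed
  \<comment> \<open>Information lost by \<open>\<zeta>\<close> cannot make the positive part
    infinite: \<open>r\<close> is compared with the ratio \<open>s / \<tau>\<close> of the fine
    observation. Taking \<open>u = max 1 r * \<tau>\<close> in \<open>mult_ln_le\<close> leaves
    three integrals: that of \<open>s * \<bar>ln s\<bar>\<close>, finite by \<open>int_s\<close>;
    that of \<open>\<tau> * (1 + r)\<close>, equal to 2; and that of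
    \<open>s * max 0 (- ln \<tau>)\<close>, at most 1 by \<open>minus_le\<close> once
    \<open>x\<close> is integrated out.\<close>
  have pos: "(\<integral>\<^sup>+z. ennreal (ln (max 1 (r z))) \<partial>N) < \<infinity>"
  proof -
    define \<tau> where "\<tau> w = enn2real (t w)" for w
    have [measurable]: "\<tau> \<in> borel_measurable U" unfolding \<tau>_def by measurable
    have t\<tau>: "AE w in \<rho>. t w = ennreal (\<tau> w) \<and> 0 < \<tau> w"
      using t_fin AE_space
      by eventually_elim (use t_pos in \<open>auto simp: \<tau>_def less_top enn2real_positive_iff\<close>)
    have "(\<integral>\<^sup>+z. ennreal (ln (max 1 (r z))) \<partial>N) = (\<integral>\<^sup>+\<omega>. ennreal (ln (max 1 (r (X \<omega>, \<zeta> (W \<omega>))))) \<partial>M)"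
      by (simp add: N_def nn_integral_distr)
    also have "\<dots> = (\<integral>\<^sup>+w. \<integral>\<^sup>+x. ennreal (s (x, w)) * ennreal (ln (max 1 (r (x, \<zeta> w)))) \<partial>PX \<partial>\<rho>)"
      using nn_law[of "\<lambda>z. ennreal (ln (max 1 (r (fst z, \<zeta> (snd z)))))"] by simp
    also have "\<dots> \<le> (\<integral>\<^sup>+w. \<integral>\<^sup>+x. ennreal (s (x, w)) * ennreal \<bar>ln (s (x, w))\<bar> +
        (ennreal (\<tau> w) * (1 + ennreal (r (x, \<zeta> w))) + ennreal (s (x, w)) * ennreal (max 0 (- ln (\<tau> w)))) \<partial>PX \<partial>\<rho>)"
    proof (intro nn_integral_mono_AE, use t\<tau> in eventually_elim, intro nn_integral_mono)
      fix w x assume w: "t w = ennreal (\<tau> w) \<and> 0 < \<tau> w"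
      let ?s = "s (x, w)" and ?u = "max 1 (r (x, \<zeta> w))"
      have s: "0 < ?s" by (rule s_pos)
      have "?s * ln ?u = ?s * ln (?u * \<tau> w) - ?s * ln (\<tau> w)"
        using w by (subst ln_mult) (auto simp: algebra_simps)
      also have "\<dots> \<le> ?s * ln ?s - ?s + ?u * \<tau> w - ?s * ln (\<tau> w)"
        using w s by (intro diff_right_mono mult_ln_le) auto
      also have "\<dots> \<le> ?s * \<bar>ln ?s\<bar> + (\<tau> w * (1 + r (x, \<zeta> w)) + ?s * max 0 (- ln (\<tau> w)))"
      proof -
        have "?s * ln ?s \<le> ?s * \<bar>ln ?s\<bar>" "?u * \<tau> w \<le> (1 + r (x, \<zeta> w)) * \<tau> w"
          using s w by (auto intro!: mult_left_mono mult_right_mono)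
        moreover have "?s * (- ln (\<tau> w)) \<le> ?s * max 0 (- ln (\<tau> w))"
          using s by (intro mult_left_mono) auto
        ultimately show ?thesis using s by (simp only: distrib_left distrib_right mult.commute[of _ "\<tau> w"] mult_minus_right mult_1_right mult_1_left)
      qed
      finally have "ennreal (?s * ln ?u) \<le> ennreal (?s * \<bar>ln ?s\<bar> + (\<tau> w * (1 + r (x, \<zeta> w)) + ?s * max 0 (- ln (\<tau> w))))"
        by (rule ennreal_leI)
      moreover have "ennreal (?s * ln ?u) = ennreal ?s * ennreal (ln ?u)"
        using s by (intro ennreal_mult) auto
      moreover have "ennreal (?s * \<bar>ln ?s\<bar> + (\<tau> w * (1 + r (x, \<zeta> w)) + ?s * max 0 (- ln (\<tau> w)))) =
        ennreal ?s * ennreal \<bar>ln ?s\<bar> + (ennreal (\<tau> w) * (1 + ennreal (r (x, \<zeta> w))) + ennreal ?s * ennreal (max 0 (- ln (\<tau> w))))"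
        using s w by (simp only: ennreal_mult ennreal_plus ennreal_1 r_nn less_imp_le abs_ge_zero max.cobounded1
            mult_nonneg_nonneg add_nonneg_nonneg zero_le_one)
      ultimately show "ennreal ?s * ennreal (ln ?u) \<le> ennreal ?s * ennreal \<bar>ln ?s\<bar> +
        (ennreal (\<tau> w) * (1 + ennreal (r (x, \<zeta> w))) + ennreal ?s * ennreal (max 0 (- ln (\<tau> w))))" by simp
    qed
    also have "\<dots> = (\<integral>\<^sup>+w. \<integral>\<^sup>+x. ennreal (s (x, w)) * ennreal \<bar>ln (s (x, w))\<bar> \<partial>PX \<partial>\<rho>) +
       ((\<integral>\<^sup>+w. \<integral>\<^sup>+x. ennreal (\<tau> w) * (1 + ennreal (r (x, \<zeta> w))) \<partial>PX \<partial>\<rho>) +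
        (\<integral>\<^sup>+w. \<integral>\<^sup>+x. ennreal (s (x, w)) * ennreal (max 0 (- ln (\<tau> w))) \<partial>PX \<partial>\<rho>))"
    proof -
      have split: "(\<integral>\<^sup>+w. \<integral>\<^sup>+x. f (x, w) + g (x, w) \<partial>PX \<partial>\<rho>) =
          (\<integral>\<^sup>+w. \<integral>\<^sup>+x. f (x, w) \<partial>PX \<partial>\<rho>) + (\<integral>\<^sup>+w. \<integral>\<^sup>+x. g (x, w) \<partial>PX \<partial>\<rho>)"
        if [measurable]: "f \<in> borel_measurable (S \<Otimes>\<^sub>M U)" "g \<in> borel_measurable (S \<Otimes>\<^sub>M U)" for f g :: "'x \<times> 'w \<Rightarrow> ennreal"
        by (simp add: X\<rho>.nn_integral_snd X\<rho>.nn_integral_snd[where f="\<lambda>z. f z + g z"] nn_integral_add)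
      show ?thesis
        using split[of "\<lambda>z. ennreal (s z) * ennreal \<bar>ln (s z)\<bar>"
            "\<lambda>z. ennreal (\<tau> (snd z)) * (1 + ennreal (r (fst z, \<zeta> (snd z)))) + ennreal (s z) * ennreal (max 0 (- ln (\<tau> (snd z))))"]
          split[of "\<lambda>z. ennreal (\<tau> (snd z)) * (1 + ennreal (r (fst z, \<zeta> (snd z))))"
            "\<lambda>z. ennreal (s z) * ennreal (max 0 (- ln (\<tau> (snd z))))"]
        by simp
    qed
    also have "\<dots> < \<infinity>"
    proof -
      have "(\<integral>\<^sup>+w. \<integral>\<^sup>+x. ennreal (s (x, w)) * ennreal \<bar>ln (s (x, w))\<bar> \<partial>PX \<partial>\<rho>) =
          (\<integral>\<^sup>+\<omega>. ennreal \<bar>ln (s (X \<omega>, W \<omega>))\<bar> \<partial>M)"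
        using nn_law[of "\<lambda>z. ennreal \<bar>ln (s z)\<bar>"] by simp
      also have "\<dots> < \<infinity>" using int_s by (simp add: integrable_iff_bounded)
      finally have 1: "(\<integral>\<^sup>+w. \<integral>\<^sup>+x. ennreal (s (x, w)) * ennreal \<bar>ln (s (x, w))\<bar> \<partial>PX \<partial>\<rho>) < \<infinity>" .
      have "(\<integral>\<^sup>+w. \<integral>\<^sup>+x. ennreal (\<tau> w) * (1 + ennreal (r (x, \<zeta> w))) \<partial>PX \<partial>\<rho>) =
          (\<integral>\<^sup>+w. t w * (\<integral>\<^sup>+x. (1 + ennreal (r (x, \<zeta> w))) \<partial>PX) \<partial>\<rho>)"
      proof (intro nn_integral_cong_AE, use t\<tau> AE_space in eventually_elim)
        fix w assume "t w = ennreal (\<tau> w) \<and> 0 < \<tau> w" and w[measurable]: "w \<in> space \<rho>"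
        then show "(\<integral>\<^sup>+x. ennreal (\<tau> w) * (1 + ennreal (r (x, \<zeta> w))) \<partial>PX) =
            t w * (\<integral>\<^sup>+x. (1 + ennreal (r (x, \<zeta> w))) \<partial>PX)"
          using measurable_space[OF \<open>\<zeta> \<in> U \<rightarrow>\<^sub>M T\<close>, of w]
          by (subst nn_integral_cmult) auto
      qed
      also have "\<dots> = (\<integral>\<^sup>+v. (\<integral>\<^sup>+x. 1 + ennreal (r (x, v)) \<partial>PX) \<partial>PV)"
        by (simp add: nn_V nn_W)
      also have "\<dots> = (\<integral>\<^sup>+z. 1 + ennreal (r z) \<partial>(PX \<Otimes>\<^sub>M PV))"
        by (subst XV.nn_integral_snd[symmetric]) auto
      also have "\<dots> = 2"
        using XV.emeasure_space_1 by (simp add: nn_integral_add nn_r)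
      finally have 2: "(\<integral>\<^sup>+w. \<integral>\<^sup>+x. ennreal (\<tau> w) * (1 + ennreal (r (x, \<zeta> w))) \<partial>PX \<partial>\<rho>) = 2" .
      have "(\<integral>\<^sup>+w. \<integral>\<^sup>+x. ennreal (s (x, w)) * ennreal (max 0 (- ln (\<tau> w))) \<partial>PX \<partial>\<rho>) \<le> (\<integral>\<^sup>+w. 1 \<partial>\<rho>)"
      proof (intro nn_integral_mono_AE, use t\<tau> AE_space in eventually_elim)
        fix w assume \<tau>: "t w = ennreal (\<tau> w) \<and> 0 < \<tau> w" and w: "w \<in> space \<rho>"
        then have [measurable]: "w \<in> space U" by simp
        have "(\<integral>\<^sup>+x. ennreal (s (x, w)) * ennreal (max 0 (- ln (\<tau> w))) \<partial>PX) = t w * ennreal (max 0 (- ln (\<tau> w)))"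
          unfolding t_def by (subst nn_integral_multc) auto
        also have "\<dots> = ennreal (\<tau> w * max 0 (- ln (\<tau> w)))"
          using \<tau> by (simp only: ennreal_mult[symmetric] max.cobounded1 less_imp_le)
        also have "\<dots> \<le> ennreal 1" using \<tau> by (intro ennreal_leI minus_le) simp
        also have "ennreal 1 = 1" by simp
        finally show "(\<integral>\<^sup>+x. ennreal (s (x, w)) * ennreal (max 0 (- ln (\<tau> w))) \<partial>PX) \<le> 1" .
      qed
      then have 3: "(\<integral>\<^sup>+w. \<integral>\<^sup>+x. ennreal (s (x, w)) * ennreal (max 0 (- ln (\<tau> w))) \<partial>PX \<partial>\<rho>) < \<infinity>"
        using \<rho>.emeasure_space_1 by (simp add: order.strict_trans1[OF _ ennreal_one_less_top])
      show ?thesis using 1 3 unfolding 2 by (simp add: ennreal_add_less_top)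
    qed
    finally show ?thesis .
  qed
  have int_r: "integrable N (\<lambda>z. ln (r z))"
  proof (unfold integrable_iff_bounded, intro conjI)
    have *: "\<bar>ln x\<bar> \<le> ln (max 1 x) + max 0 (- ln x)" if "0 \<le> x" for x :: real
      using that by (cases "x = 0"; cases "x \<le> 1") auto
    have "(\<integral>\<^sup>+z. ennreal (norm (ln (r z))) \<partial>N) \<le>
        (\<integral>\<^sup>+z. ennreal (ln (max 1 (r z))) + ennreal (max 0 (- ln (r z))) \<partial>N)"
    proof (rule nn_integral_mono)
      fix z
      have "ennreal (norm (ln (r z))) \<le> ennreal (ln (max 1 (r z)) + max 0 (- ln (r z)))"
        using *[of "r z"] by (intro ennreal_leI) simp
      also have "\<dots> = ennreal (ln (max 1 (r z))) + ennreal (max 0 (- ln (r z)))"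
        by (rule ennreal_plus) auto
      finally show "ennreal (norm (ln (r z))) \<le> ennreal (ln (max 1 (r z))) + ennreal (max 0 (- ln (r z)))" .
    qed
    also have "\<dots> = (\<integral>\<^sup>+z. ennreal (ln (max 1 (r z))) \<partial>N) + (\<integral>\<^sup>+z. ennreal (max 0 (- ln (r z))) \<partial>N)"
      by (rule nn_integral_add) measurable
    also have "\<dots> < \<infinity>"
      using pos order.strict_trans1[OF neg ennreal_one_less_top] by (simp add: ennreal_add_less_top)
    finally show "(\<integral>\<^sup>+z. ennreal (norm (ln (r z))) \<partial>N) < \<infinity>" .
  qed measurable

  have R_nn: "(\<integral>\<^sup>+z. ennreal (R z) \<partial>(PX \<Otimes>\<^sub>M PV)) \<le> 1"
  proof -
    have "(\<integral>\<^sup>+z. ennreal (R z) \<partial>(PX \<Otimes>\<^sub>M PV)) = (\<integral>\<^sup>+v. \<integral>\<^sup>+x. R (x, v) \<partial>PX \<partial>PV)"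
      by (subst XV.nn_integral_snd) auto
    also have "\<dots> \<le> (\<integral>\<^sup>+v. 1 \<partial>PV)"
      using R_le by (intro nn_integral_mono) (simp add: PX_def)
    finally show ?thesis using PV.emeasure_space_1 by simp
  qed
  have int_R1: "integrable (PX \<Otimes>\<^sub>M PV) R"
    using R_nn R_pos
    by (intro integrableI_bounded) (auto simp: less_imp_le order.strict_trans1[OF _ ennreal_one_less_top])
  have R1: "(\<integral>z. R z \<partial>(PX \<Otimes>\<^sub>M PV)) \<le> 1"
    using R_nn nn_integral_eq_integral[OF int_R1] R_pos by (simp add: less_imp_le)
  have int_r1: "integrable (PX \<Otimes>\<^sub>M PV) r"
    by (rule integrableI_bounded) (auto simp: nn_r)
  have r1: "(\<integral>z. r z \<partial>(PX \<Otimes>\<^sub>M PV)) = 1"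
    using nn_r nn_integral_eq_integral[OF int_r1] by simp
  have int_RN: "integrable N (\<lambda>z. ln (R z))"
    using int_R unfolding N_def by (subst integrable_distr_eq) auto
  have int_rr: "integrable (PX \<Otimes>\<^sub>M PV) (\<lambda>z. r z * ln (r z))"
    using int_r unfolding N by (subst (asm) integrable_density) auto
  have int_rR: "integrable (PX \<Otimes>\<^sub>M PV) (\<lambda>z. r z * ln (R z))"
    using int_RN unfolding N by (subst (asm) integrable_density) auto
  \<comment> \<open>Gibbs' inequality: after integration the correction \<open>R - r\<close> is at
    most 0, since \<open>r\<close> has mass 1 and \<open>R\<close> has mass at most 1.\<close>
  have "(\<integral>z. r z * ln (R z) \<partial>(PX \<Otimes>\<^sub>M PV)) \<le> (\<integral>z. r z * ln (r z) - r z + R z \<partial>(PX \<Otimes>\<^sub>M PV))"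
    using int_rr int_rR int_r1 int_R1 R_pos by (intro integral_mono mult_ln_le) auto
  also have "\<dots> \<le> (\<integral>z. r z * ln (r z) \<partial>(PX \<Otimes>\<^sub>M PV))"
    using int_rr int_r1 int_R1 R1 r1 by simp
  finally have "(\<integral>z. ln (R z) \<partial>N) \<le> (\<integral>z. ln (r z) \<partial>N)"
    unfolding N by (simp add: integral_density)
  then have "(\<integral>z. ln (R z) \<partial>N) / ln b \<le> (\<integral>z. ln (r z) \<partial>N) / ln b"
    using b_gt_1 by (simp add: divide_right_mono)
  also have "(\<integral>z. ln (R z) \<partial>N) / ln b = (\<integral>\<omega>. log b (R (X \<omega>, \<zeta> (W \<omega>))) \<partial>M)"
    unfolding N_def by (subst integral_distr) (auto simp: log_def)
  also have "(\<integral>z. ln (r z) \<partial>N) / ln b = mutual_information b S T X (\<lambda>\<omega>. \<zeta> (W \<omega>))"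
    unfolding mutual_information_def KL_divergence_def PX_def[symmetric] PV_def[symmetric] N_def[symmetric]
      entropy_density_def comp_def r_def[symmetric]
    by (simp add: log_def)
  finally show ?thesis .
qed

section \<open>Products of Gaussian laws\<close>

abbreviation gauss_prod :: "'i set \<Rightarrow> ('i \<Rightarrow> real) \<Rightarrow> ('i \<Rightarrow> complex) measure" where
  "gauss_prod J v \<equiv> \<Pi>\<^sub>M j\<in>J. complex_gaussian 0 (v j)"

lemma product_prob_space_complex_gaussian:
  "(\<And>j. 0 < v j) \<Longrightarrow> product_prob_space (\<lambda>j. complex_gaussian 0 (v j))"
  by (intro product_prob_spaceI prob_space_complex_gaussian)

text \<open>The vector form of the translation formula. The translated product law and the product
  law with the exponential density agree on rectangles with the product of the one-dimensional laws
  \<open>K i\<close>, so they are equal.\<close>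

lemma nn_integral_gauss_prod_shift:
  fixes f :: "('i \<Rightarrow> complex) \<Rightarrow> ennreal"
  assumes "finite I" "0 < v" and [measurable]: "f \<in> borel_measurable (\<Pi>\<^sub>M i\<in>I. borel)"
  shows "(\<integral>\<^sup>+n. f (\<lambda>i\<in>I. n i + \<mu> i) \<partial>gauss_prod I (\<lambda>_. v)) =
    (\<integral>\<^sup>+y. f y * ennreal (exp (\<Sum>i\<in>I. ((cmod (y i))\<^sup>2 - (cmod (y i - \<mu> i))\<^sup>2) / v)) \<partial>gauss_prod I (\<lambda>_. v))"
proof -
  let ?M = "gauss_prod I (\<lambda>_. v)"
  let ?g = "\<lambda>i z. ennreal (exp (((cmod z)\<^sup>2 - (cmod (z - \<mu> i))\<^sup>2) / v))"
  define K where "K i = density (complex_gaussian 0 v) (?g i)" for i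
  have [simp, measurable_cong]: "sets (K i) = sets borel" for i by (simp add: K_def)
  have [simp]: "space (K i) = UNIV" for i by (simp add: K_def)
  interpret product_prob_space "\<lambda>_. complex_gaussian 0 v"
    using assms by (intro product_prob_space_complex_gaussian)
  have K: "emeasure (K i) A = emeasure (complex_gaussian 0 v) {z. z + \<mu> i \<in> A}" if [measurable]: "A \<in> sets borel" for i A
  proof -
    have "emeasure (K i) A = (\<integral>\<^sup>+z. ?g i z * indicator A z \<partial>complex_gaussian 0 v)"
      by (simp add: K_def emeasure_density)
    also have "\<dots> = (\<integral>\<^sup>+z. indicator A (z + \<mu> i) \<partial>complex_gaussian 0 v)"
      using nn_integral_complex_gaussian_shift[OF assms(2), of "indicator A" "\<mu> i"] by (simp add: mult.commute)
    also have "\<dots> = (\<integral>\<^sup>+z. indicator {z. z + \<mu> i \<in> A} z \<partial>complex_gaussian 0 v)"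
      by (intro nn_integral_cong) (auto split: split_indicator)
    finally show ?thesis by (subst (asm) nn_integral_indicator) auto
  qed
  interpret K: product_prob_space K
  proof (intro product_prob_spaceI)
    fix i
    show "prob_space (K i)"
      by (rule prob_spaceI) (use K[of UNIV i] M.emeasure_space_1 in simp)
  qed
  have shift_meas[measurable]: "(\<lambda>n. \<lambda>i\<in>I. n i + \<mu> i) \<in> PiM I (\<lambda>_. borel) \<rightarrow>\<^sub>M (\<Pi>\<^sub>M i\<in>I. borel)"
    by measurable
  have "distr ?M (\<Pi>\<^sub>M i\<in>I. borel) (\<lambda>n. \<lambda>i\<in>I. n i + \<mu> i) = PiM I K"
  proof (rule K.PiM_eqI[OF assms(1)])
    show "sets (distr ?M (\<Pi>\<^sub>M i\<in>I. borel) (\<lambda>n. \<lambda>i\<in>I. n i + \<mu> i)) = sets (PiM I K)"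
      by (simp cong: sets_PiM_cong)
    fix A assume "\<And>i. i \<in> I \<Longrightarrow> A i \<in> sets (K i)"
    then have A[measurable]: "\<And>i. i \<in> I \<Longrightarrow> A i \<in> sets borel" by simp
    have "emeasure (distr ?M (\<Pi>\<^sub>M i\<in>I. borel) (\<lambda>n. \<lambda>i\<in>I. n i + \<mu> i)) (Pi\<^sub>E I A) =
        emeasure ?M (Pi\<^sub>E I (\<lambda>i. {z. z + \<mu> i \<in> A i}))"
      using assms(1) A by (subst emeasure_distr) (auto simp: space_PiM PiE_iff extensional_def intro!: arg_cong[where f="emeasure ?M"])
    also have "\<dots> = (\<Prod>i\<in>I. emeasure (K i) (A i))"
      using A by (subst emeasure_PiM[OF assms(1)]) (auto simp: K intro!: prod.cong)
    finally show "emeasure (distr ?M (\<Pi>\<^sub>M i\<in>I. borel) (\<lambda>n. \<lambda>i\<in>I. n i + \<mu> i)) (Pi\<^sub>E I A) = (\<Prod>i\<in>I. emeasure (K i) (A i))" .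
  qed
  moreover have "density ?M (\<lambda>y. \<Prod>i\<in>I. ?g i (y i)) = PiM I K"
  proof (rule K.PiM_eqI[OF assms(1)])
    show "sets (density ?M (\<lambda>y. \<Prod>i\<in>I. ?g i (y i))) = sets (PiM I K)"
      by (simp cong: sets_PiM_cong)
    fix A assume "\<And>i. i \<in> I \<Longrightarrow> A i \<in> sets (K i)"
    then have A[measurable]: "\<And>i. i \<in> I \<Longrightarrow> A i \<in> sets borel" by simp
    have box: "Pi\<^sub>E I A \<in> sets ?M" using assms(1) A by (intro sets_PiM_I_finite) auto
    have "emeasure (density ?M (\<lambda>y. \<Prod>i\<in>I. ?g i (y i))) (Pi\<^sub>E I A) =
        (\<integral>\<^sup>+y. (\<Prod>i\<in>I. ?g i (y i)) * indicator (Pi\<^sub>E I A) y \<partial>?M)"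
      using box by (subst emeasure_density) auto
    also have "\<dots> = (\<integral>\<^sup>+y. (\<Prod>i\<in>I. ?g i (y i) * indicator (A i) (y i)) \<partial>?M)"
    proof (intro nn_integral_cong)
      fix y assume "y \<in> space ?M"
      then have "indicator (Pi\<^sub>E I A) y = (\<Prod>i\<in>I. indicator (A i) (y i) :: ennreal)"
        using assms(1) by (auto simp: space_PiM PiE_iff indicator_def prod_zero_iff)
      then show "(\<Prod>i\<in>I. ?g i (y i)) * indicator (Pi\<^sub>E I A) y = (\<Prod>i\<in>I. ?g i (y i) * indicator (A i) (y i))"
        by (simp add: prod.distrib)
    qed
    also have "\<dots> = (\<Prod>i\<in>I. \<integral>\<^sup>+z. ?g i z * indicator (A i) z \<partial>complex_gaussian 0 v)"
      using A by (intro product_nn_integral_prod assms) auto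
    also have "\<dots> = (\<Prod>i\<in>I. emeasure (K i) (A i))"
      using A by (intro prod.cong) (auto simp: K_def emeasure_density)
    finally show "emeasure (density ?M (\<lambda>y. \<Prod>i\<in>I. ?g i (y i))) (Pi\<^sub>E I A) = (\<Prod>i\<in>I. emeasure (K i) (A i))" .
  qed
  ultimately have eq: "distr ?M (\<Pi>\<^sub>M i\<in>I. borel) (\<lambda>n. \<lambda>i\<in>I. n i + \<mu> i) = density ?M (\<lambda>y. \<Prod>i\<in>I. ?g i (y i))"
    by simp
  have "(\<integral>\<^sup>+n. f (\<lambda>i\<in>I. n i + \<mu> i) \<partial>?M) = (\<integral>\<^sup>+y. f y \<partial>distr ?M (\<Pi>\<^sub>M i\<in>I. borel) (\<lambda>n. \<lambda>i\<in>I. n i + \<mu> i))"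
    by (subst nn_integral_distr) auto
  also have "\<dots> = (\<integral>\<^sup>+y. (\<Prod>i\<in>I. ?g i (y i)) * f y \<partial>?M)"
    unfolding eq by (subst nn_integral_density) auto
  also have "\<dots> = (\<integral>\<^sup>+y. f y * ennreal (exp (\<Sum>i\<in>I. ((cmod (y i))\<^sup>2 - (cmod (y i - \<mu> i))\<^sup>2) / v)) \<partial>?M)"
    using assms(1) by (simp add: exp_sum prod_ennreal mult.commute)
  finally show ?thesis .
qed

text \<open>Coordinates are integrated out from the last to the first: by \<open>past\<close> the
  last one enters only its own factor, which then integrates to 1. This is the normalisation of a
  density assembled by the chain rule.\<close>

lemma nn_integral_sequential_kernels:
  fixes k :: "nat \<Rightarrow> (nat \<Rightarrow> 'a) \<Rightarrow> ennreal" and M :: "nat \<Rightarrow> 'a measure"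
  assumes "product_prob_space M"
  assumes [measurable]: "\<And>i n. i < n \<Longrightarrow> k i \<in> borel_measurable (PiM {..<n} M)"
    and past: "\<And>i j x y. i < j \<Longrightarrow> k i (x(j := y)) = k i x"
    and norm: "\<And>i x. (\<integral>\<^sup>+y. k i (x(i := y)) \<partial>M i) = 1"
  shows "(\<integral>\<^sup>+x. (\<Prod>i<n. k i x) \<partial>PiM {..<n} M) = 1"
proof -
  interpret N: product_prob_space M by fact
  show ?thesis
  proof (induction n)
    case 0
    show ?case by (simp add: space_PiM)
  next
    case (Suc n)
    have m: "(\<lambda>x. \<Prod>i<Suc n. k i x) \<in> borel_measurable (PiM (insert n {..<n}) M)"
      unfolding lessThan_Suc[symmetric] by measurable
    have "(\<integral>\<^sup>+x. (\<Prod>i<Suc n. k i x) \<partial>PiM {..<Suc n} M) =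
        (\<integral>\<^sup>+x. \<integral>\<^sup>+y. (\<Prod>i<Suc n. k i (x(n := y))) \<partial>M n \<partial>PiM {..<n} M)"
      unfolding lessThan_Suc[of n] by (rule N.product_nn_integral_insert) (use m in \<open>auto simp: lessThan_Suc[symmetric]\<close>)
    also have "\<dots> = (\<integral>\<^sup>+x. (\<Prod>i<n. k i x) \<partial>PiM {..<n} M)"
    proof (rule nn_integral_cong)
      fix x assume x: "x \<in> space (PiM {..<n} M)"
      have [measurable]: "(\<lambda>y. k n (x(n := y))) \<in> borel_measurable (M n)"
      proof -
        have "(\<lambda>y. x(n := y)) \<in> M n \<rightarrow>\<^sub>M PiM {..<Suc n} M"
          unfolding lessThan_Suc[of n] using x by (intro measurable_component_update) auto
        from measurable_compose[OF this assms(2)[of n "Suc n"]] show ?thesis by simp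
      qed
      show "(\<integral>\<^sup>+y. (\<Prod>i<Suc n. k i (x(n := y))) \<partial>M n) = (\<Prod>i<n. k i x)"
        by (simp add: past nn_integral_cmult norm)
    qed
    finally show ?case using Suc by simp
  qed
qed

text \<open>Applied once per link, with \<open>T\<close> the passage from (fading, pilot noise) to
  (error, estimate). The proof compares rectangles: the untouched coordinates factor out, and
  \<open>eq\<close> settles the remaining pair.\<close>

lemma distr_PiM_replace_pair:
  fixes M N :: "'i \<Rightarrow> 'a measure"
  assumes M: "product_prob_space M" and N: "product_prob_space N"
    and J: "finite J" "a \<in> J" "b \<in> J" "a \<noteq> b"
    and T[measurable]: "T \<in> M a \<Otimes>\<^sub>M M b \<rightarrow>\<^sub>M N a \<Otimes>\<^sub>M N b"
    and eq: "distr (M a \<Otimes>\<^sub>M M b) (N a \<Otimes>\<^sub>M N b) T = N a \<Otimes>\<^sub>M N b"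
    and same: "\<And>j. j \<in> J - {a, b} \<Longrightarrow> N j = M j"
  defines "F \<equiv> \<lambda>v. v(a := fst (T (v a, v b)), b := snd (T (v a, v b)))"
  shows "F \<in> PiM J M \<rightarrow>\<^sub>M PiM J N" "distr (PiM J M) (PiM J N) F = PiM J N"
proof -
  interpret M: product_prob_space M by fact
  interpret N: product_prob_space N by fact
  have [measurable_cong]: "j \<in> J - {a, b} \<Longrightarrow> sets (N j) = sets (M j)" for j using same by simp
  define K where "K = J - {a, b}"
  have K: "J = insert b (insert a K)" "finite K" "a \<notin> insert b K" "a \<notin> K" "b \<notin> insert a K" using J by (auto simp: K_def)
  have F': "F v = (\<lambda>j\<in>J. if j = a then fst (T (v a, v b)) else if j = b then snd (T (v a, v b)) else v j)"
    if "v \<in> space (PiM J M)" for v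
    using that J by (auto simp: F_def space_PiM PiE_iff extensional_def)
  have *: "(\<lambda>v. if j = a then fst (T (v a, v b)) else if j = b then snd (T (v a, v b)) else v j) \<in> PiM J M \<rightarrow>\<^sub>M N j"
    if "j \<in> J" for j
    using that J(2,3,4) same[of j] by (cases "j = a"; cases "j = b") auto
  show F[measurable]: "F \<in> PiM J M \<rightarrow>\<^sub>M PiM J N"
    by (subst measurable_cong[OF F'], assumption) (intro measurable_restrict *)
  show "distr (PiM J M) (PiM J N) F = PiM J N"
  proof (rule N.PiM_eqI[OF J(1)])
    fix A assume A: "\<And>j. j \<in> J \<Longrightarrow> A j \<in> sets (N j)"
    have box: "Pi\<^sub>E J A \<in> sets (PiM J N)" using J(1) A by (rule sets_PiM_I_finite)
    have [measurable]: "A a \<in> sets (N a)" "A b \<in> sets (N b)" "\<And>j. j \<in> K \<Longrightarrow> A j \<in> sets (M j)"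
      using A J same[symmetric] by (auto simp: K_def)
    let ?g = "\<lambda>v. indicator (A a \<times> A b) (T (v a, v b)) * (\<Prod>j\<in>K. indicator (A j) (v j)) :: ennreal"
    have KJ: "K \<subseteq> J" by (auto simp: K_def)
    have g: "?g \<in> borel_measurable (PiM J M)"
    proof -
      have "(\<lambda>v. indicator (A j) (v j) :: ennreal) \<in> borel_measurable (PiM J M)" if "j \<in> K" for j
      proof -
        have [measurable]: "A j \<in> sets (M j)" "j \<in> J" using that KJ \<open>\<And>j. j \<in> K \<Longrightarrow> A j \<in> sets (M j)\<close> by auto
        show ?thesis by measurable
      qed
      then have [measurable]: "(\<lambda>v. \<Prod>j\<in>K. indicator (A j) (v j) :: ennreal) \<in> borel_measurable (PiM J M)"
        by (intro borel_measurable_prod_ennreal) auto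
      show ?thesis using J(2,3) by measurable
    qed
    have "emeasure (distr (PiM J M) (PiM J N) F) (Pi\<^sub>E J A) = (\<integral>\<^sup>+v. indicator (Pi\<^sub>E J A) (F v) \<partial>PiM J M)"
      using box by (subst nn_integral_distr[symmetric, OF F]) auto
    also have "\<dots> = (\<integral>\<^sup>+v. ?g v \<partial>PiM J M)"
    proof (rule nn_integral_cong)
      fix v assume v: "v \<in> space (PiM J M)"
      have "F v \<in> Pi\<^sub>E J A \<longleftrightarrow> T (v a, v b) \<in> A a \<times> A b \<and> (\<forall>j\<in>K. v j \<in> A j)"
        using v K by (auto simp: F_def space_PiM PiE_iff extensional_def mem_Times_iff)
      moreover have "(\<Prod>j\<in>K. indicator (A j) (v j) :: ennreal) = of_bool (\<forall>j\<in>K. v j \<in> A j)"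
        using K(2) by (auto simp: indicator_def)
      ultimately show "indicator (Pi\<^sub>E J A) (F v) = ?g v"
        by (auto simp: indicator_def)
    qed
    also have "\<dots> = (\<integral>\<^sup>+v. \<integral>\<^sup>+y. ?g (v(b := y)) \<partial>M b \<partial>PiM (insert a K) M)"
      using g unfolding K(1) by (intro M.product_nn_integral_insert) (use K in auto)
    also have "\<dots> = (\<integral>\<^sup>+v. \<integral>\<^sup>+x. (\<integral>\<^sup>+y. ?g (v(a := x, b := y)) \<partial>M b) \<partial>M a \<partial>PiM K M)"
    proof (intro M.product_nn_integral_insert)
      show "(\<lambda>v. \<integral>\<^sup>+y. ?g (v(b := y)) \<partial>M b) \<in> borel_measurable (PiM (insert a K) M)"
      proof (rule M.M.borel_measurable_nn_integral)
        have "(\<lambda>z. (fst z)(b := snd z)) \<in> PiM (insert a K) M \<Otimes>\<^sub>M M b \<rightarrow>\<^sub>M PiM J M"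
          unfolding K(1) by (intro measurable_fun_upd[where J="insert a K"]) auto
        from measurable_compose[OF this g]
        show "(\<lambda>(v, y). ?g (v(b := y))) \<in> borel_measurable (PiM (insert a K) M \<Otimes>\<^sub>M M b)"
          by (simp add: split_beta')
      qed
    qed (use K in auto)
    also have "\<dots> = (\<integral>\<^sup>+v. (\<Prod>j\<in>K. indicator (A j) (v j)) * (\<integral>\<^sup>+x. \<integral>\<^sup>+y. indicator (A a \<times> A b) (T (x, y)) \<partial>M b \<partial>M a) \<partial>PiM K M)"
    proof (rule nn_integral_cong)
      fix v
      have eq: "?g (v(a := x, b := y)) = (\<Prod>j\<in>K. indicator (A j) (v j)) * indicator (A a \<times> A b) (T (x, y))" for x y
      proof -
        have "(\<Prod>j\<in>K. indicator (A j) ((v(a := x, b := y)) j)) = (\<Prod>j\<in>K. indicator (A j) (v j) :: ennreal)"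
          using K by (intro prod.cong) auto
        then show ?thesis using J(4) by (simp add: mult.commute)
      qed
      show "(\<integral>\<^sup>+x. (\<integral>\<^sup>+y. ?g (v(a := x, b := y)) \<partial>M b) \<partial>M a) =
         (\<Prod>j\<in>K. indicator (A j) (v j)) * (\<integral>\<^sup>+x. \<integral>\<^sup>+y. indicator (A a \<times> A b) (T (x, y)) \<partial>M b \<partial>M a)"
      proof -
        have [measurable]: "(\<lambda>z. indicator (A a \<times> A b) (T z) :: ennreal) \<in> borel_measurable (M a \<Otimes>\<^sub>M M b)"
          by measurable
        have "(\<integral>\<^sup>+y. (\<Prod>j\<in>K. indicator (A j) (v j)) * indicator (A a \<times> A b) (T (x, y)) \<partial>M b) =
            (\<Prod>j\<in>K. indicator (A j) (v j)) * (\<integral>\<^sup>+y. indicator (A a \<times> A b) (T (x, y)) \<partial>M b)"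
          if "x \<in> space (M a)" for x
          by (intro nn_integral_cmult measurable_compose_Pair1[OF that]) measurable
        then have "(\<integral>\<^sup>+x. (\<integral>\<^sup>+y. ?g (v(a := x, b := y)) \<partial>M b) \<partial>M a) =
          (\<integral>\<^sup>+x. (\<Prod>j\<in>K. indicator (A j) (v j)) * (\<integral>\<^sup>+y. indicator (A a \<times> A b) (T (x, y)) \<partial>M b) \<partial>M a)"
          unfolding eq by (intro nn_integral_cong)
        also have "\<dots> = (\<Prod>j\<in>K. indicator (A j) (v j)) * (\<integral>\<^sup>+x. \<integral>\<^sup>+y. indicator (A a \<times> A b) (T (x, y)) \<partial>M b \<partial>M a)"
          by (intro nn_integral_cmult M.M.borel_measurable_nn_integral_fst) measurable
        finally show ?thesis .
      qed
    qed
    also have "(\<integral>\<^sup>+x. \<integral>\<^sup>+y. indicator (A a \<times> A b) (T (x, y)) \<partial>M b \<partial>M a) = (\<integral>\<^sup>+z. indicator (A a \<times> A b) (T z) \<partial>(M a \<Otimes>\<^sub>M M b))"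
      by (rule M.M.nn_integral_fst) measurable
    also have "\<dots> = emeasure (N a \<Otimes>\<^sub>M N b) (A a \<times> A b)"
      by (subst eq[symmetric], subst nn_integral_indicator[symmetric], simp, subst nn_integral_distr) auto
    also have "\<dots> = emeasure (N a) (A a) * emeasure (N b) (A b)"
      by (rule N.M.emeasure_pair_measure_Times) auto
    also have "(\<integral>\<^sup>+v. (\<Prod>j\<in>K. indicator (A j) (v j)) * (emeasure (N a) (A a) * emeasure (N b) (A b)) \<partial>PiM K M) =
       (\<Prod>j\<in>K. emeasure (M j) (A j)) * (emeasure (N a) (A a) * emeasure (N b) (A b))"
    proof -
      have "(\<integral>\<^sup>+v. (\<Prod>j\<in>K. indicator (A j) (v j)) \<partial>PiM K M) = (\<Prod>j\<in>K. \<integral>\<^sup>+x. indicator (A j) x \<partial>M j)"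
        using K(2) by (intro M.product_nn_integral_prod) auto
      also have "\<dots> = (\<Prod>j\<in>K. emeasure (M j) (A j))"
        by (intro prod.cong) auto
      finally show ?thesis by (subst nn_integral_multc) auto
    qed
    also have "\<dots> = (\<Prod>j\<in>J. emeasure (N j) (A j))"
      unfolding K(1) using K same by (auto simp: K_def[symmetric] mult_ac intro!: arg_cong2[where f="(*)"] prod.cong)
    finally show "emeasure (distr (PiM J M) (PiM J N) F) (Pi\<^sub>E J A) = (\<Prod>j\<in>J. emeasure (N j) (A j))" .
  qed simp
qed

text \<open>Distinct square-free monomials in independent centred variables are orthogonal. All signals are
  such multi-affine forms in the data, the estimation errors and the noise, with coefficients that are
  functions of the channel estimates.\<close>

definition multi_affine :: "('i set \<times> complex) list \<Rightarrow> ('i \<Rightarrow> complex) \<Rightarrow> complex" where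
  "multi_affine L v = (\<Sum>(S, c)\<leftarrow>L. c * (\<Prod>j\<in>S. v j))"

lemma multi_affine_simps[simp]:
  "multi_affine [] v = 0"
  "multi_affine ((S, c) # L) v = c * (\<Prod>j\<in>S. v j) + multi_affine L v"
  by (simp_all add: multi_affine_def)

text \<open>The integrand factors over the coordinates. One lying in exactly one of \<open>S\<close>
  and \<open>T\<close> contributes its mean 0, one lying in both contributes its variance, and one
  lying in neither contributes 1.\<close>

lemma has_bochner_integral_monomials:
  assumes "finite J" "\<And>j. 0 < w j" "S \<subseteq> J" "T \<subseteq> J"
  shows "has_bochner_integral (gauss_prod J w) (\<lambda>v. (\<Prod>j\<in>S. v j) * cnj (\<Prod>j\<in>T. v j))
    (if S = T then complex_of_real (\<Prod>j\<in>S. w j) else 0)"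
proof -
  interpret product_prob_space "\<lambda>j. complex_gaussian 0 (w j)"
    by (rule product_prob_space_complex_gaussian) fact
  define f :: "'a \<Rightarrow> complex \<Rightarrow> complex" where
    "f j z = (if j \<in> S then z else 1) * (if j \<in> T then cnj z else 1)" for j z
  define g :: "'a \<Rightarrow> complex" where
    "g j = (if j \<in> S then (if j \<in> T then complex_of_real (w j) else 0) else (if j \<in> T then 0 else 1))" for j
  have id: "has_bochner_integral (complex_gaussian 0 (w j)) (\<lambda>z. z) 0" for j
    using assms(2) by (simp add: has_bochner_integral_iff integrable_complex_gaussian_id integral_complex_gaussian_id)
  have cnj: "has_bochner_integral (complex_gaussian 0 (w j)) (\<lambda>z. cnj z) 0" for j
    using has_bochner_integral_bounded_linear[OF bounded_linear_cnj id[of j]] by simp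
  have sq: "has_bochner_integral (complex_gaussian 0 (w j)) (\<lambda>z. z * cnj z) (complex_of_real (w j))" for j
    using has_bochner_integral_of_real[where 'a=complex, of "complex_gaussian 0 (w j)" "\<lambda>z. (cmod z)\<^sup>2" "w j"]
      assms(2) integrable_complex_gaussian_square[of "w j"]
    by (simp add: has_bochner_integral_iff complex_norm_square[symmetric])
  have one: "has_bochner_integral (complex_gaussian 0 (w j)) (\<lambda>z. 1 :: complex) 1" for j
    using M.emeasure_space_1[of j] M.prob_space[of j] by (simp add: has_bochner_integral_iff)
  have f: "has_bochner_integral (complex_gaussian 0 (w j)) (f j) (g j)" for j
    using id[of j] cnj[of j] sq[of j] one[of j] by (cases "j \<in> S"; cases "j \<in> T") (simp_all add: f_def[abs_def] g_def)
  have restr: "(\<Prod>j\<in>A. h j) = (\<Prod>j\<in>J. if j \<in> A then h j else 1)" if "A \<subseteq> J" for A and h :: "'a \<Rightarrow> complex"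
    using prod.inter_restrict[OF assms(1), of h A] that by (simp only: Int_absorb1)
  have "(\<Prod>j\<in>S. v j) * cnj (\<Prod>j\<in>T. v j) = (\<Prod>j\<in>J. f j (v j))" for v
    unfolding cnj_prod f_def prod.distrib by (simp only: restr[OF assms(3)] restr[OF assms(4)])
  moreover have "has_bochner_integral (gauss_prod J w) (\<lambda>v. \<Prod>j\<in>J. f j (v j)) (\<Prod>j\<in>J. g j)"
    using f product_integral_prod[OF assms(1), of f] product_integrable_prod[OF assms(1), of f]
    by (simp add: has_bochner_integral_iff)
  moreover have "(\<Prod>j\<in>J. g j) = (if S = T then complex_of_real (\<Prod>j\<in>S. w j) else 0)"
  proof (cases "S = T")
    case True
    show ?thesis
      unfolding of_real_prod restr[OF assms(3)] using True by (auto simp: g_def intro!: prod.cong)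
  next
    case False
    then obtain j where "j \<in> S \<union> T" "(j \<in> S) \<noteq> (j \<in> T)" by auto
    then have "j \<in> J" "g j = 0" using assms(3,4) by (auto simp: g_def)
    then have "(\<Prod>j\<in>J. g j) = 0" using assms(1) by (auto simp: prod_zero_iff)
    then show ?thesis using False by simp
  qed
  ultimately show ?thesis by simp
qed

lemma has_bochner_integral_multi_affine_inner:
  assumes J: "finite J" "\<And>j. 0 < w j"
    and L: "\<And>S c. (S, c) \<in> set L \<Longrightarrow> S \<subseteq> J" and L': "\<And>S c. (S, c) \<in> set L' \<Longrightarrow> S \<subseteq> J"
  shows "has_bochner_integral (gauss_prod J w) (\<lambda>v. multi_affine L v * cnj (multi_affine L' v))
    (\<Sum>(S, c)\<leftarrow>L. \<Sum>(T, d)\<leftarrow>L'. if S = T then c * cnj d * complex_of_real (\<Prod>j\<in>S. w j) else 0)"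
  using L
proof (induction L)
  case (Cons a L)
  obtain S c where a: "a = (S, c)" by (cases a)
  have S: "S \<subseteq> J" using Cons.prems[of S c] a by simp
  have 1: "has_bochner_integral (gauss_prod J w) (\<lambda>v. c * (\<Prod>j\<in>S. v j) * cnj (multi_affine L' v))
    (\<Sum>(T, d)\<leftarrow>L'. if S = T then c * cnj d * complex_of_real (\<Prod>j\<in>S. w j) else 0)"
    using L'
  proof (induction L')
    case (Cons b L')
    obtain T d where b: "b = (T, d)" by (cases b)
    have T: "T \<subseteq> J" using Cons.prems[of T d] b by simp
    have IH: "has_bochner_integral (gauss_prod J w) (\<lambda>v. c * (\<Prod>j\<in>S. v j) * cnj (multi_affine L' v))
      (\<Sum>(T, d)\<leftarrow>L'. if S = T then c * cnj d * complex_of_real (\<Prod>j\<in>S. w j) else 0)"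
      using Cons.prems by (intro Cons.IH) auto
    have "has_bochner_integral (gauss_prod J w) (\<lambda>v. (c * cnj d) * ((\<Prod>j\<in>S. v j) * cnj (\<Prod>j\<in>T. v j)))
       ((c * cnj d) * (if S = T then complex_of_real (\<Prod>j\<in>S. w j) else 0))"
      by (intro has_bochner_integral_mult_right has_bochner_integral_monomials J S T)
    from has_bochner_integral_add[OF this IH]
    show ?case by (cases "S = T") (simp_all add: b algebra_simps)
  qed (simp add: has_bochner_integral_zero)
  have "has_bochner_integral (gauss_prod J w) (\<lambda>v. multi_affine L v * cnj (multi_affine L' v))
    (\<Sum>(S, c)\<leftarrow>L. \<Sum>(T, d)\<leftarrow>L'. if S = T then c * cnj d * complex_of_real (\<Prod>j\<in>S. w j) else 0)"
    using Cons.prems by (intro Cons.IH) auto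
  from has_bochner_integral_add[OF 1 this] show ?case by (simp add: a distrib_right)
qed (simp add: has_bochner_integral_zero)

text \<open>As the index sets in the list are distinct, only the diagonal of the double sum from
  \<open>has_bochner_integral_multi_affine_inner\<close> survives.\<close>

lemma nn_integral_multi_affine_square:
  assumes J: "finite J" "\<And>j. 0 < w j"
    and L: "\<And>S c. (S, c) \<in> set L \<Longrightarrow> S \<subseteq> J" and "distinct (map fst L)"
  shows "(\<integral>\<^sup>+v. ennreal ((cmod (multi_affine L v))\<^sup>2) \<partial>gauss_prod J w) =
    ennreal (\<Sum>(S, c)\<leftarrow>L. (cmod c)\<^sup>2 * (\<Prod>j\<in>S. w j))"
proof -
  have inner: "(\<Sum>(T, d)\<leftarrow>K. if S = T then c * cnj d * complex_of_real (\<Prod>j\<in>S. w j) else 0) =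
      (if (S, c) \<in> set K then complex_of_real ((cmod c)\<^sup>2 * (\<Prod>j\<in>S. w j)) else 0)"
    if "distinct (map fst K)" "\<And>d. (S, d) \<in> set K \<Longrightarrow> d = c" for K S c
    using that
  proof (induction K)
    case (Cons b K)
    obtain T d where b: "b = (T, d)" by (cases b)
    have IH: "(\<Sum>(T, d)\<leftarrow>K. if S = T then c * cnj d * complex_of_real (\<Prod>j\<in>S. w j) else 0) =
      (if (S, c) \<in> set K then complex_of_real ((cmod c)\<^sup>2 * (\<Prod>j\<in>S. w j)) else 0)"
      using Cons.prems by (intro Cons.IH) auto
    show ?case
    proof (cases "S = T")
      case True
      have "d = c" using Cons.prems(2)[of d] True b by simp
      moreover have "(S, c) \<notin> set K" using Cons.prems(1) True b by force
      ultimately show ?thesis using IH True b by (simp add: complex_norm_square[symmetric] del: of_real_power)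
    next
      case False
      then show ?thesis using IH b by auto
    qed
  qed simp
  have "(\<Sum>(S, c)\<leftarrow>L. \<Sum>(T, d)\<leftarrow>L. if S = T then c * cnj d * complex_of_real (\<Prod>j\<in>S. w j) else 0) =
      (\<Sum>(S, c)\<leftarrow>L. complex_of_real ((cmod c)\<^sup>2 * (\<Prod>j\<in>S. w j)))"
  proof (intro arg_cong[where f=sum_list] map_cong refl)
    fix a assume a: "a \<in> set L"
    obtain S c where [simp]: "a = (S, c)" by (cases a)
    have "d = c" if "(S, d) \<in> set L" for d
      using that a eq_key_imp_eq_value[OF assms(4)] by auto
    from inner[OF assms(4) this]
    show "(case a of (S, c) \<Rightarrow> \<Sum>(T, d)\<leftarrow>L. if S = T then c * cnj d * complex_of_real (\<Prod>j\<in>S. w j) else 0) =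
        (case a of (S, c) \<Rightarrow> complex_of_real ((cmod c)\<^sup>2 * (\<Prod>j\<in>S. w j)))"
      using a by simp
  qed
  also have "\<dots> = complex_of_real (\<Sum>(S, c)\<leftarrow>L. (cmod c)\<^sup>2 * (\<Prod>j\<in>S. w j))"
    by (induction L) auto
  finally have sum_eq: "(\<Sum>(S, c)\<leftarrow>L. \<Sum>(T, d)\<leftarrow>L. if S = T then c * cnj d * complex_of_real (\<Prod>j\<in>S. w j) else 0) =
      complex_of_real (\<Sum>(S, c)\<leftarrow>L. (cmod c)\<^sup>2 * (\<Prod>j\<in>S. w j))" .
  have "has_bochner_integral (gauss_prod J w) (\<lambda>v. multi_affine L v * cnj (multi_affine L v))
      (\<Sum>(S, c)\<leftarrow>L. \<Sum>(T, d)\<leftarrow>L. if S = T then c * cnj d * complex_of_real (\<Prod>j\<in>S. w j) else 0)"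
    by (rule has_bochner_integral_multi_affine_inner) (fact J, fact J, fact L, fact L)
  then have "has_bochner_integral (gauss_prod J w) (\<lambda>v. complex_of_real ((cmod (multi_affine L v))\<^sup>2))
      (complex_of_real (\<Sum>(S, c)\<leftarrow>L. (cmod c)\<^sup>2 * (\<Prod>j\<in>S. w j)))"
    unfolding sum_eq by (simp only: complex_norm_square)
  from has_bochner_integral_bounded_linear[OF bounded_linear_Re this]
  have "has_bochner_integral (gauss_prod J w) (\<lambda>v. (cmod (multi_affine L v))\<^sup>2)
      (\<Sum>(S, c)\<leftarrow>L. (cmod c)\<^sup>2 * (\<Prod>j\<in>S. w j))"
    by (simp only: Re_complex_of_real)
  then show ?thesis
    by (subst nn_integral_eq_integral) (auto simp: has_bochner_integral_iff)
qed

section \<open>The coordinates of a block\<close>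

text \<open>A single index type for data, fading, relay noise and destination noise, so that a whole
  block becomes one product of independent Gaussians.\<close>

datatype coord = Rx nat | Rh link | Rr nat | Rd nat

lemma UNIV_link: "(UNIV :: link set) = {SR, SD, RD}"
  using link.exhaust by auto

instance link :: finite
  by standard (simp add: UNIV_link)

text \<open>The noise that disturbs the pilot of a link; under \<open>coord\<close> the same slot
  holds the channel estimate.\<close>

fun pilot_coord :: "link \<Rightarrow> coord" where
  "pilot_coord SR = Rr 0"
| "pilot_coord SD = Rd 0"
| "pilot_coord RD = Rd 1"

definition coords :: "relay_net \<Rightarrow> coord set" where
  "coords p = Rx ` {..<data_len p} \<union> Rh ` UNIV \<union> Rr ` {..<block_len p} \<union> Rd ` {..<block_len p}"

lemma finite_coords[simp]: "finite (coords p)"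
  by (simp add: coords_def)

definition raw_coord :: "relay_net \<Rightarrow> outcome \<Rightarrow> coord \<Rightarrow> complex" where
  "raw_coord p = (\<lambda>(x, h, nr, nd). \<lambda>j\<in>coords p.
     case j of Rx i \<Rightarrow> x i | Rh l \<Rightarrow> h l | Rr t \<Rightarrow> nr t | Rd t \<Rightarrow> nd t)"

text \<open>Each pilot noise is replaced by the channel estimate it gives rise to, and each fading
  coefficient by its estimation error; the coordinates then remain independent.\<close>

definition coord :: "relay_net \<Rightarrow> outcome \<Rightarrow> coord \<Rightarrow> complex" where
  "coord p \<omega> = (case \<omega> of (x, h, nr, nd) \<Rightarrow> \<lambda>j\<in>coords p.
     case j of Rx i \<Rightarrow> x i
     | Rh l \<Rightarrow> h l - mmse_est p l \<omega>
     | Rr t \<Rightarrow> (if t = 0 then mmse_est p SR \<omega> else nr t)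
     | Rd t \<Rightarrow> (if t = 0 then mmse_est p SD \<omega> else if t = 1 then mmse_est p RD \<omega> else nd t))"

definition gauss_input :: "relay_net \<Rightarrow> (nat \<Rightarrow> complex) measure" where
  "gauss_input p = gauss_prod {..<data_len p} (\<lambda>_. src_symbol_energy p)"

text \<open>The variance of the MMSE estimate. Together with \<open>err_var\<close> it adds up to
  the fading variance, as befits an estimate orthogonal to its error.\<close>

definition est_var :: "relay_net \<Rightarrow> link \<Rightarrow> real" where
  "est_var p l = (fading_sd p l)^4 * pilot_energy p l / ((fading_sd p l)\<^sup>2 * pilot_energy p l + noise_var p)"

definition err_var :: "relay_net \<Rightarrow> link \<Rightarrow> real" where
  "err_var p l = (fading_sd p l)\<^sup>2 * noise_var p / ((fading_sd p l)\<^sup>2 * pilot_energy p l + noise_var p)"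

fun raw_var :: "relay_net \<Rightarrow> coord \<Rightarrow> real" where
  "raw_var p (Rx i) = src_symbol_energy p"
| "raw_var p (Rh l) = (fading_sd p l)\<^sup>2"
| "raw_var p (Rr t) = noise_var p"
| "raw_var p (Rd t) = noise_var p"

fun coord_var :: "relay_net \<Rightarrow> coord \<Rightarrow> real" where
  "coord_var p (Rx i) = src_symbol_energy p"
| "coord_var p (Rh l) = err_var p l"
| "coord_var p (Rr t) = (if t = 0 then est_var p SR else noise_var p)"
| "coord_var p (Rd t) = (if t = 0 then est_var p SD else if t = 1 then est_var p RD else noise_var p)"

section \<open>Law of the coordinates of a block\<close>

locale af_network =
  fixes p :: relay_net
  assumes block_len: "2 < block_len p"
    and overlap: "0 < overlap p" "overlap p \<le> 1 / 2"
    and src_train_frac: "0 < src_train_frac p" "src_train_frac p < 1"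
    and rel_train_frac: "0 < rel_train_frac p" "rel_train_frac p < 1"
    and power: "0 < src_power p" "0 < rel_power p"
    and noise_var: "0 < noise_var p"
    and fading_sd: "\<And>l. 0 < fading_sd p l"
    and integral_dims: "(1 - 2 * overlap p) * (real (block_len p) - 2) \<in> \<int>"
      "overlap p * (real (block_len p) - 2) \<in> \<int>"
begin

abbreviation "Es \<equiv> src_symbol_energy p"
abbreviation "Er \<equiv> rel_symbol_energy p"
abbreviation "N0 \<equiv> noise_var p"

text \<open>Integrality is what makes the floors in \<open>dim1\<close> and \<open>dim2\<close>
  exact.\<close>

lemma dims: "real (dim1 p) = (1 - 2 * overlap p) * (real (block_len p) - 2)"
  "real (dim2 p) = overlap p * (real (block_len p) - 2)"
proof -
  have "0 \<le> (1 - 2 * overlap p) * (real (block_len p) - 2)" "0 \<le> overlap p * (real (block_len p) - 2)"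
    using overlap block_len by auto
  then show "real (dim1 p) = (1 - 2 * overlap p) * (real (block_len p) - 2)"
    "real (dim2 p) = overlap p * (real (block_len p) - 2)"
    using integral_dims by (auto simp: dim1_def dim2_def elim!: Ints_cases)
qed

lemma data_len_eq: "data_len p = dim1 p + dim2 p + dim2 p" and dim2_pos: "0 < dim2 p"
proof -
  have "real (data_len p) = real (dim1 p + dim2 p + dim2 p)"
    using dims block_len by (simp add: data_len_def algebra_simps of_nat_diff)
  then show "data_len p = dim1 p + dim2 p + dim2 p" by linarith
  have "0 < real (dim2 p)" using dims overlap block_len by simp
  then show "0 < dim2 p" by simp
qed

lemma Es_pos: "0 < Es" and Er_pos: "0 < Er"
  using src_train_frac rel_train_frac power block_len overlap
  by (simp_all add: src_symbol_energy_def rel_symbol_energy_def)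

lemma pilot_energy_pos: "0 < pilot_energy p l"
  using src_train_frac rel_train_frac power block_len by (cases l) auto

lemma pilot_denom_pos: "0 < (fading_sd p l)\<^sup>2 * pilot_energy p l + N0"
  using pilot_energy_pos[of l] noise_var by (simp add: add_nonneg_pos)

lemma est_var_pos: "0 < est_var p l" and err_var_pos: "0 < err_var p l"
  using pilot_energy_pos[of l] noise_var fading_sd[of l] pilot_denom_pos[of l] by (auto simp: est_var_def err_var_def)

lemma fading_sd_nonzero[simp]: "fading_sd p l \<noteq> 0"
  using fading_sd[of l] by simp

lemma raw_var_pos: "0 < raw_var p j"
  by (cases j) (simp_all add: Es_pos noise_var)

lemma coord_var_pos: "0 < coord_var p j"
  by (cases j) (simp_all add: Es_pos noise_var est_var_pos err_var_pos)

lemma prob_space_gauss_input: "prob_space (gauss_input p)"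
  unfolding gauss_input_def by (intro prob_space_PiM prob_space_complex_gaussian Es_pos)

lemma sets_gauss_input[simp, measurable_cong]: "sets (gauss_input p) = sets (\<Pi>\<^sub>M i\<in>{..<data_len p}. borel)"
  unfolding gauss_input_def by (intro sets_PiM_cong) auto

abbreviation "\<Omega> \<equiv> block_space p (gauss_input p)"

lemma sets_block_space: "sets \<Omega> = sets ((\<Pi>\<^sub>M i\<in>{..<data_len p}. borel) \<Otimes>\<^sub>M (\<Pi>\<^sub>M l\<in>UNIV. borel) \<Otimes>\<^sub>M
     (\<Pi>\<^sub>M t\<in>{..<block_len p}. borel) \<Otimes>\<^sub>M (\<Pi>\<^sub>M t\<in>{..<block_len p}. borel))"
  unfolding block_space_def
  by (intro sets_pair_measure_cong sets_gauss_input sets_PiM_cong sets_complex_gaussian refl)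

lemma measurable_block_space_components:
  "fst \<in> \<Omega> \<rightarrow>\<^sub>M (\<Pi>\<^sub>M i\<in>{..<data_len p}. borel)"
  "(\<lambda>\<omega>. fst (snd \<omega>)) \<in> \<Omega> \<rightarrow>\<^sub>M (\<Pi>\<^sub>M l\<in>UNIV. borel)"
  "(\<lambda>\<omega>. fst (snd (snd \<omega>))) \<in> \<Omega> \<rightarrow>\<^sub>M (\<Pi>\<^sub>M t\<in>{..<block_len p}. borel)"
  "(\<lambda>\<omega>. snd (snd (snd \<omega>))) \<in> \<Omega> \<rightarrow>\<^sub>M (\<Pi>\<^sub>M t\<in>{..<block_len p}. borel)"
  unfolding measurable_cong_sets[OF sets_block_space refl] by measurable

lemma measurable_raw_coord: "raw_coord p \<in> \<Omega> \<rightarrow>\<^sub>M (\<Pi>\<^sub>M j\<in>coords p. borel)"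
proof -
  note comp = measurable_block_space_components[THEN measurable_compose]
  have "(\<lambda>\<omega>. case j of Rx i \<Rightarrow> fst \<omega> i | Rh l \<Rightarrow> fst (snd \<omega>) l | Rr t \<Rightarrow> fst (snd (snd \<omega>)) t
      | Rd t \<Rightarrow> snd (snd (snd \<omega>)) t) \<in> borel_measurable \<Omega>" if j: "j \<in> coords p" for j
  proof (cases j)
    case (Rx i)
    then have "i \<in> {..<data_len p}" using j by (auto simp: coords_def)
    from comp(1)[OF measurable_component_singleton[OF this]] show ?thesis by (simp add: Rx)
  next
    case (Rh l)
    from comp(2)[OF measurable_component_singleton[OF UNIV_I[of l]]] show ?thesis by (simp add: Rh)
  next
    case (Rr t)
    then have "t \<in> {..<block_len p}" using j by (auto simp: coords_def)
    from comp(3)[OF measurable_component_singleton[OF this]] show ?thesis by (simp add: Rr)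
  next
    case (Rd t)
    then have "t \<in> {..<block_len p}" using j by (auto simp: coords_def)
    from comp(4)[OF measurable_component_singleton[OF this]] show ?thesis by (simp add: Rd)
  qed
  then show ?thesis
    unfolding raw_coord_def split_beta' by (rule measurable_restrict)
qed

lemma distr_raw_coord: "distr \<Omega> (\<Pi>\<^sub>M j\<in>coords p. borel) (raw_coord p) = gauss_prod (coords p) (raw_var p)"
proof -
  interpret R: product_prob_space "\<lambda>j. complex_gaussian 0 (raw_var p j)"
    by (rule product_prob_space_complex_gaussian) (rule raw_var_pos)
  have ps: "prob_space (gauss_prod I w)" if "\<And>i. 0 < w i" for I :: "'i set" and w
    using that by (intro prob_space_PiM prob_space_complex_gaussian)
  let ?H = "gauss_prod UNIV (\<lambda>l. (fading_sd p l)\<^sup>2)" and ?N = "gauss_prod {..<block_len p} (\<lambda>_. N0)"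
  interpret X: prob_space "gauss_input p" by (rule prob_space_gauss_input)
  interpret H: prob_space ?H by (intro ps) simp
  interpret N: prob_space ?N using noise_var by (intro ps)
  interpret NN: pair_prob_space ?N ?N ..
  interpret HNN: pair_prob_space ?H "?N \<Otimes>\<^sub>M ?N" ..
  show ?thesis
  proof (rule R.PiM_eqI)
    show "sets (distr \<Omega> (\<Pi>\<^sub>M j\<in>coords p. borel) (raw_coord p)) = sets (gauss_prod (coords p) (raw_var p))"
      by (simp cong: sets_PiM_cong)
    fix A assume "\<And>j. j \<in> coords p \<Longrightarrow> A j \<in> sets (complex_gaussian 0 (raw_var p j))"
    then have A: "\<And>j. j \<in> coords p \<Longrightarrow> A j \<in> sets borel" by simp
    let ?Bx = "Pi\<^sub>E {..<data_len p} (\<lambda>i. A (Rx i))" and ?Bh = "Pi\<^sub>E UNIV (\<lambda>l. A (Rh l))"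
      and ?Br = "Pi\<^sub>E {..<block_len p} (\<lambda>t. A (Rr t))" and ?Bd = "Pi\<^sub>E {..<block_len p} (\<lambda>t. A (Rd t))"
    have B[measurable]: "?Bx \<in> sets (gauss_input p)" "?Bh \<in> sets ?H" "?Br \<in> sets ?N" "?Bd \<in> sets ?N"
      using A unfolding gauss_input_def by (auto intro!: sets_PiM_I_finite simp: coords_def)
    have "raw_coord p -` Pi\<^sub>E (coords p) A \<inter> space \<Omega> = ?Bx \<times> ?Bh \<times> ?Br \<times> ?Bd"
    proof -
      have mem: "raw_coord p (x, h, nr, nd) \<in> Pi\<^sub>E (coords p) A \<longleftrightarrow>
          (\<forall>i<data_len p. x i \<in> A (Rx i)) \<and> (\<forall>l. h l \<in> A (Rh l)) \<and>
          (\<forall>t<block_len p. nr t \<in> A (Rr t)) \<and> (\<forall>t<block_len p. nd t \<in> A (Rd t))" (is "_ \<longleftrightarrow> ?Q x h nr nd") for x h nr nd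
        by (simp add: raw_coord_def restrict_PiE_iff) (simp add: coords_def ball_Un Pi_iff, simp add: Ball_def)
      have box: "(x, h, nr, nd) \<in> raw_coord p -` Pi\<^sub>E (coords p) A \<inter> space \<Omega> \<longleftrightarrow>
          (x, h, nr, nd) \<in> space \<Omega> \<and> ?Q x h nr nd" for x h nr nd
        by (simp only: Int_iff vimage_eq mem conj_ac)
      have box': "(x, h, nr, nd) \<in> ?Bx \<times> ?Bh \<times> ?Br \<times> ?Bd \<longleftrightarrow> (x, h, nr, nd) \<in> space \<Omega> \<and> ?Q x h nr nd" for x h nr nd
        unfolding block_space_def gauss_input_def
        by (simp only: mem_Times_iff fst_conv snd_conv space_pair_measure space_PiM PiE_iff space_complex_gaussian
            UNIV_I ball_UNIV lessThan_iff Ball_def simp_thms conj_ac)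
      show ?thesis
      proof (rule set_eqI)
        fix \<omega> :: outcome
        show "\<omega> \<in> raw_coord p -` Pi\<^sub>E (coords p) A \<inter> space \<Omega> \<longleftrightarrow> \<omega> \<in> ?Bx \<times> ?Bh \<times> ?Br \<times> ?Bd"
          by (cases \<omega>) (simp only: box box')
      qed
    qed
    then have "emeasure (distr \<Omega> (\<Pi>\<^sub>M j\<in>coords p. borel) (raw_coord p)) (Pi\<^sub>E (coords p) A) =
        emeasure \<Omega> (?Bx \<times> ?Bh \<times> ?Br \<times> ?Bd)"
      using A by (subst emeasure_distr[OF measurable_raw_coord]) (auto intro!: sets_PiM_I_finite)
    also have "\<dots> = emeasure (gauss_input p) ?Bx * (emeasure ?H ?Bh * (emeasure ?N ?Br * emeasure ?N ?Bd))"
      unfolding block_space_def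
      using B by (simp add: HNN.P.emeasure_pair_measure_Times NN.P.emeasure_pair_measure_Times N.emeasure_pair_measure_Times)
    also have "\<dots> = (\<Prod>j\<in>coords p. emeasure (complex_gaussian 0 (raw_var p j)) (A j))"
    proof -
      have box: "emeasure (gauss_prod I w) (Pi\<^sub>E I B) = (\<Prod>i\<in>I. emeasure (complex_gaussian 0 (w i)) (B i))"
        if "\<And>i. 0 < w i" "finite I" "\<And>i. i \<in> I \<Longrightarrow> B i \<in> sets borel" for I :: "'i set" and w B
      proof -
        interpret product_prob_space "\<lambda>i. complex_gaussian 0 (w i)"
          by (rule product_prob_space_complex_gaussian) fact
        show ?thesis using that by (intro emeasure_PiM) auto
      qed
      have "emeasure (gauss_input p) ?Bx = (\<Prod>i<data_len p. emeasure (complex_gaussian 0 Es) (A (Rx i)))"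
        unfolding gauss_input_def using A Es_pos by (intro box) (auto simp: coords_def)
      moreover have "emeasure ?H ?Bh = (\<Prod>l\<in>UNIV. emeasure (complex_gaussian 0 ((fading_sd p l)\<^sup>2)) (A (Rh l)))"
        using A by (intro box) (auto simp: coords_def)
      moreover have "emeasure ?N ?Br = (\<Prod>t<block_len p. emeasure (complex_gaussian 0 N0) (A (Rr t)))"
        using A noise_var by (intro box) (auto simp: coords_def)
      moreover have "emeasure ?N ?Bd = (\<Prod>t<block_len p. emeasure (complex_gaussian 0 N0) (A (Rd t)))"
        using A noise_var by (intro box) (auto simp: coords_def)
      moreover have "(\<Prod>j\<in>coords p. f j) = (\<Prod>i<data_len p. f (Rx i)) * ((\<Prod>l\<in>UNIV. f (Rh l)) *
          ((\<Prod>t<block_len p. f (Rr t)) * (\<Prod>t<block_len p. f (Rd t))))" for f :: "coord \<Rightarrow> ennreal"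
        unfolding coords_def
        by (subst prod.union_disjoint, simp, simp, blast)+ (simp add: prod.reindex inj_on_def mult.assoc)
      ultimately show ?thesis by simp
    qed
    finally show "emeasure (distr \<Omega> (\<Pi>\<^sub>M j\<in>coords p. borel) (raw_coord p)) (Pi\<^sub>E (coords p) A) =
      (\<Prod>j\<in>coords p. emeasure (complex_gaussian 0 (raw_var p j)) (A j))" .
  qed simp
qed

definition bayes_map :: "link \<Rightarrow> complex \<times> complex \<Rightarrow> complex \<times> complex" where
  "bayes_map l = (\<lambda>(h, n).
     let z = complex_of_real ((fading_sd p l)\<^sup>2 * sqrt (pilot_energy p l) /
       ((fading_sd p l)\<^sup>2 * pilot_energy p l + N0)) * (complex_of_real (sqrt (pilot_energy p l)) * h + n)
     in (h - z, z))"

lemma distr_bayes_map: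
  "distr (complex_gaussian 0 ((fading_sd p l)\<^sup>2) \<Otimes>\<^sub>M complex_gaussian 0 N0) (borel \<Otimes>\<^sub>M borel) (bayes_map l) =
    complex_gaussian 0 (err_var p l) \<Otimes>\<^sub>M complex_gaussian 0 (est_var p l)"
proof -
  have "((fading_sd p l)\<^sup>2 * sqrt (pilot_energy p l) / ((fading_sd p l)\<^sup>2 * pilot_energy p l + N0))\<^sup>2 *
      ((fading_sd p l)\<^sup>2 * pilot_energy p l + N0) = est_var p l"
    using pilot_denom_pos[of l] pilot_energy_pos[of l]
    by (simp add: est_var_def power_divide power_mult_distrib power2_eq_square[of "_ + _"])
  then show ?thesis
    using distr_complex_gaussian_mmse[of "(fading_sd p l)\<^sup>2" N0 "sqrt (pilot_energy p l)"]
      fading_sd[of l] noise_var pilot_energy_pos[of l]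
    by (simp add: bayes_map_def Let_def err_var_def less_imp_le)
qed

lemma measurable_bayes_map[measurable]: "bayes_map l \<in> borel \<Otimes>\<^sub>M borel \<rightarrow>\<^sub>M borel \<Otimes>\<^sub>M borel"
  unfolding bayes_map_def Let_def by measurable

definition bayes_update :: "link \<Rightarrow> (coord \<Rightarrow> complex) \<Rightarrow> (coord \<Rightarrow> complex)" where
  "bayes_update l v = v(Rh l := fst (bayes_map l (v (Rh l), v (pilot_coord l))),
     pilot_coord l := snd (bayes_map l (v (Rh l), v (pilot_coord l))))"

lemma distr_bayes_update:
  assumes "\<And>j. 0 < w j" "w (Rh l) = (fading_sd p l)\<^sup>2" "w (pilot_coord l) = N0"
  defines "w' \<equiv> w(Rh l := err_var p l, pilot_coord l := est_var p l)"
  shows "bayes_update l \<in> (\<Pi>\<^sub>M j\<in>coords p. borel) \<rightarrow>\<^sub>M (\<Pi>\<^sub>M j\<in>coords p. borel)"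
    "distr (gauss_prod (coords p) w) (\<Pi>\<^sub>M j\<in>coords p. borel) (bayes_update l) = gauss_prod (coords p) w'"
proof -
  have w': "0 < w' j" for j using assms(1) est_var_pos err_var_pos by (simp add: w'_def)
  have ne: "Rh l \<noteq> pilot_coord l" by (cases l) auto
  have inJ: "Rh l \<in> coords p" "pilot_coord l \<in> coords p" using block_len by (cases l; auto simp: coords_def)+
  have s: "sets (gauss_prod (coords p) w) = sets (\<Pi>\<^sub>M j\<in>coords p. borel)" for w
    by (intro sets_PiM_cong) auto
  have "bayes_update l \<in> gauss_prod (coords p) w \<rightarrow>\<^sub>M gauss_prod (coords p) w'"
    "distr (gauss_prod (coords p) w) (gauss_prod (coords p) w') (bayes_update l) = gauss_prod (coords p) w'"
    unfolding bayes_update_def[abs_def]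
    using distr_PiM_replace_pair[OF product_prob_space_complex_gaussian[OF assms(1)]
      product_prob_space_complex_gaussian[OF w'] finite_coords inJ ne, of "bayes_map l"]
      distr_bayes_map[of l] ne
    by (simp_all add: w'_def assms(2,3) cong: distr_cong)
  then show "bayes_update l \<in> (\<Pi>\<^sub>M j\<in>coords p. borel) \<rightarrow>\<^sub>M (\<Pi>\<^sub>M j\<in>coords p. borel)"
    "distr (gauss_prod (coords p) w) (\<Pi>\<^sub>M j\<in>coords p. borel) (bayes_update l) = gauss_prod (coords p) w'"
    by (simp_all add: s cong: measurable_cong_sets distr_cong)
qed

lemma measurable_bayes_update[measurable]:
  "bayes_update l \<in> (\<Pi>\<^sub>M j\<in>coords p. borel) \<rightarrow>\<^sub>M (\<Pi>\<^sub>M j\<in>coords p. borel)"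
proof (rule distr_bayes_update(1)[of "raw_var p"])
  show "raw_var p (pilot_coord l) = N0" by (cases l) simp_all
qed (simp_all add: raw_var_pos)

text \<open>The three links occupy disjoint pairs of coordinates, so the updates can be carried out
  one after the other and each still reads raw values.\<close>

lemma coord_eq: "coord p \<omega> = bayes_update RD (bayes_update SD (bayes_update SR (raw_coord p \<omega>)))"
proof -
  obtain x h nr nd where \<omega>: "\<omega> = (x, h, nr, nd)" by (cases \<omega>)
  have inJ: "Rh l \<in> coords p" "pilot_coord l \<in> coords p" for l using block_len by (cases l; auto simp: coords_def)+
  show ?thesis
  proof
    fix j
    note simps = coord_def raw_coord_def bayes_update_def bayes_map_def Let_def mmse_est_def pilot_obs_def
      restrict_def mult.commute \<omega>
    show "coord p \<omega> j = bayes_update RD (bayes_update SD (bayes_update SR (raw_coord p \<omega>))) j"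
    proof (cases j)
      case (Rh l)
      then show ?thesis
        using inJ(1) inJ(2)[of SR] inJ(2)[of SD] inJ(2)[of RD] by (cases l) (simp_all add: simps)
    qed (use inJ(1) inJ(2)[of SR] inJ(2)[of SD] inJ(2)[of RD] in \<open>auto simp: simps\<close>)
  qed
qed

lemma measurable_coord: "(\<lambda>\<omega>. coord p \<omega>) \<in> \<Omega> \<rightarrow>\<^sub>M (\<Pi>\<^sub>M j\<in>coords p. borel)"
  unfolding coord_eq
  by (rule measurable_compose[OF measurable_compose[OF measurable_compose[OF measurable_raw_coord
    measurable_bayes_update[of SR]] measurable_bayes_update[of SD]] measurable_bayes_update[of RD]])

lemma distr_coord: "distr \<Omega> (\<Pi>\<^sub>M j\<in>coords p. borel) (coord p) = gauss_prod (coords p) (coord_var p)"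
proof -
  let ?B = "\<Pi>\<^sub>M j\<in>coords p. borel :: complex measure"
  define w1 where "w1 = (raw_var p)(Rh SR := err_var p SR, pilot_coord SR := est_var p SR)"
  define w2 where "w2 = w1(Rh SD := err_var p SD, pilot_coord SD := est_var p SD)"
  define w3 where "w3 = w2(Rh RD := err_var p RD, pilot_coord RD := est_var p RD)"
  have w: "0 < w1 j" "0 < w2 j" for j
    by (simp_all add: w1_def w2_def raw_var_pos est_var_pos err_var_pos)
  have "w3 = coord_var p"
  proof
    fix j show "w3 j = coord_var p j"
    proof (cases j)
      case (Rh l)
      then show ?thesis by (cases l) (simp_all add: w1_def w2_def w3_def)
    qed (simp_all add: w1_def w2_def w3_def)
  qed
  have "distr \<Omega> ?B (coord p) = distr (distr (distr (distr \<Omega> ?B (raw_coord p)) ?B (bayes_update SR)) ?B (bayes_update SD)) ?B (bayes_update RD)"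
    using measurable_raw_coord by (simp add: distr_distr coord_eq[abs_def] comp_def)
  also have "\<dots> = gauss_prod (coords p) w3"
    unfolding distr_raw_coord
    apply (subst distr_bayes_update(2)[of "raw_var p" SR, folded w1_def], rule raw_var_pos, simp, simp)
    apply (subst distr_bayes_update(2)[of w1 SD, folded w2_def], rule w, simp add: w1_def, simp add: w1_def)
    apply (subst distr_bayes_update(2)[of w2 RD, folded w3_def], rule w, simp add: w1_def w2_def, simp add: w1_def w2_def)
    apply simp
    done
  finally show ?thesis by (simp add: \<open>w3 = coord_var p\<close>)
qed

end

lemma measurable_cnj[measurable (raw)]:
  "f \<in> borel_measurable M \<Longrightarrow> (\<lambda>x. cnj (f x)) \<in> borel_measurable M"
  by (intro borel_measurable_continuous_on[where f=cnj] continuous_intros)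

section \<open>The channel estimates and the remaining randomness, which is independent of
  them\<close>

context af_network begin

definition rest_coords :: "coord set" where
  "rest_coords = coords p - range pilot_coord"

definition rest :: "outcome \<Rightarrow> coord \<Rightarrow> complex" where
  "rest \<omega> = restrict (coord p \<omega>) rest_coords"

abbreviation "est_space \<equiv> \<Pi>\<^sub>M l\<in>(UNIV :: link set). (borel :: complex measure)"
abbreviation "rest_space \<equiv> \<Pi>\<^sub>M j\<in>rest_coords. (borel :: complex measure)"
abbreviation "est_law \<equiv> gauss_prod UNIV (est_var p)"
abbreviation "rest_law \<equiv> gauss_prod rest_coords (coord_var p)"

lemma finite_rest_coords[simp]: "finite rest_coords"
  by (simp add: rest_coords_def)

lemma sets_est_law[simp, measurable_cong]: "sets est_law = sets est_space"
  by (intro sets_PiM_cong) auto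

lemma sets_rest_law[simp, measurable_cong]: "sets rest_law = sets rest_space"
  by (intro sets_PiM_cong) auto

lemma prob_space_est_law: "prob_space est_law"
  by (intro prob_space_PiM prob_space_complex_gaussian est_var_pos)

lemma prob_space_rest_law: "prob_space rest_law"
  by (intro prob_space_PiM prob_space_complex_gaussian coord_var_pos)

lemma inj_pilot_coord: "inj pilot_coord"
proof (rule injI)
  fix k l :: link assume "pilot_coord k = pilot_coord l"
  then show "k = l" by (cases k; cases l) auto
qed

lemma pilot_coord_in_coords: "pilot_coord l \<in> coords p"
  using block_len by (cases l) (auto simp: coords_def)

lemma coord_var_pilot_coord: "coord_var p (pilot_coord l) = est_var p l"
  by (cases l) auto

lemma coord_pilot_coord: "coord p \<omega> (pilot_coord l) = mmse_est p l \<omega>"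
  using pilot_coord_in_coords[of l] by (cases \<omega>; cases l) (auto simp: coord_def)

lemma prob_space_block_space: "prob_space \<Omega>"
proof -
  interpret X: prob_space "gauss_input p" by (rule prob_space_gauss_input)
  interpret H: prob_space "gauss_prod UNIV (\<lambda>l. (fading_sd p l)\<^sup>2)"
    by (intro prob_space_PiM prob_space_complex_gaussian) simp
  interpret N: prob_space "gauss_prod {..<block_len p} (\<lambda>_. N0)"
    using noise_var by (intro prob_space_PiM prob_space_complex_gaussian)
  interpret NN: pair_prob_space "gauss_prod {..<block_len p} (\<lambda>_. N0)" "gauss_prod {..<block_len p} (\<lambda>_. N0)" ..
  interpret HNN: pair_prob_space "gauss_prod UNIV (\<lambda>l. (fading_sd p l)\<^sup>2)"
     "gauss_prod {..<block_len p} (\<lambda>_. N0) \<Otimes>\<^sub>M gauss_prod {..<block_len p} (\<lambda>_. N0)" ..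
  interpret XHNN: pair_prob_space "gauss_input p" "gauss_prod UNIV (\<lambda>l. (fading_sd p l)\<^sup>2) \<Otimes>\<^sub>M
     gauss_prod {..<block_len p} (\<lambda>_. N0) \<Otimes>\<^sub>M gauss_prod {..<block_len p} (\<lambda>_. N0)" ..
  show ?thesis unfolding block_space_def by (rule XHNN.P.prob_space_axioms)
qed

sublocale block: prob_space \<Omega> by (rule prob_space_block_space)
sublocale est: prob_space est_law by (rule prob_space_est_law)
sublocale rest: prob_space rest_law by (rule prob_space_rest_law)
sublocale est_rest: pair_prob_space est_law rest_law ..

definition split_coord :: "(coord \<Rightarrow> complex) \<Rightarrow> (link \<Rightarrow> complex) \<times> (coord \<Rightarrow> complex)" where
  "split_coord v = (\<lambda>l. v (pilot_coord l), restrict v rest_coords)"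

lemma measurable_split_coord: "split_coord \<in> (\<Pi>\<^sub>M j\<in>coords p. borel) \<rightarrow>\<^sub>M est_space \<Otimes>\<^sub>M rest_space"
proof -
  have 1: "(\<lambda>v. \<lambda>l\<in>UNIV. v (pilot_coord l)) \<in> (\<Pi>\<^sub>M j\<in>coords p. borel) \<rightarrow>\<^sub>M est_space"
    by (intro measurable_restrict measurable_component_singleton pilot_coord_in_coords)
  have 2: "(\<lambda>v. restrict v rest_coords) \<in> (\<Pi>\<^sub>M j\<in>coords p. borel) \<rightarrow>\<^sub>M rest_space"
    by (intro measurable_restrict measurable_component_singleton) (auto simp: rest_coords_def)
  show ?thesis unfolding split_coord_def using measurable_Pair[OF 1 2] by (simp add: restrict_UNIV)
qed

lemma split_coord_coord: "split_coord (coord p \<omega>) = (mmse_ests p \<omega>, rest \<omega>)"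
  by (simp add: split_coord_def coord_pilot_coord mmse_ests_def rest_def)

lemma measurable_est_rest: "(\<lambda>\<omega>. (mmse_ests p \<omega>, rest \<omega>)) \<in> \<Omega> \<rightarrow>\<^sub>M est_space \<Otimes>\<^sub>M rest_space"
  using measurable_compose[OF measurable_coord measurable_split_coord] by (simp add: split_coord_coord)

lemma measurable_mmse_ests: "mmse_ests p \<in> \<Omega> \<rightarrow>\<^sub>M est_space"
  using measurable_compose[OF measurable_est_rest measurable_fst] by simp

lemma measurable_rest: "rest \<in> \<Omega> \<rightarrow>\<^sub>M rest_space"
  using measurable_compose[OF measurable_est_rest measurable_snd] by simp

text \<open>By \<open>distr_coord\<close> all coordinates are independent; the estimates fill the
  slots \<open>range pilot_coord\<close> and \<open>rest\<close> fills the others. From here on,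
  conditioning on the estimates is Fubini's theorem.\<close>

lemma distr_est_rest:
  "distr \<Omega> (est_space \<Otimes>\<^sub>M rest_space) (\<lambda>\<omega>. (mmse_ests p \<omega>, rest \<omega>)) = est_law \<Otimes>\<^sub>M rest_law"
proof -
  let ?Z = "range pilot_coord"
  interpret C: product_prob_space "\<lambda>j. complex_gaussian 0 (coord_var p j)"
    by (rule product_prob_space_complex_gaussian) (rule coord_var_pos)
  have un: "?Z \<union> rest_coords = coords p" using pilot_coord_in_coords by (auto simp: rest_coords_def)
  have disj: "?Z \<inter> rest_coords = {}" by (auto simp: rest_coords_def)
  have B: "sets (gauss_prod (coords p) (coord_var p)) = sets (\<Pi>\<^sub>M j\<in>coords p. borel)" by (intro sets_PiM_cong) auto
  let ?G = "gauss_prod ?Z (coord_var p)"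
  have "distr \<Omega> (est_space \<Otimes>\<^sub>M rest_space) (\<lambda>\<omega>. (mmse_ests p \<omega>, rest \<omega>)) =
      distr (distr \<Omega> (\<Pi>\<^sub>M j\<in>coords p. borel) (coord p)) (est_space \<Otimes>\<^sub>M rest_space) split_coord"
    by (subst distr_distr[OF measurable_split_coord measurable_coord]) (simp add: comp_def split_coord_coord)
  also have "\<dots> = distr (gauss_prod (coords p) (coord_var p)) (est_space \<Otimes>\<^sub>M rest_space) split_coord"
    unfolding distr_coord ..
  also have "\<dots> = distr (distr (?G \<Otimes>\<^sub>M rest_law) (gauss_prod (coords p) (coord_var p)) (merge ?Z rest_coords)) (est_space \<Otimes>\<^sub>M rest_space) split_coord"
    using C.distr_merge[OF disj, folded un] by (simp add: un)
  also have "\<dots> = distr (?G \<Otimes>\<^sub>M rest_law) (est_space \<Otimes>\<^sub>M rest_space) (split_coord \<circ> merge ?Z rest_coords)"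
  proof (rule distr_distr)
    show "split_coord \<in> gauss_prod (coords p) (coord_var p) \<rightarrow>\<^sub>M est_space \<Otimes>\<^sub>M rest_space"
      using measurable_split_coord by (simp cong: measurable_cong_sets add: B)
    show "merge ?Z rest_coords \<in> ?G \<Otimes>\<^sub>M rest_law \<rightarrow>\<^sub>M gauss_prod (coords p) (coord_var p)"
      unfolding un[symmetric] by (rule measurable_merge)
  qed
  also have "\<dots> = distr (?G \<Otimes>\<^sub>M rest_law) (est_space \<Otimes>\<^sub>M rest_space) (\<lambda>(z, r). (\<lambda>l. z (pilot_coord l), r))"
  proof (rule distr_cong[OF refl refl])
    fix x assume "x \<in> space (?G \<Otimes>\<^sub>M rest_law)"
    then have "snd x \<in> extensional rest_coords" by (auto simp: space_pair_measure space_PiM PiE_iff)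
    then show "(split_coord \<circ> merge ?Z rest_coords) x = (case x of (z, r) \<Rightarrow> (\<lambda>l. z (pilot_coord l), r))"
      using disj by (cases x) (auto simp: split_coord_def merge_def fun_eq_iff extensional_def)
  qed
  also have "\<dots> = distr ?G est_space (\<lambda>z l. z (pilot_coord l)) \<Otimes>\<^sub>M distr rest_law rest_space (\<lambda>r. r)"
  proof (rule pair_measure_distr[symmetric])
    have "(\<lambda>z. \<lambda>l\<in>UNIV. z (pilot_coord l)) \<in> ?G \<rightarrow>\<^sub>M est_space"
    proof (rule measurable_restrict)
      fix l :: link
      show "(\<lambda>z. z (pilot_coord l)) \<in> borel_measurable ?G"
        using measurable_component_singleton[of "pilot_coord l" ?Z "\<lambda>j. complex_gaussian 0 (coord_var p j)"]
        by (simp cong: measurable_cong_sets)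
    qed
    then show "(\<lambda>z l. z (pilot_coord l)) \<in> ?G \<rightarrow>\<^sub>M est_space" by (simp add: restrict_UNIV)
    show "(\<lambda>r. r) \<in> rest_law \<rightarrow>\<^sub>M rest_space" by measurable
    show "sigma_finite_measure (distr rest_law rest_space (\<lambda>r. r))"
      by (intro prob_space_imp_sigma_finite rest.prob_space_distr) measurable
  qed
  also have "distr rest_law rest_space (\<lambda>r. r) = rest_law"
    by (rule distr_id2) simp
  also have "distr ?G est_space (\<lambda>z l. z (pilot_coord l)) = est_law"
  proof -
    have "distr ?G (\<Pi>\<^sub>M l\<in>UNIV. complex_gaussian 0 (coord_var p (pilot_coord l))) (\<lambda>z. \<lambda>l\<in>UNIV. z (pilot_coord l)) =
        (\<Pi>\<^sub>M l\<in>UNIV. complex_gaussian 0 (coord_var p (pilot_coord l)))"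
      by (rule distr_PiM_reindex) (auto intro!: prob_space_complex_gaussian coord_var_pos inj_pilot_coord)
    then show ?thesis by (simp add: coord_var_pilot_coord restrict_UNIV cong: distr_cong)
  qed
  finally show ?thesis .
qed

lemma nn_integral_est_rest:
  fixes f :: "(link \<Rightarrow> complex) \<times> (coord \<Rightarrow> complex) \<Rightarrow> ennreal"
  assumes [measurable]: "f \<in> borel_measurable (est_space \<Otimes>\<^sub>M rest_space)"
  shows "(\<integral>\<^sup>+\<omega>. f (mmse_ests p \<omega>, rest \<omega>) \<partial>\<Omega>) = (\<integral>\<^sup>+z. \<integral>\<^sup>+r. f (z, r) \<partial>rest_law \<partial>est_law)"
proof -
  have "(\<integral>\<^sup>+\<omega>. f (mmse_ests p \<omega>, rest \<omega>) \<partial>\<Omega>) = (\<integral>\<^sup>+x. f x \<partial>(est_law \<Otimes>\<^sub>M rest_law))"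
    unfolding distr_est_rest[symmetric] by (subst nn_integral_distr[OF measurable_est_rest]) auto
  then show ?thesis by (simp add: rest.nn_integral_fst)
qed

lemma nn_integral_est:
  fixes f :: "(link \<Rightarrow> complex) \<Rightarrow> ennreal"
  assumes [measurable]: "f \<in> borel_measurable est_space"
  shows "(\<integral>\<^sup>+\<omega>. f (mmse_ests p \<omega>) \<partial>\<Omega>) = (\<integral>\<^sup>+z. f z \<partial>est_law)"
  using nn_integral_est_rest[of "\<lambda>x. f (fst x)"] by (simp add: rest.emeasure_space_1)

lemma distr_mmse_ests: "distr \<Omega> est_space (mmse_ests p) = est_law"
proof (rule measure_eqI)
  fix A assume "A \<in> sets (distr \<Omega> est_space (mmse_ests p))"
  then have [measurable]: "A \<in> sets est_space" by simp
  show "emeasure (distr \<Omega> est_space (mmse_ests p)) A = emeasure est_law A"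
    using nn_integral_est[of "indicator A"]
    by (subst nn_integral_indicator[symmetric], simp, subst nn_integral_distr[OF measurable_mmse_ests]) auto
qed simp

lemma nn_integral_est_square: "(\<integral>\<^sup>+z. ennreal ((cmod (z l))\<^sup>2) \<partial>est_law) = ennreal (est_var p l)"
proof -
  have "(\<integral>\<^sup>+z. ennreal ((cmod (z l))\<^sup>2) \<partial>est_law) =
     (\<integral>\<^sup>+x. ennreal ((cmod x)\<^sup>2) \<partial>distr est_law (complex_gaussian 0 (est_var p l)) (\<lambda>z. z l))"
    by (subst nn_integral_distr) auto
  also have "distr est_law (complex_gaussian 0 (est_var p l)) (\<lambda>z. z l) = complex_gaussian 0 (est_var p l)"
    by (rule distr_PiM_component) (auto intro!: prob_space_complex_gaussian est_var_pos)
  finally show ?thesis by (simp add: nn_integral_complex_gaussian_square est_var_pos)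
qed

text \<open>\<open>V z\<close> is the conditional second moment given estimates \<open>z\<close>:
  once \<open>z\<close> is frozen, the signal is a multi-affine form in independent centred
  variables. The weight \<open>k\<close> may be any nonnegative function of the estimates, such as
  an inverse variance or a squared gain.\<close>

lemma nn_integral_cond_square:
  fixes F :: "(link \<Rightarrow> complex) \<Rightarrow> (coord \<Rightarrow> complex) \<Rightarrow> complex"
  assumes [measurable]: "(\<lambda>x. F (fst x) (snd x)) \<in> borel_measurable (est_space \<Otimes>\<^sub>M rest_space)"
    "k \<in> borel_measurable est_space" and k: "\<And>z. 0 \<le> k z"
    and F: "\<And>z r. F z r = multi_affine (L z) r"
    and L: "\<And>z S c. (S, c) \<in> set (L z) \<Longrightarrow> S \<subseteq> rest_coords" "\<And>z. distinct (map fst (L z))"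
    and V: "\<And>z. (\<Sum>(S, c)\<leftarrow>L z. (cmod c)\<^sup>2 * (\<Prod>j\<in>S. coord_var p j)) = V z"
  shows "(\<integral>\<^sup>+\<omega>. ennreal (k (mmse_ests p \<omega>) * (cmod (F (mmse_ests p \<omega>) (rest \<omega>)))\<^sup>2) \<partial>\<Omega>) =
    (\<integral>\<^sup>+z. ennreal (k z * V z) \<partial>est_law)"
proof -
  have "(\<integral>\<^sup>+\<omega>. ennreal (k (mmse_ests p \<omega>) * (cmod (F (mmse_ests p \<omega>) (rest \<omega>)))\<^sup>2) \<partial>\<Omega>) =
      (\<integral>\<^sup>+z. \<integral>\<^sup>+r. ennreal (k z * (cmod (F z r))\<^sup>2) \<partial>rest_law \<partial>est_law)"
    using nn_integral_est_rest[of "\<lambda>x. ennreal (k (fst x) * (cmod (F (fst x) (snd x)))\<^sup>2)"] by simp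
  also have "\<dots> = (\<integral>\<^sup>+z. ennreal (k z * V z) \<partial>est_law)"
  proof (rule nn_integral_cong)
    fix z assume z: "z \<in> space est_law"
    then have [measurable]: "F z \<in> borel_measurable rest_law"
      using measurable_compose_Pair1[of z est_space "\<lambda>x. F (fst x) (snd x)" rest_space]
      by (simp add: space_PiM cong: measurable_cong_sets)
    have "(\<integral>\<^sup>+r. ennreal (k z * (cmod (F z r))\<^sup>2) \<partial>rest_law) = ennreal (k z) * (\<integral>\<^sup>+r. ennreal ((cmod (F z r))\<^sup>2) \<partial>rest_law)"
      using k by (simp add: ennreal_mult nn_integral_cmult)
    also have "\<dots> = ennreal (k z) * ennreal (V z)"
      unfolding F V[symmetric]
      by (subst nn_integral_multi_affine_square[OF finite_rest_coords coord_var_pos L(1) L(2)]) auto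
    finally show "(\<integral>\<^sup>+r. ennreal (k z * (cmod (F z r))\<^sup>2) \<partial>rest_law) = ennreal (k z * V z)"
      using k by (simp add: ennreal_mult')
  qed
  finally show ?thesis .
qed

text \<open>The counterpart of \<open>nn_integral_cond_square\<close> for complex cross terms, where
  integrability must be supplied before Fubini applies. It yields the uncorrelatedness of the relay
  symbols.\<close>

lemma integral_cond_inner:
  fixes F G :: "(link \<Rightarrow> complex) \<Rightarrow> (coord \<Rightarrow> complex) \<Rightarrow> complex" and k :: "(link \<Rightarrow> complex) \<Rightarrow> complex"
  assumes [measurable]: "(\<lambda>x. F (fst x) (snd x)) \<in> borel_measurable (est_space \<Otimes>\<^sub>M rest_space)"
    "(\<lambda>x. G (fst x) (snd x)) \<in> borel_measurable (est_space \<Otimes>\<^sub>M rest_space)"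
    "k \<in> borel_measurable est_space" "V \<in> borel_measurable est_space"
    and int: "integrable \<Omega> (\<lambda>\<omega>. k (mmse_ests p \<omega>) * (F (mmse_ests p \<omega>) (rest \<omega>) * cnj (G (mmse_ests p \<omega>) (rest \<omega>))))"
    and F: "\<And>z r. F z r = multi_affine (L z) r" and G: "\<And>z r. G z r = multi_affine (L' z) r"
    and L: "\<And>z S c. (S, c) \<in> set (L z) \<Longrightarrow> S \<subseteq> rest_coords" 
    and L': "\<And>z S c. (S, c) \<in> set (L' z) \<Longrightarrow> S \<subseteq> rest_coords"
    and V: "\<And>z. (\<Sum>(S, c)\<leftarrow>L z. \<Sum>(T, d)\<leftarrow>L' z. if S = T then c * cnj d * complex_of_real (\<Prod>j\<in>S. coord_var p j) else 0) = V z"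
  shows "(\<integral>\<omega>. k (mmse_ests p \<omega>) * (F (mmse_ests p \<omega>) (rest \<omega>) * cnj (G (mmse_ests p \<omega>) (rest \<omega>))) \<partial>\<Omega>) =
    (\<integral>\<omega>. k (mmse_ests p \<omega>) * V (mmse_ests p \<omega>) \<partial>\<Omega>)"
proof -
  let ?f = "\<lambda>x. k (fst x) * (F (fst x) (snd x) * cnj (G (fst x) (snd x)))"
  have int': "integrable (est_law \<Otimes>\<^sub>M rest_law) ?f"
    unfolding distr_est_rest[symmetric] using int
    by (subst integrable_distr_eq[OF measurable_est_rest]) auto
  have "(\<integral>\<omega>. ?f (mmse_ests p \<omega>, rest \<omega>) \<partial>\<Omega>) = (\<integral>x. ?f x \<partial>(est_law \<Otimes>\<^sub>M rest_law))"
    unfolding distr_est_rest[symmetric] by (subst integral_distr[OF measurable_est_rest]) auto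
  also have "\<dots> = (\<integral>z. (\<integral>r. ?f (z, r) \<partial>rest_law) \<partial>est_law)"
    by (rule est_rest.integral_fst'[symmetric, OF int'])
  also have "\<dots> = (\<integral>z. k z * V z \<partial>est_law)"
  proof (rule Bochner_Integration.integral_cong[OF refl])
    fix z
    have "has_bochner_integral rest_law (\<lambda>r. multi_affine (L z) r * cnj (multi_affine (L' z) r))
       (\<Sum>(S, c)\<leftarrow>L z. \<Sum>(T, d)\<leftarrow>L' z. if S = T then c * cnj d * complex_of_real (\<Prod>j\<in>S. coord_var p j) else 0)"
      by (rule has_bochner_integral_multi_affine_inner[OF finite_rest_coords coord_var_pos]) (fact L, fact L')
    then show "(\<integral>r. ?f (z, r) \<partial>rest_law) = k z * V z"
      by (simp add: F G V has_bochner_integral_iff)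
  qed
  also have "\<dots> = (\<integral>\<omega>. k (mmse_ests p \<omega>) * V (mmse_ests p \<omega>) \<partial>\<Omega>)"
    unfolding distr_mmse_ests[symmetric] by (subst integral_distr[OF measurable_mmse_ests]) auto
  finally show ?thesis by simp
qed

lemma range_pilot_coord: "range pilot_coord = {Rr 0, Rd 0, Rd 1}"
  by (auto simp: UNIV_link)

lemma rest_coords_simps[simp]:
  "Rx i \<in> rest_coords \<longleftrightarrow> i < data_len p" "Rh l \<in> rest_coords"
  "Rr t \<in> rest_coords \<longleftrightarrow> 0 < t \<and> t < block_len p" "Rd t \<in> rest_coords \<longleftrightarrow> 1 < t \<and> t < block_len p"
  using block_len unfolding rest_coords_def range_pilot_coord by (auto simp: coords_def)

lemma rest_simps:
  "i < data_len p \<Longrightarrow> rest (x, h, nr, nd) (Rx i) = x i"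
  "rest (x, h, nr, nd) (Rh l) = h l - mmse_ests p (x, h, nr, nd) l"
  "0 < t \<Longrightarrow> t < block_len p \<Longrightarrow> rest (x, h, nr, nd) (Rr t) = nr t"
  "1 < t \<Longrightarrow> t < block_len p \<Longrightarrow> rest (x, h, nr, nd) (Rd t) = nd t"
proof -
  have "j \<in> rest_coords \<Longrightarrow> j \<in> coords p" for j by (simp add: rest_coords_def)
  note this[of "Rx i"] this[of "Rh l"] this[of "Rr t"] this[of "Rd t"]
  then show "i < data_len p \<Longrightarrow> rest (x, h, nr, nd) (Rx i) = x i"
    "rest (x, h, nr, nd) (Rh l) = h l - mmse_ests p (x, h, nr, nd) l"
    "0 < t \<Longrightarrow> t < block_len p \<Longrightarrow> rest (x, h, nr, nd) (Rr t) = nr t"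
    "1 < t \<Longrightarrow> t < block_len p \<Longrightarrow> rest (x, h, nr, nd) (Rd t) = nd t"
    by (simp_all add: rest_def coord_def mmse_ests_def)
qed

lemma measurable_rest_space_component:
  "j \<in> rest_coords \<Longrightarrow> f \<in> M \<rightarrow>\<^sub>M rest_space \<Longrightarrow> (\<lambda>x. f x j) \<in> borel_measurable M"
  by (rule measurable_compose[OF _ measurable_component_singleton])

lemma measurable_est_space_component:
  "f \<in> M \<rightarrow>\<^sub>M est_space \<Longrightarrow> (\<lambda>x. f x l) \<in> borel_measurable M"
  by (rule measurable_compose[OF _ measurable_component_singleton]) auto

lemma measurable_mmse_est[measurable]: "mmse_est p l \<in> borel_measurable \<Omega>"
  using measurable_est_space_component[OF measurable_mmse_ests, of l] by (simp add: mmse_ests_def)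

lemma add_two_less_block_len: "i < data_len p \<Longrightarrow> 2 + i < block_len p"
  by (simp add: data_len_def)

subsection \<open>Admissible input and relay gain\<close>

lemma admissible_gauss_input: "admissible_input p (gauss_input p)"
proof -
  interpret X: prob_space "gauss_input p" by (rule prob_space_gauss_input)
  have mom: "has_bochner_integral (gauss_input p) (\<lambda>x. x i * cnj (x j)) (if i = j then complex_of_real Es else 0)"
    if "i < data_len p" "j < data_len p" for i j
    using has_bochner_integral_monomials[of "{..<data_len p}" "\<lambda>_. Es" "{i}" "{j}"] that Es_pos
    by (cases "i = j") (simp_all add: gauss_input_def)
  have meas: "(\<lambda>x. x i) \<in> borel_measurable (gauss_input p)" if "i < data_len p" for i
    using that measurable_component_singleton[of i "{..<data_len p}" "\<lambda>_. borel"]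
    by (simp cong: measurable_cong_sets)
  have dist: "distr (gauss_input p) borel (\<lambda>x. x i) = complex_gaussian 0 Es" if "i < data_len p" for i
  proof -
    have "distr (gauss_input p) borel (\<lambda>x. x i) = distr (gauss_input p) (complex_gaussian 0 Es) (\<lambda>x. x i)"
      by (intro distr_cong) auto
    then show ?thesis
      unfolding gauss_input_def using that Es_pos
      by (subst (asm) distr_PiM_component) (auto intro!: prob_space_complex_gaussian)
  qed
  have "X.indep_vars (\<lambda>_. borel) (\<lambda>i x. x i) {..<data_len p}"
  proof (subst X.indep_vars_iff_distr_eq_PiM')
    show "{..<data_len p} \<noteq> {}" using block_len by (auto simp: data_len_def lessThan_empty_iff)
    have "distr (gauss_input p) (\<Pi>\<^sub>M i\<in>{..<data_len p}. borel) (\<lambda>x. \<lambda>i\<in>{..<data_len p}. x i) = distr (gauss_input p) (\<Pi>\<^sub>M i\<in>{..<data_len p}. borel) (\<lambda>x. x)"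
      by (intro distr_cong) (auto simp: gauss_input_def space_PiM PiE_iff extensional_restrict)
    also have "\<dots> = gauss_input p" by (rule distr_id2) simp
    also have "\<dots> = (\<Pi>\<^sub>M i\<in>{..<data_len p}. distr (gauss_input p) borel (\<lambda>x. x i))"
      unfolding gauss_input_def by (rule PiM_cong) (auto simp: dist[unfolded gauss_input_def])
    finally show "distr (gauss_input p) (\<Pi>\<^sub>M i\<in>{..<data_len p}. borel) (\<lambda>x. \<lambda>i\<in>{..<data_len p}. x i) =
        (\<Pi>\<^sub>M i\<in>{..<data_len p}. distr (gauss_input p) borel (\<lambda>x. x i))" .
  qed (simp add: meas)
  moreover have "pilot_energy p SD + (\<integral>x. (\<Sum>i<data_len p. (cmod (x i))\<^sup>2) \<partial>gauss_input p)
       \<le> real (block_len p) * src_power p"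
  proof -
    have sq: "has_bochner_integral (gauss_input p) (\<lambda>x. (cmod (x i))\<^sup>2) Es" if "i < data_len p" for i
    proof -
      have "has_bochner_integral (gauss_input p) (\<lambda>x. complex_of_real ((cmod (x i))\<^sup>2)) (complex_of_real Es)"
        using mom[OF that that] by (simp only: complex_norm_square if_True simp_thms)
      from has_bochner_integral_bounded_linear[OF bounded_linear_Re this] show ?thesis
        by (simp only: Re_complex_of_real)
    qed
    \<comment> \<open>The number of data symbols cancels the denominator of \<open>Es\<close>, so
      that pilot and data together exhaust the energy budget exactly.\<close>
    have "(\<integral>x. (\<Sum>i<data_len p. (cmod (x i))\<^sup>2) \<partial>gauss_input p) = (\<Sum>i<data_len p. Es)"
      by (intro has_bochner_integral_integral_eq has_bochner_integral_sum) (simp add: sq)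
    also have "\<dots> = (real (block_len p) - 2) * Es" using block_len by (simp add: data_len_def of_nat_diff)
    also have "\<dots> = (1 - src_train_frac p) * real (block_len p) * src_power p"
      using block_len by (simp add: src_symbol_energy_def)
    finally show ?thesis by (simp add: algebra_simps)
  qed
  ultimately show ?thesis
    using mom unfolding admissible_input_def
    by (simp add: prob_space_gauss_input has_bochner_integral_iff)
qed

text \<open>The denominator is the energy of one relay observation given the estimate: the estimated
  channel and the estimation error, both acting on data of energy \<open>Es\<close>, plus
  noise.\<close>

definition gain :: "complex \<Rightarrow> real" where
  "gain z = sqrt (Er / (((cmod z)\<^sup>2 + err_var p SR) * Es + N0))"

lemma gain_denom_pos: "0 < ((cmod z)\<^sup>2 + err_var p SR) * Es + N0"
  using err_var_pos[of SR] Es_pos noise_var by (intro add_nonneg_pos) auto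

lemma gain_nonneg: "0 \<le> gain z"
  using gain_denom_pos[of z] Er_pos by (simp add: gain_def)

lemma gain_square: "(gain z)\<^sup>2 * (((cmod z)\<^sup>2 + err_var p SR) * Es + N0) = Er"
  using gain_denom_pos[of z] Er_pos by (simp add: gain_def)

lemma measurable_gain[measurable]: "gain \<in> borel_measurable borel"
  unfolding gain_def by measurable

text \<open>The relay's reception in the new coordinates, where the true fading is estimate plus
  error.\<close>

definition relay_obs :: "nat \<Rightarrow> (link \<Rightarrow> complex) \<Rightarrow> (coord \<Rightarrow> complex) \<Rightarrow> complex" where
  "relay_obs i z r = (z SR + r (Rh SR)) * r (Rx (dim1 p + i)) + r (Rr (2 + dim1 p + i))"

lemma relay_obs_rest:
  assumes "i < dim2 p"
  shows "y_r p i \<omega> = relay_obs i (mmse_ests p \<omega>) (rest \<omega>)"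
proof -
  have "dim1 p + i < data_len p" using assms data_len_eq by simp
  then show ?thesis
    using add_two_less_block_len[of "dim1 p + i"] by (cases \<omega>) (simp add: y_r_def relay_obs_def rest_simps)
qed

lemma measurable_relay_obs[measurable (raw)]:
  assumes "i < dim2 p" and [measurable]: "f \<in> M \<rightarrow>\<^sub>M est_space" "g \<in> M \<rightarrow>\<^sub>M rest_space"
  shows "(\<lambda>x. relay_obs i (f x) (g x)) \<in> borel_measurable M"
proof -
  have "dim1 p + i < data_len p" using assms data_len_eq by simp
  then have [measurable]: "(\<lambda>x. g x (Rx (dim1 p + i))) \<in> borel_measurable M"
    "(\<lambda>x. g x (Rr (2 + dim1 p + i))) \<in> borel_measurable M"
    "(\<lambda>x. g x (Rh SR)) \<in> borel_measurable M"
    using add_two_less_block_len[of "dim1 p + i"]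
    by (auto intro!: measurable_rest_space_component[OF _ assms(3)])
  note [measurable] = measurable_est_space_component[OF assms(2), of SR]
  show ?thesis unfolding relay_obs_def by measurable
qed

definition relay_obs_terms :: "nat \<Rightarrow> (link \<Rightarrow> complex) \<Rightarrow> (coord set \<times> complex) list" where
  "relay_obs_terms i z =
    [({Rx (dim1 p + i)}, z SR), ({Rh SR, Rx (dim1 p + i)}, 1), ({Rr (2 + dim1 p + i)}, 1)]"

lemma relay_obs_eq: "relay_obs i z r = multi_affine (relay_obs_terms i z) r"
  by (simp add: relay_obs_def relay_obs_terms_def algebra_simps)

lemma relay_obs_terms_coords:
  "i < dim2 p \<Longrightarrow> (S, c) \<in> set (relay_obs_terms i z) \<Longrightarrow> S \<subseteq> rest_coords"
  using data_len_eq add_two_less_block_len[of "dim1 p + i"] by (auto simp: relay_obs_terms_def)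

lemma nn_integral_relay_signal:
  assumes i: "i < dim2 p"
  shows "(\<integral>\<^sup>+\<omega>. ennreal ((cmod (x_r p gain i \<omega>))\<^sup>2) \<partial>\<Omega>) = ennreal Er"
proof -
  have "(\<integral>\<^sup>+\<omega>. ennreal ((cmod (x_r p gain i \<omega>))\<^sup>2) \<partial>\<Omega>) =
      (\<integral>\<^sup>+\<omega>. ennreal ((gain (mmse_ests p \<omega> SR))\<^sup>2 * (cmod (relay_obs i (mmse_ests p \<omega>) (rest \<omega>)))\<^sup>2) \<partial>\<Omega>)"
    by (simp add: x_r_def norm_mult power_mult_distrib relay_obs_rest[OF i] mmse_ests_def)
  also have "\<dots> = (\<integral>\<^sup>+z. ennreal ((gain (z SR))\<^sup>2 * (((cmod (z SR))\<^sup>2 + err_var p SR) * Es + N0)) \<partial>est_law)"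
  proof (rule nn_integral_cond_square[where L="relay_obs_terms i"])
    show "(\<Sum>(S, c)\<leftarrow>relay_obs_terms i z. (cmod c)\<^sup>2 * prod (coord_var p) S) = ((cmod (z SR))\<^sup>2 + err_var p SR) * Es + N0" for z
      by (simp add: relay_obs_terms_def algebra_simps)
    show "distinct (map fst (relay_obs_terms i z))" for z by (auto simp: relay_obs_terms_def)
    show "(\<lambda>x. relay_obs i (fst x) (snd x)) \<in> borel_measurable (est_space \<Otimes>\<^sub>M rest_space)"
      using i by measurable
    show "(\<lambda>z. (gain (z SR))\<^sup>2) \<in> borel_measurable est_space" by measurable
  qed (simp, rule relay_obs_eq, erule relay_obs_terms_coords[OF i])
  also have "\<dots> = ennreal Er" using est.emeasure_space_1 by (simp add: gain_square)
  finally show ?thesis .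
qed

lemma measurable_x_r:
  assumes "i < dim2 p" shows "x_r p gain i \<in> borel_measurable \<Omega>"
proof -
  note [measurable] = measurable_mmse_ests measurable_rest
  have "x_r p gain i = (\<lambda>\<omega>. complex_of_real (gain (mmse_ests p \<omega> SR)) * relay_obs i (mmse_ests p \<omega>) (rest \<omega>))"
    by (auto simp: x_r_def relay_obs_rest[OF assms] mmse_ests_def)
  then show ?thesis using assms by simp
qed

lemma has_bochner_integral_relay_signal:
  assumes "i < dim2 p"
  shows "has_bochner_integral \<Omega> (\<lambda>\<omega>. (cmod (x_r p gain i \<omega>))\<^sup>2) Er"
  using nn_integral_relay_signal[OF assms] Er_pos measurable_x_r[OF assms]
  by (intro has_bochner_integral_nn_integral) auto

lemma integrable_relay_products:
  assumes "i < dim2 p" "j < dim2 p"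
  shows "integrable \<Omega> (\<lambda>\<omega>. x_r p gain i \<omega> * cnj (x_r p gain j \<omega>))"
proof (rule Bochner_Integration.integrable_bound)
  show "integrable \<Omega> (\<lambda>\<omega>. (cmod (x_r p gain i \<omega>))\<^sup>2 + (cmod (x_r p gain j \<omega>))\<^sup>2)"
    using assms has_bochner_integral_relay_signal by (auto simp: has_bochner_integral_iff)
  have "a * b \<le> a\<^sup>2 + b\<^sup>2" for a b :: real
    using sum_squares_bound[of a b] zero_le_power2[of a] zero_le_power2[of b] by linarith
  then show "AE \<omega> in \<Omega>. norm (x_r p gain i \<omega> * cnj (x_r p gain j \<omega>)) \<le>
      norm ((cmod (x_r p gain i \<omega>))\<^sup>2 + (cmod (x_r p gain j \<omega>))\<^sup>2)"
    by (simp add: norm_mult)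
qed (use assms measurable_x_r in measurable)

text \<open>The weights \<open>indicator B\<close> test against all events determined by the relay's
  estimate, which characterises the conditional expectation. For \<open>i \<noteq> j\<close> the two
  observations have no monomial in common; for \<open>i = j\<close>, \<open>gain_square\<close>
  makes the conditional energy constant.\<close>

lemma integral_relay_products:
  assumes ij: "i < dim2 p" "j < dim2 p" and [measurable]: "B \<in> sets borel"
  shows "(\<integral>\<omega>. indicator B (mmse_est p SR \<omega>) * (x_r p gain i \<omega> * cnj (x_r p gain j \<omega>)) \<partial>\<Omega>) =
    (\<integral>\<omega>. indicator B (mmse_est p SR \<omega>) * (if i = j then complex_of_real Er else 0) \<partial>\<Omega>)"
proof -
  note [measurable] = measurable_mmse_ests measurable_rest
  let ?k = "\<lambda>z. indicator B (z SR) * (complex_of_real (gain (z SR)))\<^sup>2"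
  let ?V = "\<lambda>z. if i = j then complex_of_real (((cmod (z SR))\<^sup>2 + err_var p SR) * Es + N0) else 0"
  have eq: "indicator B (mmse_est p SR \<omega>) * (x_r p gain i \<omega> * cnj (x_r p gain j \<omega>)) =
      ?k (mmse_ests p \<omega>) * (relay_obs i (mmse_ests p \<omega>) (rest \<omega>) * cnj (relay_obs j (mmse_ests p \<omega>) (rest \<omega>)))" for \<omega>
    using ij by (simp add: x_r_def relay_obs_rest mmse_ests_def power2_eq_square)
  have "(\<integral>\<omega>. indicator B (mmse_est p SR \<omega>) * (x_r p gain i \<omega> * cnj (x_r p gain j \<omega>)) \<partial>\<Omega>) =
     (\<integral>\<omega>. ?k (mmse_ests p \<omega>) * ?V (mmse_ests p \<omega>) \<partial>\<Omega>)"
    unfolding eq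
  proof (rule integral_cond_inner[where L="relay_obs_terms i" and L'="relay_obs_terms j"])
    show "(\<lambda>x. relay_obs i (fst x) (snd x)) \<in> borel_measurable (est_space \<Otimes>\<^sub>M rest_space)"
      "(\<lambda>x. relay_obs j (fst x) (snd x)) \<in> borel_measurable (est_space \<Otimes>\<^sub>M rest_space)"
      using ij by measurable
    show "?k \<in> borel_measurable est_space" "?V \<in> borel_measurable est_space" by measurable
    have "integrable \<Omega> (\<lambda>\<omega>. indicator B (mmse_est p SR \<omega>) * (x_r p gain i \<omega> * cnj (x_r p gain j \<omega>)))"
      by (rule Bochner_Integration.integrable_bound[OF integrable_relay_products[OF ij]])
         (use measurable_x_r[OF ij(1)] measurable_x_r[OF ij(2)] in \<open>auto simp: norm_mult split: split_indicator\<close>)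
    then show "integrable \<Omega> (\<lambda>\<omega>. ?k (mmse_ests p \<omega>) * (relay_obs i (mmse_ests p \<omega>) (rest \<omega>) * cnj (relay_obs j (mmse_ests p \<omega>) (rest \<omega>))))"
      by (simp only: eq)
    show "(\<Sum>(S, c)\<leftarrow>relay_obs_terms i z. \<Sum>(T, d)\<leftarrow>relay_obs_terms j z.
       if S = T then c * cnj d * complex_of_real (prod (coord_var p) S) else 0) = ?V z" for z
    proof (cases "i = j")
      case True
      then show ?thesis
        by (auto simp: relay_obs_terms_def doubleton_eq_iff complex_norm_square[symmetric] algebra_simps simp del: of_real_power)
    next
      case False
      then show ?thesis by (auto simp: relay_obs_terms_def doubleton_eq_iff)
    qed
  qed (erule relay_obs_eq relay_obs_terms_coords[OF ij(1)] relay_obs_terms_coords[OF ij(2)] | rule relay_obs_eq)+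
  also have "\<dots> = (\<integral>\<omega>. indicator B (mmse_est p SR \<omega>) * (if i = j then complex_of_real Er else 0) \<partial>\<Omega>)"
  proof (rule Bochner_Integration.integral_cong[OF refl])
    fix \<omega>
    have "(complex_of_real (gain z))\<^sup>2 * complex_of_real (((cmod z)\<^sup>2 + err_var p SR) * Es + N0) = complex_of_real Er" for z
      unfolding gain_square[of z, symmetric] by simp
    then show "?k (mmse_ests p \<omega>) * ?V (mmse_ests p \<omega>) = indicator B (mmse_est p SR \<omega>) * (if i = j then complex_of_real Er else 0)"
      by (simp add: mmse_ests_def mult.assoc)
  qed
  finally show ?thesis .
qed

lemma admissible_gain: "admissible_gain p (gauss_input p) gain"
proof -
  define F where "F = vimage_algebra (space \<Omega>) (mmse_est p SR) borel"
  have setsF: "sets F = {mmse_est p SR -` A \<inter> space \<Omega> | A. A \<in> sets borel}"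
    unfolding F_def by (rule sets_vimage_algebra2) auto
  have sub: "subalgebra \<Omega> F"
    unfolding subalgebra_def setsF using measurable_sets[OF measurable_mmse_est] by (auto simp: F_def)
  interpret finite_measure_subalgebra \<Omega> F by unfold_locales (rule sub)
  \<comment> \<open>A bounded linear \<open>T\<close> treats real and imaginary part at once. Events
    of \<open>F\<close> are preimages of Borel sets under the estimate, so
    \<open>integral_relay_products\<close> is exactly the defining property of the conditional
    expectation.\<close>
  have cond: "AE \<omega> in \<Omega>. real_cond_exp \<Omega> F (\<lambda>\<omega>. T (x_r p gain i \<omega> * cnj (x_r p gain j \<omega>))) \<omega> =
      T (if i = j then complex_of_real Er else 0)"
    if ij: "i < dim2 p" "j < dim2 p" and T: "bounded_linear T" for i j and T :: "complex \<Rightarrow> real"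
  proof (rule real_cond_exp_charact)
    interpret T: bounded_linear T by fact
    show "integrable \<Omega> (\<lambda>\<omega>. T (x_r p gain i \<omega> * cnj (x_r p gain j \<omega>)))"
      by (rule integrable_bounded_linear[OF T integrable_relay_products[OF ij]])
    fix A assume "A \<in> sets F"
    then obtain B where B[measurable]: "B \<in> sets borel" and A: "A = mmse_est p SR -` B \<inter> space \<Omega>"
      by (auto simp: setsF)
    have eq: "(\<integral>\<omega>\<in>A. T (f \<omega>) \<partial>\<Omega>) = T (\<integral>\<omega>. indicator B (mmse_est p SR \<omega>) * f \<omega> \<partial>\<Omega>)"
      if f: "integrable \<Omega> f" for f
    proof -
      have "integrable \<Omega> (\<lambda>\<omega>. indicator B (mmse_est p SR \<omega>) * f \<omega>)"
        by (rule Bochner_Integration.integrable_bound[OF f])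
           (use f in \<open>auto simp: norm_mult split: split_indicator\<close>)
      from integral_bounded_linear[OF T this]
      have "T (\<integral>\<omega>. indicator B (mmse_est p SR \<omega>) * f \<omega> \<partial>\<Omega>) = (\<integral>\<omega>. T (indicator B (mmse_est p SR \<omega>) * f \<omega>) \<partial>\<Omega>)"
        by simp
      also have "\<dots> = (\<integral>\<omega>\<in>A. T (f \<omega>) \<partial>\<Omega>)"
        unfolding set_lebesgue_integral_def
        by (rule Bochner_Integration.integral_cong) (auto simp: A T.zero split: split_indicator)
      finally show ?thesis ..
    qed
    show "(\<integral>\<omega>\<in>A. T (x_r p gain i \<omega> * cnj (x_r p gain j \<omega>)) \<partial>\<Omega>) = (\<integral>\<omega>\<in>A. T (if i = j then complex_of_real Er else 0) \<partial>\<Omega>)"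
      using eq[OF integrable_relay_products[OF ij]] eq[of "\<lambda>_. if i = j then complex_of_real Er else 0"]
        integral_relay_products[OF ij B] by simp
  qed auto
  \<comment> \<open>The denominator of \<open>Er\<close> is the length of the relay's transmission,
    so the relay's budget is met with equality too.\<close>
  have "(\<integral>\<omega>. (\<Sum>i<dim2 p. (cmod (x_r p gain i \<omega>))\<^sup>2) \<partial>\<Omega>) = (\<Sum>i<dim2 p. Er)"
    by (intro has_bochner_integral_integral_eq has_bochner_integral_sum) (simp add: has_bochner_integral_relay_signal)
  also have "\<dots> = (1 - rel_train_frac p) * real (block_len p) * rel_power p"
    using block_len overlap dims(2) by (simp add: rel_symbol_energy_def)
  finally have "pilot_energy p RD + (\<integral>\<omega>. (\<Sum>i<dim2 p. (cmod (x_r p gain i \<omega>))\<^sup>2) \<partial>\<Omega>) \<le> real (block_len p) * rel_power p"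
    by (simp add: algebra_simps)
  moreover have "AE \<omega> in \<Omega>. real_cond_exp \<Omega> F (\<lambda>\<omega>. Re (x_r p gain i \<omega> * cnj (x_r p gain j \<omega>))) \<omega> = (if i = j then Er else 0)"
    "AE \<omega> in \<Omega>. real_cond_exp \<Omega> F (\<lambda>\<omega>. Im (x_r p gain i \<omega> * cnj (x_r p gain j \<omega>))) \<omega> = 0"
    if "i < dim2 p" "j < dim2 p" for i j
    using cond[OF that bounded_linear_Re] cond[OF that bounded_linear_Im] by (simp_all split: if_splits)
  ultimately show ?thesis
    unfolding admissible_gain_def Let_def F_def[symmetric]
    using integrable_relay_products gain_nonneg by simp
qed

end

section \<open>Scalar linear MMSE identities\<close>

text \<open>\<open>C\<close> is the inverse of the total precision \<open>D\<close>: prior precision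
  plus one term per observation with uncorrelated noise. The weights leave the coefficient
  \<open>1 - u * h - v * g = C / E\<close> on the data, so the error energy is
  \<open>C * (C * D)\<close>, and \<open>C * D = 1\<close>.\<close>

lemma mmse_two_observations:
  fixes h g :: complex and E K K' :: real
  assumes "0 < E" "0 < K" "0 < K'"
  defines "C \<equiv> 1 / (1 / E + (cmod h)\<^sup>2 / K + (cmod g)\<^sup>2 / K')"
  defines "u \<equiv> complex_of_real (C / K) * cnj h" and "v \<equiv> complex_of_real (C / K') * cnj g"
  shows "(cmod (1 - u * h - v * g))\<^sup>2 * E + (cmod u)\<^sup>2 * K + (cmod v)\<^sup>2 * K' = C"
proof -
  define D where "D = 1 / E + (cmod h)\<^sup>2 / K + (cmod g)\<^sup>2 / K'"
  have D: "0 < D" unfolding D_def using assms by (intro add_pos_nonneg) auto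
  have CD: "C * D = 1" using D by (simp add: C_def D_def)
  have "u * h = complex_of_real (C * ((cmod h)\<^sup>2 / K))"
    using complex_norm_square[of h] by (simp add: u_def mult.commute)
  moreover have "v * g = complex_of_real (C * ((cmod g)\<^sup>2 / K'))"
    using complex_norm_square[of g] by (simp add: v_def mult.commute)
  ultimately have "1 - u * h - v * g = complex_of_real (1 - C * ((cmod h)\<^sup>2 / K) - C * ((cmod g)\<^sup>2 / K'))"
    by simp
  also have "1 - C * ((cmod h)\<^sup>2 / K) - C * ((cmod g)\<^sup>2 / K') = C / E"
    using CD by (simp add: D_def distrib_left)
  finally have 1: "(cmod (1 - u * h - v * g))\<^sup>2 = (C / E)\<^sup>2"
    by (simp only: norm_of_real power2_abs)
  have 2: "(cmod u)\<^sup>2 = (C / K)\<^sup>2 * (cmod h)\<^sup>2" "(cmod v)\<^sup>2 = (C / K')\<^sup>2 * (cmod g)\<^sup>2"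
    unfolding u_def v_def norm_mult power_mult_distrib by (simp_all only: norm_of_real power2_abs complex_mod_cnj)
  have "(C / E)\<^sup>2 * E + (C / K)\<^sup>2 * (cmod h)\<^sup>2 * K + (C / K')\<^sup>2 * (cmod g)\<^sup>2 * K' = C * (C * D)"
    using assms(1-3) by (simp add: D_def power2_eq_square distrib_left)
  then show ?thesis unfolding 1 2 using CD by simp
qed

lemma mmse_one_observation:
  fixes h :: complex and E K :: real
  assumes "0 < E" "0 < K"
  defines "C \<equiv> 1 / (1 / E + (cmod h)\<^sup>2 / K)"
  defines "u \<equiv> complex_of_real (C / K) * cnj h"
  shows "(cmod (1 - u * h))\<^sup>2 * E + (cmod u)\<^sup>2 * K = C"
  using mmse_two_observations[of E K 1 h 0] assms by simp

context af_network begin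

subsection \<open>Linear MMSE estimates of the data\<close>

definition direct_obs :: "nat \<Rightarrow> (link \<Rightarrow> complex) \<Rightarrow> (coord \<Rightarrow> complex) \<Rightarrow> complex" where
  "direct_obs i z r = (z SD + r (Rh SD)) * r (Rx i) + r (Rd (2 + i))"

definition relayed_obs :: "nat \<Rightarrow> (link \<Rightarrow> complex) \<Rightarrow> (coord \<Rightarrow> complex) \<Rightarrow> complex" where
  "relayed_obs k z r = direct_obs (dim1 p + dim2 p + k) z r + (z RD + r (Rh RD)) * (gain (z SR) * relay_obs k z r)"

definition relay_path :: "(link \<Rightarrow> complex) \<Rightarrow> complex" where
  "relay_path z = z RD * gain (z SR) * z SR"

text \<open>Conditionally on the estimates, the received symbols are the estimated channels applied to the
  data plus uncorrelated noise, of variance \<open>noise_direct\<close> or \<open>noise_relayed\<close>.\<close>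

definition noise_direct :: real where
  "noise_direct = err_var p SD * Es + N0"

definition noise_relayed :: "(link \<Rightarrow> complex) \<Rightarrow> real" where
  "noise_relayed z = err_var p SD * Es + N0 + err_var p RD * Er +
     (gain (z SR))\<^sup>2 * (cmod (z RD))\<^sup>2 * (err_var p SR * Es + N0)"

definition mmse_direct :: "(link \<Rightarrow> complex) \<Rightarrow> real" where
  "mmse_direct z = 1 / (1 / Es + (cmod (z SD))\<^sup>2 / noise_direct)"

text \<open>The error for a symbol heard directly and again through the relay. The overlapping
  symbol is still unknown at this stage, so its energy \<open>(cmod (z SD))\<^sup>2 * Es\<close>
  counts as noise in the second observation.\<close>

definition mmse_relayed :: "(link \<Rightarrow> complex) \<Rightarrow> real" where
  "mmse_relayed z = 1 / (1 / Es + (cmod (z SD))\<^sup>2 / noise_direct +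
     (cmod (relay_path z))\<^sup>2 / ((cmod (z SD))\<^sup>2 * Es + noise_relayed z))"

text \<open>The error for the symbol sent while the relay transmits, after the relayed symbol has
  been subtracted; only \<open>noise_relayed\<close> remains.\<close>

definition mmse_overlapped :: "(link \<Rightarrow> complex) \<Rightarrow> real" where
  "mmse_overlapped z = 1 / (1 / Es + (cmod (z SD))\<^sup>2 / noise_relayed z)"

definition w_direct :: "(link \<Rightarrow> complex) \<Rightarrow> complex" where
  "w_direct z = complex_of_real (mmse_direct z / noise_direct) * cnj (z SD)"

definition w_relayed1 :: "(link \<Rightarrow> complex) \<Rightarrow> complex" where
  "w_relayed1 z = complex_of_real (mmse_relayed z / noise_direct) * cnj (z SD)"

definition w_relayed2 :: "(link \<Rightarrow> complex) \<Rightarrow> complex" where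
  "w_relayed2 z = complex_of_real (mmse_relayed z / ((cmod (z SD))\<^sup>2 * Es + noise_relayed z)) * cnj (relay_path z)"

definition w_overlapped :: "(link \<Rightarrow> complex) \<Rightarrow> complex" where
  "w_overlapped z = complex_of_real (mmse_overlapped z / noise_relayed z) * cnj (z SD)"

lemma noise_direct_pos: "0 < noise_direct"
  unfolding noise_direct_def using err_var_pos[of SD] Es_pos noise_var by (intro add_pos_pos mult_pos_pos)

lemma noise_relayed_ge: "err_var p SD * Es + N0 + err_var p RD * Er \<le> noise_relayed z"
  unfolding noise_relayed_def using err_var_pos[of SR] Es_pos noise_var by simp

lemma noise_relayed_pos: "0 < noise_relayed z"
  using noise_relayed_ge[of z] err_var_pos[of SD] err_var_pos[of RD] Es_pos Er_pos noise_var
  by (smt (verit) mult_pos_pos)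

lemma mmse_pos: "0 < mmse_direct z" "0 < mmse_relayed z" "0 < mmse_overlapped z"
  unfolding mmse_direct_def mmse_relayed_def mmse_overlapped_def
  using noise_direct_pos noise_relayed_pos[of z] Es_pos
  by (auto intro!: divide_pos_pos add_pos_nonneg)

text \<open>Writing \<open>Er\<close> back as squared gain times received energy separates the
  powers of the individual monomials, which is the form in which \<open>power_sum\<close> delivers
  them.\<close>

lemma noise_relayed_expand:
  "noise_relayed z = err_var p SD * Es + N0 + (gain (z SR))\<^sup>2 *
     ((cmod (z RD))\<^sup>2 * (err_var p SR * Es + N0) + err_var p RD * ((cmod (z SR))\<^sup>2 * Es + err_var p SR * Es + N0))"
  unfolding noise_relayed_def gain_square[of "z SR", symmetric] by (simp add: algebra_simps)

definition direct_obs_terms :: "nat \<Rightarrow> (link \<Rightarrow> complex) \<Rightarrow> (coord set \<times> complex) list" where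
  "direct_obs_terms i z = [({Rx i}, z SD), ({Rh SD, Rx i}, 1), ({Rd (2 + i)}, 1)]"

definition residual_direct_terms :: "nat \<Rightarrow> (link \<Rightarrow> complex) \<Rightarrow> (coord set \<times> complex) list" where
  "residual_direct_terms i z = (let u = w_direct z in
    [({Rx i}, 1 - u * z SD), ({Rh SD, Rx i}, - u), ({Rd (2 + i)}, - u)])"

definition relayed_obs_terms :: "nat \<Rightarrow> (link \<Rightarrow> complex) \<Rightarrow> (coord set \<times> complex) list" where
  "relayed_obs_terms k z = (let i = dim1 p + k; j = dim1 p + dim2 p + k; g = complex_of_real (gain (z SR)) in
    [({Rx j}, z SD), ({Rh SD, Rx j}, 1), ({Rx i}, z RD * g * z SR), ({Rh SR, Rx i}, g * z RD), ({Rh RD, Rx i}, g * z SR),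
     ({Rh RD, Rh SR, Rx i}, g), ({Rr (2 + i)}, g * z RD), ({Rh RD, Rr (2 + i)}, g), ({Rd (2 + j)}, 1)])"

text \<open>There is no monomial \<open>{Rx i}\<close> alone: the subtraction of
  \<open>relay_path z\<close> times the relayed symbol has cancelled it, and what is left of that
  symbol comes with an estimation error.\<close>

definition residual_overlapped_terms :: "nat \<Rightarrow> (link \<Rightarrow> complex) \<Rightarrow> (coord set \<times> complex) list" where
  "residual_overlapped_terms k z = (let i = dim1 p + k; j = dim1 p + dim2 p + k; g = complex_of_real (gain (z SR)); u = w_overlapped z in
    [({Rx j}, 1 - u * z SD), ({Rh SD, Rx j}, - u), ({Rh SR, Rx i}, - u * g * z RD), ({Rh RD, Rx i}, - u * g * z SR),
     ({Rh RD, Rh SR, Rx i}, - u * g), ({Rr (2 + i)}, - u * g * z RD), ({Rh RD, Rr (2 + i)}, - u * g), ({Rd (2 + j)}, - u)])"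

definition residual_relayed_terms :: "nat \<Rightarrow> (link \<Rightarrow> complex) \<Rightarrow> (coord set \<times> complex) list" where
  "residual_relayed_terms k z = (let i = dim1 p + k; j = dim1 p + dim2 p + k; g = complex_of_real (gain (z SR));
      u = w_relayed1 z; v = w_relayed2 z in
    [({Rx i}, 1 - u * z SD - v * relay_path z), ({Rh SD, Rx i}, - u), ({Rd (2 + i)}, - u),
     ({Rx j}, - v * z SD), ({Rh SD, Rx j}, - v), ({Rh SR, Rx i}, - v * g * z RD), ({Rh RD, Rx i}, - v * g * z SR),
     ({Rh RD, Rh SR, Rx i}, - v * g), ({Rr (2 + i)}, - v * g * z RD), ({Rh RD, Rr (2 + i)}, - v * g), ({Rd (2 + j)}, - v)])"

lemma direct_obs_eq: "direct_obs i z r = multi_affine (direct_obs_terms i z) r"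
  by (simp add: direct_obs_def direct_obs_terms_def algebra_simps)

lemma residual_direct_eq: "r (Rx i) - w_direct z * direct_obs i z r = multi_affine (residual_direct_terms i z) r"
  by (simp add: direct_obs_def residual_direct_terms_def Let_def algebra_simps)

lemma relayed_obs_eq: "relayed_obs k z r = multi_affine (relayed_obs_terms k z) r"
  by (simp add: relayed_obs_def relay_obs_def direct_obs_def relayed_obs_terms_def Let_def algebra_simps)

lemma residual_overlapped_eq:
  "r (Rx (dim1 p + dim2 p + k)) - w_overlapped z * (relayed_obs k z r - relay_path z * r (Rx (dim1 p + k))) =
     multi_affine (residual_overlapped_terms k z) r"
  by (simp add: relayed_obs_def relay_path_def relay_obs_def direct_obs_def residual_overlapped_terms_def Let_def algebra_simps)

lemma residual_relayed_eq:
  "r (Rx (dim1 p + k)) - (w_relayed1 z * direct_obs (dim1 p + k) z r + w_relayed2 z * relayed_obs k z r) =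
     multi_affine (residual_relayed_terms k z) r"
  by (simp add: relayed_obs_def relay_path_def relay_obs_def direct_obs_def residual_relayed_terms_def Let_def algebra_simps)

text \<open>For distinct index sets within \<open>rest_coords\<close> this is the second moment
  given the estimates, by \<open>nn_integral_multi_affine_square\<close>.\<close>

abbreviation power_sum :: "(coord set \<times> complex) list \<Rightarrow> real" where
  "power_sum L \<equiv> (\<Sum>(S, c)\<leftarrow>L. (cmod c)\<^sup>2 * (\<Prod>j\<in>S. coord_var p j))"

lemma power_sum_direct_obs: "power_sum (direct_obs_terms i z) = (cmod (z SD))\<^sup>2 * Es + noise_direct"
  by (simp add: direct_obs_terms_def noise_direct_def)

lemma power_sum_residual_direct: "power_sum (residual_direct_terms i z) = mmse_direct z"
proof -
  have "power_sum (residual_direct_terms i z) = (cmod (1 - w_direct z * z SD))\<^sup>2 * Es + (cmod (w_direct z))\<^sup>2 * noise_direct"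
    by (simp add: residual_direct_terms_def noise_direct_def Let_def algebra_simps)
  also have "\<dots> = mmse_direct z"
    unfolding w_direct_def mmse_direct_def by (rule mmse_one_observation[OF Es_pos noise_direct_pos])
  finally show ?thesis .
qed

lemma power_sum_relayed_obs:
  "power_sum (relayed_obs_terms k z) = (cmod (z SD))\<^sup>2 * Es + (cmod (relay_path z))\<^sup>2 * Es + noise_relayed z"
  unfolding noise_relayed_expand
  by (simp add: relayed_obs_terms_def relay_path_def Let_def norm_mult power_mult_distrib algebra_simps)

lemma power_sum_residual_overlapped: "power_sum (residual_overlapped_terms k z) = mmse_overlapped z"
proof -
  have "power_sum (residual_overlapped_terms k z) =
      (cmod (1 - w_overlapped z * z SD))\<^sup>2 * Es + (cmod (w_overlapped z))\<^sup>2 * noise_relayed z"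
    unfolding noise_relayed_expand
    by (simp add: residual_overlapped_terms_def Let_def norm_mult power_mult_distrib algebra_simps)
  also have "\<dots> = mmse_overlapped z"
    unfolding w_overlapped_def mmse_overlapped_def by (rule mmse_one_observation[OF Es_pos noise_relayed_pos])
  finally show ?thesis .
qed

lemma power_sum_residual_relayed: "power_sum (residual_relayed_terms k z) = mmse_relayed z"
proof -
  have pos: "0 < (cmod (z SD))\<^sup>2 * Es + noise_relayed z"
    using Es_pos noise_relayed_pos[of z] by (intro add_nonneg_pos) auto
  have "power_sum (residual_relayed_terms k z) =
      (cmod (1 - w_relayed1 z * z SD - w_relayed2 z * relay_path z))\<^sup>2 * Es + (cmod (w_relayed1 z))\<^sup>2 * noise_direct
       + (cmod (w_relayed2 z))\<^sup>2 * ((cmod (z SD))\<^sup>2 * Es + noise_relayed z)"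
    unfolding noise_relayed_expand noise_direct_def
    by (simp add: residual_relayed_terms_def Let_def norm_mult power_mult_distrib algebra_simps)
  also have "\<dots> = mmse_relayed z"
    unfolding w_relayed1_def w_relayed2_def mmse_relayed_def
    by (rule mmse_two_observations[OF Es_pos noise_direct_pos pos])
  finally show ?thesis .
qed

text \<open>\<open>dim2_pos\<close> keeps the relayed symbol and the one overlapping it, as well as
  their noise times, apart.\<close>

lemma terms_distinct:
  "distinct (map fst (direct_obs_terms i z))" "distinct (map fst (residual_direct_terms i z))"
  "distinct (map fst (relayed_obs_terms k z))" "distinct (map fst (residual_overlapped_terms k z))"
  "distinct (map fst (residual_relayed_terms k z))"
  using dim2_pos
  by (simp_all add: direct_obs_terms_def residual_direct_terms_def relayed_obs_terms_def
      residual_overlapped_terms_def residual_relayed_terms_def Let_def set_eq_subset)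

lemma direct_terms_coords:
  assumes "i < data_len p"
  shows "(S, c) \<in> set (direct_obs_terms i z) \<Longrightarrow> S \<subseteq> rest_coords"
    "(S, c) \<in> set (residual_direct_terms i z) \<Longrightarrow> S \<subseteq> rest_coords"
  using assms add_two_less_block_len[of i] by (auto simp: direct_obs_terms_def residual_direct_terms_def Let_def)

lemma relayed_terms_coords:
  assumes "k < dim2 p"
  shows "(S, c) \<in> set (relayed_obs_terms k z) \<Longrightarrow> S \<subseteq> rest_coords"
    "(S, c) \<in> set (residual_overlapped_terms k z) \<Longrightarrow> S \<subseteq> rest_coords"
    "(S, c) \<in> set (residual_relayed_terms k z) \<Longrightarrow> S \<subseteq> rest_coords"
proof -
  have "dim1 p + k < data_len p" "dim1 p + dim2 p + k < data_len p" using assms data_len_eq by auto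
  then show "(S, c) \<in> set (relayed_obs_terms k z) \<Longrightarrow> S \<subseteq> rest_coords"
    "(S, c) \<in> set (residual_overlapped_terms k z) \<Longrightarrow> S \<subseteq> rest_coords"
    "(S, c) \<in> set (residual_relayed_terms k z) \<Longrightarrow> S \<subseteq> rest_coords"
    using add_two_less_block_len[of "dim1 p + k"] add_two_less_block_len[of "dim1 p + dim2 p + k"]
    by (auto simp: relayed_obs_terms_def residual_overlapped_terms_def residual_relayed_terms_def Let_def)
qed

lemma measurable_weights[measurable]:
  "relay_path \<in> borel_measurable est_space"
  "noise_relayed \<in> borel_measurable est_space"
  "mmse_direct \<in> borel_measurable est_space" "mmse_relayed \<in> borel_measurable est_space"
  "mmse_overlapped \<in> borel_measurable est_space" "w_direct \<in> borel_measurable est_space"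
  "w_relayed1 \<in> borel_measurable est_space" "w_relayed2 \<in> borel_measurable est_space"
  "w_overlapped \<in> borel_measurable est_space"
  unfolding relay_path_def[abs_def] noise_relayed_def[abs_def] mmse_direct_def[abs_def] mmse_relayed_def[abs_def]
    mmse_overlapped_def[abs_def] w_direct_def[abs_def] w_relayed1_def[abs_def] w_relayed2_def[abs_def]
    w_overlapped_def[abs_def]
  by measurable

lemma measurable_direct_obs[measurable (raw)]:
  assumes "i < data_len p" and [measurable]: "f \<in> M \<rightarrow>\<^sub>M est_space" "g \<in> M \<rightarrow>\<^sub>M rest_space"
  shows "(\<lambda>x. direct_obs i (f x) (g x)) \<in> borel_measurable M"
proof -
  have [measurable]: "(\<lambda>x. g x (Rx i)) \<in> borel_measurable M"
    "(\<lambda>x. g x (Rd (2 + i))) \<in> borel_measurable M" "(\<lambda>x. g x (Rh SD)) \<in> borel_measurable M"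
    using assms(1) add_two_less_block_len[of i]
    by (auto intro!: measurable_rest_space_component[OF _ assms(3)])
  note [measurable] = measurable_est_space_component[OF assms(2), of SD]
  show ?thesis unfolding direct_obs_def by measurable
qed

lemma measurable_relayed_obs[measurable (raw)]:
  assumes k: "k < dim2 p" and [measurable]: "f \<in> M \<rightarrow>\<^sub>M est_space" "g \<in> M \<rightarrow>\<^sub>M rest_space"
  shows "(\<lambda>x. relayed_obs k (f x) (g x)) \<in> borel_measurable M"
proof -
  have [measurable]: "(\<lambda>x. g x (Rh RD)) \<in> borel_measurable M"
    by (auto intro!: measurable_rest_space_component[OF _ assms(3)])
  have j: "dim1 p + dim2 p + k < data_len p" using k data_len_eq by simp
  note [measurable] = measurable_est_space_component[OF assms(2)] measurable_relay_obs[OF k assms(2,3)]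
    measurable_direct_obs[OF j assms(2,3)]
  show ?thesis unfolding relayed_obs_def by measurable
qed

end

lemma nn_integral_pair4:
  fixes f :: "'a \<times> 'b \<times> 'c \<times> 'd \<Rightarrow> ennreal"
  assumes "sigma_finite_measure B" "sigma_finite_measure C" "sigma_finite_measure D"
    and f: "f \<in> borel_measurable (A \<Otimes>\<^sub>M B \<Otimes>\<^sub>M C \<Otimes>\<^sub>M D)"
  shows "(\<integral>\<^sup>+x. f x \<partial>(A \<Otimes>\<^sub>M B \<Otimes>\<^sub>M C \<Otimes>\<^sub>M D)) = (\<integral>\<^sup>+a. \<integral>\<^sup>+b. \<integral>\<^sup>+c. \<integral>\<^sup>+d. f (a, b, c, d) \<partial>D \<partial>C \<partial>B \<partial>A)"
proof -
  interpret B: sigma_finite_measure B by fact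
  interpret C: sigma_finite_measure C by fact
  interpret D: sigma_finite_measure D by fact
  interpret CD: pair_sigma_finite C D ..
  interpret BCD: pair_sigma_finite B "C \<Otimes>\<^sub>M D" ..
  have "(\<integral>\<^sup>+x. f x \<partial>(A \<Otimes>\<^sub>M B \<Otimes>\<^sub>M C \<Otimes>\<^sub>M D)) = (\<integral>\<^sup>+a. \<integral>\<^sup>+y. f (a, y) \<partial>(B \<Otimes>\<^sub>M C \<Otimes>\<^sub>M D) \<partial>A)"
    by (rule BCD.P.nn_integral_fst[symmetric]) fact
  also have "\<dots> = (\<integral>\<^sup>+a. \<integral>\<^sup>+b. \<integral>\<^sup>+y. f (a, b, y) \<partial>(C \<Otimes>\<^sub>M D) \<partial>B \<partial>A)"
    by (intro nn_integral_cong CD.P.nn_integral_fst[symmetric] measurable_compose_Pair1[OF _ f])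
  also have "\<dots> = (\<integral>\<^sup>+a. \<integral>\<^sup>+b. \<integral>\<^sup>+c. \<integral>\<^sup>+d. f (a, b, c, d) \<partial>D \<partial>C \<partial>B \<partial>A)"
    by (intro nn_integral_cong D.nn_integral_fst[symmetric]
      measurable_compose_Pair1[OF _ measurable_compose_Pair1[OF _ f]])
  finally show ?thesis .
qed

context af_network begin

subsection \<open>Second moments\<close>

text \<open>Each part of the relay's received energy, once amplified, stays below the prescribed
  \<open>Er\<close>. These bounds are uniform in the source-relay estimate, so all later dominating
  functions are quadratic in the estimates of the other two links.\<close>

lemma gain_bounds:
  "(gain (z SR))\<^sup>2 * ((cmod (z SR))\<^sup>2 * Es) \<le> Er" "(gain (z SR))\<^sup>2 * (err_var p SR * Es + N0) \<le> Er"
proof -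
  have "(gain (z SR))\<^sup>2 * ((cmod (z SR))\<^sup>2 * Es) + (gain (z SR))\<^sup>2 * (err_var p SR * Es + N0) = Er"
    using gain_square[of "z SR"] by (simp add: algebra_simps)
  moreover have "0 \<le> (gain (z SR))\<^sup>2 * ((cmod (z SR))\<^sup>2 * Es)" "0 \<le> (gain (z SR))\<^sup>2 * (err_var p SR * Es + N0)"
    using Es_pos noise_var err_var_pos[of SR] by auto
  ultimately show "(gain (z SR))\<^sup>2 * ((cmod (z SR))\<^sup>2 * Es) \<le> Er" "(gain (z SR))\<^sup>2 * (err_var p SR * Es + N0) \<le> Er"
    by linarith+
qed

lemma relay_path_bound: "(cmod (relay_path z))\<^sup>2 * Es \<le> Er * (cmod (z RD))\<^sup>2"
proof -
  have "(cmod (relay_path z))\<^sup>2 * Es = (gain (z SR))\<^sup>2 * ((cmod (z SR))\<^sup>2 * Es) * (cmod (z RD))\<^sup>2"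
    by (simp add: relay_path_def norm_mult power_mult_distrib)
  also have "\<dots> \<le> Er * (cmod (z RD))\<^sup>2"
    by (intro mult_right_mono gain_bounds) auto
  finally show ?thesis .
qed

lemma noise_relayed_le:
  "noise_relayed z \<le> err_var p SD * Es + N0 + err_var p RD * Er + Er * (cmod (z RD))\<^sup>2"
proof -
  have "(gain (z SR))\<^sup>2 * (cmod (z RD))\<^sup>2 * (err_var p SR * Es + N0) =
      (gain (z SR))\<^sup>2 * (err_var p SR * Es + N0) * (cmod (z RD))\<^sup>2" by simp
  also have "\<dots> \<le> Er * (cmod (z RD))\<^sup>2"
    by (intro mult_right_mono gain_bounds) auto
  finally show ?thesis by (simp add: noise_relayed_def)
qed

lemma nn_integral_quadratic_est:
  assumes "0 \<le> s" "0 \<le> t" "0 \<le> u"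
  shows "(\<integral>\<^sup>+z. ennreal (s + t * (cmod (z SD))\<^sup>2 + u * (cmod (z RD))\<^sup>2) \<partial>est_law) < \<infinity>"
proof -
  have "(\<integral>\<^sup>+z. ennreal (s + t * (cmod (z SD))\<^sup>2 + u * (cmod (z RD))\<^sup>2) \<partial>est_law) =
      (\<integral>\<^sup>+z. ennreal s + ennreal t * ennreal ((cmod (z SD))\<^sup>2) + ennreal u * ennreal ((cmod (z RD))\<^sup>2) \<partial>est_law)"
    using assms by (intro nn_integral_cong) (simp add: ennreal_mult)
  also have "\<dots> = ennreal s + ennreal t * ennreal (est_var p SD) + ennreal u * ennreal (est_var p RD)"
    by (simp add: nn_integral_add nn_integral_cmult nn_integral_est_square est.emeasure_space_1)
  also have "\<dots> < \<infinity>" by (simp add: ennreal_mult_less_top)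
  finally show ?thesis .
qed

lemma integrable_of_quadratic_est:
  assumes [measurable]: "f \<in> borel_measurable est_space"
    and "\<And>z. 0 \<le> f z" "\<And>z. f z \<le> s + t * (cmod (z SD))\<^sup>2 + u * (cmod (z RD))\<^sup>2" "0 \<le> s" "0 \<le> t" "0 \<le> u"
  shows "integrable \<Omega> (\<lambda>\<omega>. f (mmse_ests p \<omega>))"
proof (rule integrableI_bounded)
  show "(\<lambda>\<omega>. f (mmse_ests p \<omega>)) \<in> borel_measurable \<Omega>"
    by (rule measurable_compose[OF measurable_mmse_ests]) measurable
  have "(\<integral>\<^sup>+\<omega>. ennreal (norm (f (mmse_ests p \<omega>))) \<partial>\<Omega>) = (\<integral>\<^sup>+z. ennreal (f z) \<partial>est_law)"
    using nn_integral_est[of "\<lambda>z. ennreal (f z)"] assms(2) by simp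
  also have "\<dots> \<le> (\<integral>\<^sup>+z. ennreal (s + t * (cmod (z SD))\<^sup>2 + u * (cmod (z RD))\<^sup>2) \<partial>est_law)"
    using assms(3) by (intro nn_integral_mono ennreal_leI)
  also have "\<dots> < \<infinity>" using assms by (intro nn_integral_quadratic_est)
  finally show "(\<integral>\<^sup>+\<omega>. ennreal (norm (f (mmse_ests p \<omega>))) \<partial>\<Omega>) < \<infinity>" .
qed

lemma measurable_est_rest_compose:
  "(\<lambda>x. F (fst x) (snd x)) \<in> borel_measurable (est_space \<Otimes>\<^sub>M rest_space) \<Longrightarrow>
    (\<lambda>\<omega>. F (mmse_ests p \<omega>) (rest \<omega>)) \<in> borel_measurable \<Omega>"
  using measurable_compose[OF measurable_est_rest, of "\<lambda>x. F (fst x) (snd x)" borel] by simp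

lemma integrable_direct_obs:
  assumes "i < data_len p"
  shows "integrable \<Omega> (\<lambda>\<omega>. (cmod (direct_obs i (mmse_ests p \<omega>) (rest \<omega>)))\<^sup>2)"
proof (rule integrableI_bounded)
  have m: "(\<lambda>x. direct_obs i (fst x) (snd x)) \<in> borel_measurable (est_space \<Otimes>\<^sub>M rest_space)"
    using assms by measurable
  show "(\<lambda>\<omega>. (cmod (direct_obs i (mmse_ests p \<omega>) (rest \<omega>)))\<^sup>2) \<in> borel_measurable \<Omega>"
    using measurable_est_rest_compose[OF m] by measurable
  have "(\<integral>\<^sup>+\<omega>. ennreal (1 * (cmod (direct_obs i (mmse_ests p \<omega>) (rest \<omega>)))\<^sup>2) \<partial>\<Omega>) =
      (\<integral>\<^sup>+z. ennreal (1 * ((cmod (z SD))\<^sup>2 * Es + noise_direct)) \<partial>est_law)"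
    by (rule nn_integral_cond_square[where L="direct_obs_terms i"])
      (fact m direct_obs_eq power_sum_direct_obs terms_distinct | simp | erule direct_terms_coords[OF assms])+
  also have "\<dots> = (\<integral>\<^sup>+z. ennreal (noise_direct + Es * (cmod (z SD))\<^sup>2 + 0 * (cmod (z RD))\<^sup>2) \<partial>est_law)"
    by (simp add: algebra_simps)
  also have "\<dots> < \<infinity>"
    using noise_direct_pos Es_pos by (intro nn_integral_quadratic_est) auto
  finally show "(\<integral>\<^sup>+\<omega>. ennreal (norm ((cmod (direct_obs i (mmse_ests p \<omega>) (rest \<omega>)))\<^sup>2)) \<partial>\<Omega>) < \<infinity>"
    by simp
qed

lemma integrable_relayed_obs:
  assumes "k < dim2 p"
  shows "integrable \<Omega> (\<lambda>\<omega>. (cmod (relayed_obs k (mmse_ests p \<omega>) (rest \<omega>)))\<^sup>2)"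
proof (rule integrableI_bounded)
  have m: "(\<lambda>x. relayed_obs k (fst x) (snd x)) \<in> borel_measurable (est_space \<Otimes>\<^sub>M rest_space)"
    using assms by measurable
  show "(\<lambda>\<omega>. (cmod (relayed_obs k (mmse_ests p \<omega>) (rest \<omega>)))\<^sup>2) \<in> borel_measurable \<Omega>"
    using measurable_est_rest_compose[OF m] by measurable
  have "(\<integral>\<^sup>+\<omega>. ennreal (1 * (cmod (relayed_obs k (mmse_ests p \<omega>) (rest \<omega>)))\<^sup>2) \<partial>\<Omega>) =
      (\<integral>\<^sup>+z. ennreal (1 * ((cmod (z SD))\<^sup>2 * Es + (cmod (relay_path z))\<^sup>2 * Es + noise_relayed z)) \<partial>est_law)"
    by (rule nn_integral_cond_square[where L="relayed_obs_terms k"])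
      (fact m relayed_obs_eq power_sum_relayed_obs terms_distinct | simp | erule relayed_terms_coords[OF assms])+
  also have "\<dots> \<le> (\<integral>\<^sup>+z. ennreal ((err_var p SD * Es + N0 + err_var p RD * Er) + Es * (cmod (z SD))\<^sup>2 + (Er + Er) * (cmod (z RD))\<^sup>2) \<partial>est_law)"
  proof (intro nn_integral_mono ennreal_leI)
    fix z
    show "1 * ((cmod (z SD))\<^sup>2 * Es + (cmod (relay_path z))\<^sup>2 * Es + noise_relayed z) \<le>
        (err_var p SD * Es + N0 + err_var p RD * Er) + Es * (cmod (z SD))\<^sup>2 + (Er + Er) * (cmod (z RD))\<^sup>2"
      using relay_path_bound[of z] noise_relayed_le[of z] by (simp add: distrib_right mult.commute)
  qed
  also have "\<dots> < \<infinity>"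
    using noise_var Es_pos Er_pos err_var_pos[of SD] err_var_pos[of RD] by (intro nn_integral_quadratic_est) auto
  finally show "(\<integral>\<^sup>+\<omega>. ennreal (norm ((cmod (relayed_obs k (mmse_ests p \<omega>) (rest \<omega>)))\<^sup>2)) \<partial>\<Omega>) < \<infinity>"
    by simp
qed

text \<open>Dividing by the conditional variance gives expectation exactly 1, with no dependence on
  the estimates. This is why the quadratic parts of the logarithm of \<open>test_density\<close>
  cancel on average although the true noise is not Gaussian.\<close>

lemma has_bochner_integral_normalized_residual:
  assumes m: "(\<lambda>x. F (fst x) (snd x)) \<in> borel_measurable (est_space \<Otimes>\<^sub>M rest_space)"
    and v[measurable]: "v \<in> borel_measurable est_space" and pos: "\<And>z. 0 < v z"
    and F: "\<And>z r. F z r = multi_affine (L z) r"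
    and L: "\<And>z S c. (S, c) \<in> set (L z) \<Longrightarrow> S \<subseteq> rest_coords" "\<And>z. distinct (map fst (L z))"
    and P: "\<And>z. power_sum (L z) = v z"
  shows "has_bochner_integral \<Omega> (\<lambda>\<omega>. (cmod (F (mmse_ests p \<omega>) (rest \<omega>)))\<^sup>2 / v (mmse_ests p \<omega>)) 1"
proof (rule has_bochner_integral_nn_integral)
  note [measurable] = measurable_est_rest_compose[OF m] measurable_mmse_ests
  show "(\<lambda>\<omega>. (cmod (F (mmse_ests p \<omega>) (rest \<omega>)))\<^sup>2 / v (mmse_ests p \<omega>)) \<in> borel_measurable \<Omega>"
    by measurable
  have "(\<integral>\<^sup>+\<omega>. ennreal (1 / v (mmse_ests p \<omega>) * (cmod (F (mmse_ests p \<omega>) (rest \<omega>)))\<^sup>2) \<partial>\<Omega>) =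
      (\<integral>\<^sup>+z. ennreal (1 / v z * v z) \<partial>est_law)"
    by (rule nn_integral_cond_square[where L=L]) (fact m F L P | simp add: pos less_imp_le | erule L)+
  also have "\<dots> = ennreal 1"
    using pos[THEN less_imp_neq] est.emeasure_space_1 by simp
  finally show "(\<integral>\<^sup>+\<omega>. ennreal ((cmod (F (mmse_ests p \<omega>) (rest \<omega>)))\<^sup>2 / v (mmse_ests p \<omega>)) \<partial>\<Omega>) = ennreal 1"
    by simp
qed (use pos in \<open>auto simp: less_imp_le\<close>)

lemma measurable_Rx:
  "i < data_len p \<Longrightarrow> g \<in> M \<rightarrow>\<^sub>M rest_space \<Longrightarrow> (\<lambda>x. g x (Rx i)) \<in> borel_measurable M"
  by (rule measurable_rest_space_component) simp_all

lemma residual_direct: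
  assumes "i < data_len p"
  shows "has_bochner_integral \<Omega> (\<lambda>\<omega>. (cmod (rest \<omega> (Rx i) - w_direct (mmse_ests p \<omega>) *
    direct_obs i (mmse_ests p \<omega>) (rest \<omega>)))\<^sup>2 / mmse_direct (mmse_ests p \<omega>)) 1"
proof (rule has_bochner_integral_normalized_residual[where L="residual_direct_terms i"])
  show "(\<lambda>x. snd x (Rx i) - w_direct (fst x) * direct_obs i (fst x) (snd x)) \<in> borel_measurable (est_space \<Otimes>\<^sub>M rest_space)"
    supply [measurable (raw)] = measurable_Rx
    using assms by measurable
qed (fact residual_direct_eq power_sum_residual_direct terms_distinct mmse_pos measurable_weights | erule direct_terms_coords[OF assms])+

lemma residual_relayed:
  assumes "k < dim2 p"
  shows "has_bochner_integral \<Omega> (\<lambda>\<omega>. (cmod (rest \<omega> (Rx (dim1 p + k)) -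
    (w_relayed1 (mmse_ests p \<omega>) * direct_obs (dim1 p + k) (mmse_ests p \<omega>) (rest \<omega>) +
     w_relayed2 (mmse_ests p \<omega>) * relayed_obs k (mmse_ests p \<omega>) (rest \<omega>))))\<^sup>2 / mmse_relayed (mmse_ests p \<omega>)) 1"
proof (rule has_bochner_integral_normalized_residual[where L="residual_relayed_terms k"])
  have "dim1 p + k < data_len p" using assms data_len_eq by simp
  then show "(\<lambda>x. snd x (Rx (dim1 p + k)) - (w_relayed1 (fst x) * direct_obs (dim1 p + k) (fst x) (snd x) +
      w_relayed2 (fst x) * relayed_obs k (fst x) (snd x))) \<in> borel_measurable (est_space \<Otimes>\<^sub>M rest_space)"
    supply [measurable (raw)] = measurable_Rx
    using assms by measurable
qed (fact residual_relayed_eq power_sum_residual_relayed terms_distinct mmse_pos measurable_weights | erule relayed_terms_coords[OF assms])+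

lemma residual_overlapped:
  assumes "k < dim2 p"
  shows "has_bochner_integral \<Omega> (\<lambda>\<omega>. (cmod (rest \<omega> (Rx (dim1 p + dim2 p + k)) -
    w_overlapped (mmse_ests p \<omega>) * (relayed_obs k (mmse_ests p \<omega>) (rest \<omega>) -
     relay_path (mmse_ests p \<omega>) * rest \<omega> (Rx (dim1 p + k)))))\<^sup>2 / mmse_overlapped (mmse_ests p \<omega>)) 1"
proof (rule has_bochner_integral_normalized_residual[where L="residual_overlapped_terms k"])
  have "dim1 p + k < data_len p" "dim1 p + dim2 p + k < data_len p" using assms data_len_eq by simp_all
  then show "(\<lambda>x. snd x (Rx (dim1 p + dim2 p + k)) - w_overlapped (fst x) * (relayed_obs k (fst x) (snd x) -
      relay_path (fst x) * snd x (Rx (dim1 p + k)))) \<in> borel_measurable (est_space \<Otimes>\<^sub>M rest_space)"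
    supply [measurable (raw)] = measurable_Rx
    using assms by measurable
qed (fact residual_overlapped_eq power_sum_residual_overlapped terms_distinct mmse_pos measurable_weights | erule relayed_terms_coords[OF assms])+

lemma has_bochner_integral_coord_square:
  assumes "j \<in> rest_coords"
  shows "has_bochner_integral \<Omega> (\<lambda>\<omega>. (cmod (rest \<omega> j))\<^sup>2) (coord_var p j)"
proof -
  have "has_bochner_integral \<Omega> (\<lambda>\<omega>. (cmod (rest \<omega> j))\<^sup>2 / coord_var p j) 1"
    by (rule has_bochner_integral_normalized_residual[where F="\<lambda>z r. r j" and v="\<lambda>_. coord_var p j" and L="\<lambda>_. [({j}, 1)]"])
      (use assms coord_var_pos in \<open>auto intro!: measurable_rest_space_component\<close>)
  from has_bochner_integral_mult_right[OF this, of "coord_var p j"] show ?thesis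
    using coord_var_pos[of j] by simp
qed

subsection \<open>Integrability of the rates\<close>

lemma mmse_ratio:
  "Es / mmse_direct z = 1 + Es * (cmod (z SD))\<^sup>2 / noise_direct"
  "Es / mmse_relayed z = 1 + Es * (cmod (z SD))\<^sup>2 / noise_direct +
     Es * (cmod (relay_path z))\<^sup>2 / ((cmod (z SD))\<^sup>2 * Es + noise_relayed z)"
  "Es / mmse_overlapped z = 1 + Es * (cmod (z SD))\<^sup>2 / noise_relayed z"
  using Es_pos by (simp_all add: mmse_direct_def mmse_relayed_def mmse_overlapped_def distrib_left)

text \<open>Each ratio in \<open>mmse_ratio\<close> is \<open>1 + t\<close> with
  \<open>0 \<le> ln (1 + t) \<le> t\<close>. All denominators are at least \<open>N0\<close>, so
  \<open>t\<close> is bounded by a quadratic function of the estimates.\<close>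

lemma integrable_rates:
  "integrable \<Omega> (\<lambda>\<omega>. ln (Es / mmse_direct (mmse_ests p \<omega>)))"
  "integrable \<Omega> (\<lambda>\<omega>. ln (Es / mmse_relayed (mmse_ests p \<omega>)))"
  "integrable \<Omega> (\<lambda>\<omega>. ln (Es / mmse_overlapped (mmse_ests p \<omega>)))"
proof -
  have N0_le: "N0 \<le> noise_direct" "N0 \<le> noise_relayed z" "N0 \<le> (cmod (z SD))\<^sup>2 * Es + noise_relayed z" for z
  proof -
    have "0 \<le> err_var p SD * Es" "0 \<le> err_var p RD * Er" "0 \<le> (cmod (z SD))\<^sup>2 * Es"
      using Es_pos Er_pos err_var_pos[of SD] err_var_pos[of RD] by auto
    then show "N0 \<le> noise_direct" "N0 \<le> noise_relayed z" "N0 \<le> (cmod (z SD))\<^sup>2 * Es + noise_relayed z"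
      using noise_relayed_ge[of z] by (simp_all add: noise_direct_def)
  qed
  have q: "0 \<le> Es * (cmod (z SD))\<^sup>2 / noise_direct" "0 \<le> Es * (cmod (z SD))\<^sup>2 / noise_relayed z"
    "0 \<le> Es * (cmod (relay_path z))\<^sup>2 / ((cmod (z SD))\<^sup>2 * Es + noise_relayed z)"
    "Es * (cmod (z SD))\<^sup>2 / noise_direct \<le> Es / N0 * (cmod (z SD))\<^sup>2"
    "Es * (cmod (z SD))\<^sup>2 / noise_relayed z \<le> Es / N0 * (cmod (z SD))\<^sup>2"
    "Es * (cmod (relay_path z))\<^sup>2 / ((cmod (z SD))\<^sup>2 * Es + noise_relayed z) \<le> Er / N0 * (cmod (z RD))\<^sup>2" for z
  proof -
    note le = N0_le(1) N0_le(2)[of z] N0_le(3)[of z]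
    show "0 \<le> Es * (cmod (z SD))\<^sup>2 / noise_direct" "0 \<le> Es * (cmod (z SD))\<^sup>2 / noise_relayed z"
      "0 \<le> Es * (cmod (relay_path z))\<^sup>2 / ((cmod (z SD))\<^sup>2 * Es + noise_relayed z)"
      using le noise_var Es_pos by auto
    show "Es * (cmod (z SD))\<^sup>2 / noise_direct \<le> Es / N0 * (cmod (z SD))\<^sup>2"
      "Es * (cmod (z SD))\<^sup>2 / noise_relayed z \<le> Es / N0 * (cmod (z SD))\<^sup>2"
      using divide_left_mono[OF le(1), of "Es * (cmod (z SD))\<^sup>2"] divide_left_mono[OF le(2), of "Es * (cmod (z SD))\<^sup>2"]
        noise_var noise_direct_pos noise_relayed_pos[of z] Es_pos by simp_all
    have "Es * (cmod (relay_path z))\<^sup>2 / ((cmod (z SD))\<^sup>2 * Es + noise_relayed z) \<le> Es * (cmod (relay_path z))\<^sup>2 / N0"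
      using le noise_var Es_pos by (intro divide_left_mono) auto
    also have "\<dots> \<le> Er * (cmod (z RD))\<^sup>2 / N0"
      using relay_path_bound[of z] noise_var by (intro divide_right_mono) (auto simp: mult.commute)
    finally show "Es * (cmod (relay_path z))\<^sup>2 / ((cmod (z SD))\<^sup>2 * Es + noise_relayed z) \<le> Er / N0 * (cmod (z RD))\<^sup>2"
      by simp
  qed
  have c: "0 \<le> Es / N0" "0 \<le> Er / N0" using Es_pos Er_pos noise_var by auto
  have ln: "0 \<le> ln (1 + t)" "ln (1 + t) \<le> t" if "0 \<le> t" for t :: real
    using that by (auto intro: ln_add_one_self_le_self)
  show "integrable \<Omega> (\<lambda>\<omega>. ln (Es / mmse_direct (mmse_ests p \<omega>)))"
  proof (rule integrable_of_quadratic_est[where s=0 and t="Es / N0" and u=0])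
    fix z :: "link \<Rightarrow> complex"
    show "0 \<le> ln (Es / mmse_direct z)" "ln (Es / mmse_direct z) \<le> 0 + Es / N0 * (cmod (z SD))\<^sup>2 + 0 * (cmod (z RD))\<^sup>2"
      using ln[OF q(1)[of z]] q(4)[of z] unfolding mmse_ratio by auto
  qed (use c in auto)
  show "integrable \<Omega> (\<lambda>\<omega>. ln (Es / mmse_overlapped (mmse_ests p \<omega>)))"
  proof (rule integrable_of_quadratic_est[where s=0 and t="Es / N0" and u=0])
    fix z :: "link \<Rightarrow> complex"
    show "0 \<le> ln (Es / mmse_overlapped z)" "ln (Es / mmse_overlapped z) \<le> 0 + Es / N0 * (cmod (z SD))\<^sup>2 + 0 * (cmod (z RD))\<^sup>2"
      using ln[OF q(2)[of z]] q(5)[of z] unfolding mmse_ratio by auto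
  qed (use c in auto)
  show "integrable \<Omega> (\<lambda>\<omega>. ln (Es / mmse_relayed (mmse_ests p \<omega>)))"
  proof (rule integrable_of_quadratic_est[where s=0 and t="Es / N0" and u="Er / N0"])
    fix z :: "link \<Rightarrow> complex"
    show "0 \<le> ln (Es / mmse_relayed z)" "ln (Es / mmse_relayed z) \<le> 0 + Es / N0 * (cmod (z SD))\<^sup>2 + Er / N0 * (cmod (z RD))\<^sup>2"
      using ln[OF add_nonneg_nonneg[OF q(1)[of z] q(3)[of z]]] q(4)[of z] q(6)[of z] unfolding mmse_ratio
      by (auto simp: add.assoc)
  qed (use c in auto)
qed

subsection \<open>The channel law relative to pure noise\<close>

abbreviation "input_space \<equiv> \<Pi>\<^sub>M i\<in>{..<data_len p}. (borel :: complex measure)"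
abbreviation "data_noise_space \<equiv> \<Pi>\<^sub>M t\<in>{2..<block_len p}. (borel :: complex measure)"
abbreviation "side_space \<equiv> est_space \<Otimes>\<^sub>M (\<Pi>\<^sub>M t\<in>{..<block_len p}. (borel :: complex measure)) \<Otimes>\<^sub>M
  (\<Pi>\<^sub>M t\<in>{..<2 :: nat}. (borel :: complex measure))"

text \<open>Everything besides the data that determines the mean of the received block: fading,
  relay noise, and the destination's noise at the two pilot times.\<close>

definition side :: "outcome \<Rightarrow> (link \<Rightarrow> complex) \<times> (nat \<Rightarrow> complex) \<times> (nat \<Rightarrow> complex)" where
  "side = (\<lambda>(x, h, nr, nd). (h, nr, restrict nd {..<2}))"

text \<open>Estimates depend on pilots only; the zero data vector is a placeholder that completes
  the outcome.\<close>

definition side_est :: "(link \<Rightarrow> complex) \<times> (nat \<Rightarrow> complex) \<times> (nat \<Rightarrow> complex) \<Rightarrow> link \<Rightarrow> complex" where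
  "side_est = (\<lambda>(h, nr, nd). mmse_ests p (\<lambda>_. 0, h, nr, nd))"

text \<open>At time \<open>t\<close> the source sends entry \<open>t - 2\<close>. The relay forwards
  with a delay of \<open>dim2 p\<close> symbols, hence entry \<open>t - 2 - dim2 p\<close> together
  with the relay noise of time \<open>t - dim2 p\<close>.\<close>

definition mean_obs :: "nat \<Rightarrow> (nat \<Rightarrow> complex) \<Rightarrow> (link \<Rightarrow> complex) \<times> (nat \<Rightarrow> complex) \<times> (nat \<Rightarrow> complex) \<Rightarrow> complex" where
  "mean_obs t x u = fst u SD * x (t - 2) +
     (if t - 2 < dim1 p + dim2 p then 0
      else fst u RD * (complex_of_real (gain (side_est u SR)) * (fst u SR * x (t - 2 - dim2 p) + fst (snd u) (t - dim2 p))))"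

definition received :: "outcome \<Rightarrow> nat \<Rightarrow> complex" where
  "received \<omega> = (\<lambda>t\<in>{2..<block_len p}. snd (snd (snd \<omega>)) t + mean_obs t (fst \<omega>) (side \<omega>))"

text \<open>The Cameron-Martin factor for a translation of the destination noise by
  \<open>mean_obs\<close>; it plays the role of \<open>s\<close> in the variational bound.\<close>

definition noise_ratio :: "(nat \<Rightarrow> complex) \<times> (nat \<Rightarrow> complex) \<times> (link \<Rightarrow> complex) \<times> (nat \<Rightarrow> complex) \<times> (nat \<Rightarrow> complex) \<Rightarrow> real" where
  "noise_ratio = (\<lambda>(x, y, u). exp (\<Sum>t\<in>{2..<block_len p}. ((cmod (y t))\<^sup>2 - (cmod (y t - mean_obs t x u))\<^sup>2) / N0))"

lemma side_est_side: "side_est (side \<omega>) = mmse_ests p \<omega>"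
proof
  fix l
  obtain x h nr nd where "\<omega> = (x, h, nr, nd)" by (cases \<omega>)
  then show "side_est (side \<omega>) l = mmse_ests p \<omega> l"
    by (cases l) (simp_all add: side_est_def side_def mmse_ests_def mmse_est_def pilot_obs_def)
qed

lemma measurable_side_est[measurable]: "(\<lambda>u. side_est u l) \<in> borel_measurable side_space"
proof -
  have [measurable]: "0 \<in> {..<block_len p}" "0 \<in> {..<2 :: nat}" "1 \<in> {..<2 :: nat}" using block_len by auto
  have "(\<lambda>u. pilot_noise l (\<lambda>_. 0, fst u, fst (snd u), snd (snd u))) \<in> borel_measurable side_space"
    by (cases l; hypsubst; unfold pilot_noise.simps; measurable)
  moreover have "(\<lambda>u. fst u l) \<in> borel_measurable side_space" by measurable
  ultimately show ?thesis
    unfolding side_est_def mmse_ests_def mmse_est_def pilot_obs_def split_beta' by (simp add: split_beta')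
qed

lemma measurable_side_est': "side_est \<in> side_space \<rightarrow>\<^sub>M est_space"
proof -
  have "(\<lambda>u. \<lambda>l\<in>UNIV. side_est u l) \<in> side_space \<rightarrow>\<^sub>M est_space"
    by (intro measurable_restrict measurable_side_est)
  then show ?thesis by (simp add: restrict_UNIV)
qed

lemma measurable_mean_obs:
  assumes t: "t \<in> {2..<block_len p}"
  shows "(\<lambda>x. mean_obs t (fst x) (snd x)) \<in> borel_measurable (input_space \<Otimes>\<^sub>M side_space)"
proof -
  have [measurable]: "t - 2 \<in> {..<data_len p}" "t - 2 - dim2 p \<in> {..<data_len p}" "t - dim2 p \<in> {..<block_len p}"
    using t by (auto simp: data_len_def)
  have [measurable]: "(\<lambda>x. side_est (snd x) SR) \<in> borel_measurable (input_space \<Otimes>\<^sub>M side_space)"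
    by measurable
  show ?thesis unfolding mean_obs_def by measurable
qed

lemma measurable_mean_obs_compose[measurable (raw)]:
  assumes "t \<in> {2..<block_len p}" "f \<in> M \<rightarrow>\<^sub>M input_space" "g \<in> M \<rightarrow>\<^sub>M side_space"
  shows "(\<lambda>x. mean_obs t (f x) (g x)) \<in> borel_measurable M"
  using measurable_compose[OF measurable_Pair[OF assms(2,3)] measurable_mean_obs[OF assms(1)]] by simp

lemma measurable_noise_ratio[measurable]:
  "noise_ratio \<in> borel_measurable (input_space \<Otimes>\<^sub>M data_noise_space \<Otimes>\<^sub>M side_space)"
  unfolding noise_ratio_def split_beta' by measurable

abbreviation "fading_law \<equiv> gauss_prod UNIV (\<lambda>l. (fading_sd p l)\<^sup>2)"
abbreviation noise_law :: "nat set \<Rightarrow> (nat \<Rightarrow> complex) measure" where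
  "noise_law T \<equiv> gauss_prod T (\<lambda>_. N0)"

text \<open>A fictitious law under which the data phase delivers pure noise, independent of the side
  information.\<close>

definition reference_law where
  "reference_law = noise_law {2..<block_len p} \<Otimes>\<^sub>M (fading_law \<Otimes>\<^sub>M noise_law {..<block_len p} \<Otimes>\<^sub>M noise_law {..<2})"

lemma sets_noise_law[simp, measurable_cong]: "sets (noise_law T) = sets (\<Pi>\<^sub>M t\<in>T. borel)"
  by (intro sets_PiM_cong) auto

lemma sets_fading_law[simp, measurable_cong]: "sets fading_law = sets est_space"
  by (intro sets_PiM_cong) auto

lemma prob_space_fading_law: "prob_space fading_law"
  by (intro prob_space_PiM prob_space_complex_gaussian) simp

lemma prob_space_noise_law: "prob_space (noise_law T)"
  by (intro prob_space_PiM prob_space_complex_gaussian noise_var)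

lemma sets_reference_law[simp, measurable_cong]:
  "sets reference_law = sets (data_noise_space \<Otimes>\<^sub>M side_space)"
  unfolding reference_law_def by (intro sets_pair_measure_cong) simp_all

lemma prob_space_side_law: "prob_space (fading_law \<Otimes>\<^sub>M noise_law {..<block_len p} \<Otimes>\<^sub>M noise_law {..<2})"
proof -
  interpret F: prob_space fading_law by (rule prob_space_fading_law)
  interpret N: prob_space "noise_law {..<block_len p}" by (rule prob_space_noise_law)
  interpret N2: prob_space "noise_law {..<2}" by (rule prob_space_noise_law)
  interpret NN: pair_prob_space "noise_law {..<block_len p}" "noise_law {..<2}" ..
  interpret FNN: pair_prob_space fading_law "noise_law {..<block_len p} \<Otimes>\<^sub>M noise_law {..<2}" ..
  show ?thesis by (rule FNN.P.prob_space_axioms)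
qed

lemma prob_space_reference_law: "prob_space reference_law"
proof -
  interpret N: prob_space "noise_law {2..<block_len p}" by (rule prob_space_noise_law)
  interpret S: prob_space "fading_law \<Otimes>\<^sub>M noise_law {..<block_len p} \<Otimes>\<^sub>M noise_law {..<2}" by (rule prob_space_side_law)
  interpret NS: pair_prob_space "noise_law {2..<block_len p}" "fading_law \<Otimes>\<^sub>M noise_law {..<block_len p} \<Otimes>\<^sub>M noise_law {..<2}" ..
  show ?thesis unfolding reference_law_def by (rule NS.P.prob_space_axioms)
qed

lemma measurable_side: "side \<in> \<Omega> \<rightarrow>\<^sub>M side_space"
proof -
  note [measurable] = measurable_block_space_components
  have "(\<lambda>\<omega>. restrict (snd (snd (snd \<omega>))) {..<2}) \<in> \<Omega> \<rightarrow>\<^sub>M (\<Pi>\<^sub>M t\<in>{..<2}. borel)"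
    using block_len by (intro measurable_compose[OF measurable_block_space_components(4)] measurable_restrict_subset) auto
  then show ?thesis unfolding side_def split_beta' by measurable
qed

lemma measurable_received: "received \<in> \<Omega> \<rightarrow>\<^sub>M data_noise_space"
proof -
  have "(\<lambda>\<omega>. snd (snd (snd \<omega>)) t) \<in> borel_measurable \<Omega>" if "t \<in> {2..<block_len p}" for t
    using that by (intro measurable_compose[OF measurable_block_space_components(4)] measurable_component_singleton) auto
  then show ?thesis
    unfolding received_def
    by (intro measurable_restrict borel_measurable_add measurable_mean_obs_compose measurable_side
      measurable_block_space_components(1))
qed

lemma measurable_received_side: "(\<lambda>\<omega>. (received \<omega>, side \<omega>)) \<in> \<Omega> \<rightarrow>\<^sub>M data_noise_space \<Otimes>\<^sub>M side_space"
  by (intro measurable_Pair measurable_received measurable_side)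

lemma distr_fst_block_space: "distr \<Omega> input_space fst = gauss_input p"
proof -
  interpret F: prob_space fading_law by (rule prob_space_fading_law)
  interpret N: prob_space "noise_law {..<block_len p}" by (rule prob_space_noise_law)
  interpret NN: pair_prob_space "noise_law {..<block_len p}" "noise_law {..<block_len p}" ..
  interpret FNN: pair_prob_space fading_law "noise_law {..<block_len p} \<Otimes>\<^sub>M noise_law {..<block_len p}" ..
  have "distr \<Omega> input_space fst = distr \<Omega> (gauss_input p) fst" by (intro distr_cong) simp_all
  also have "\<dots> = gauss_input p" unfolding block_space_def by (rule FNN.P.distr_pair_fst)
  finally show ?thesis .
qed

text \<open>Destination noise at times 0 and 1 belongs to \<open>side\<close>; only the later times
  are translated by the signal.\<close>

lemma nn_integral_noise_split:
  fixes f :: "(nat \<Rightarrow> complex) \<Rightarrow> (nat \<Rightarrow> complex) \<Rightarrow> ennreal"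
  assumes [measurable]: "case_prod f \<in> borel_measurable ((\<Pi>\<^sub>M t\<in>{..<2}. borel) \<Otimes>\<^sub>M data_noise_space)"
  shows "(\<integral>\<^sup>+nd. f (restrict nd {..<2}) (restrict nd {2..<block_len p}) \<partial>noise_law {..<block_len p}) =
    (\<integral>\<^sup>+u. \<integral>\<^sup>+n. f u n \<partial>noise_law {2..<block_len p} \<partial>noise_law {..<2})"
proof -
  interpret product_prob_space "\<lambda>_ :: nat. complex_gaussian 0 N0"
    using noise_var by (intro product_prob_space_complex_gaussian)
  have un: "{..<2} \<union> {2..<block_len p} = {..<block_len p}" using block_len by auto
  have m: "(\<lambda>nd. f (restrict nd {..<2}) (restrict nd {2..<block_len p})) \<in> borel_measurable (noise_law ({..<2} \<union> {2..<block_len p}))"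
  proof -
    have [measurable]: "(\<lambda>nd. restrict nd {..<2}) \<in> noise_law ({..<2} \<union> {2..<block_len p}) \<rightarrow>\<^sub>M (\<Pi>\<^sub>M t\<in>{..<2}. borel)"
      "(\<lambda>nd. restrict nd {2..<block_len p}) \<in> noise_law ({..<2} \<union> {2..<block_len p}) \<rightarrow>\<^sub>M data_noise_space"
      by (auto intro!: measurable_restrict measurable_component_singleton cong: measurable_cong_sets)
    show ?thesis by measurable
  qed
  have "(\<integral>\<^sup>+nd. f (restrict nd {..<2}) (restrict nd {2..<block_len p}) \<partial>noise_law {..<block_len p}) =
     (\<integral>\<^sup>+u. \<integral>\<^sup>+n. f (restrict (merge {..<2} {2..<block_len p} (u, n)) {..<2})
        (restrict (merge {..<2} {2..<block_len p} (u, n)) {2..<block_len p}) \<partial>noise_law {2..<block_len p} \<partial>noise_law {..<2})"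
    unfolding un[symmetric] by (rule product_nn_integral_fold) (use m in auto)
  also have "\<dots> = (\<integral>\<^sup>+u. \<integral>\<^sup>+n. f u n \<partial>noise_law {2..<block_len p} \<partial>noise_law {..<2})"
  proof (intro nn_integral_cong)
    fix u n assume "u \<in> space (noise_law {..<2})" "n \<in> space (noise_law {2..<block_len p})"
    then have "restrict (merge {..<2} {2..<block_len p} (u, n)) {..<2} = u"
      "restrict (merge {..<2} {2..<block_len p} (u, n)) {2..<block_len p} = n"
      by (auto simp: space_PiM PiE_iff extensional_def merge_def fun_eq_iff)
    then show "f (restrict (merge {..<2} {2..<block_len p} (u, n)) {..<2})
        (restrict (merge {..<2} {2..<block_len p} (u, n)) {2..<block_len p}) = f u n" by simp
  qed
  finally show ?thesis .
qed

text \<open>Once data and side information are fixed, the received block is the data-phase noise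
  translated by a constant vector, so \<open>nn_integral_gauss_prod_shift\<close> applies inside the
  integrals over the other variables.\<close>

lemma distr_received:
  "distr \<Omega> (input_space \<Otimes>\<^sub>M data_noise_space \<Otimes>\<^sub>M side_space) (\<lambda>\<omega>. (fst \<omega>, received \<omega>, side \<omega>)) =
    density (distr \<Omega> input_space fst \<Otimes>\<^sub>M reference_law) noise_ratio"
proof (rule measure_eqI)
  let ?T = "{2..<block_len p}"
  let ?S = "fading_law \<Otimes>\<^sub>M noise_law {..<block_len p} \<Otimes>\<^sub>M noise_law {..<2}"
  interpret X: prob_space "gauss_input p" by (rule prob_space_gauss_input)
  interpret F: prob_space fading_law by (rule prob_space_fading_law)
  interpret N: prob_space "noise_law {..<block_len p}" by (rule prob_space_noise_law)
  interpret N2: prob_space "noise_law {..<2}" by (rule prob_space_noise_law)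
  interpret NT: prob_space "noise_law ?T" by (rule prob_space_noise_law)
  interpret S: prob_space ?S by (rule prob_space_side_law)
  interpret R: prob_space reference_law by (rule prob_space_reference_law)
  interpret TS: pair_prob_space "noise_law ?T" ?S ..
  let ?B = "input_space \<Otimes>\<^sub>M data_noise_space \<Otimes>\<^sub>M side_space"
  show "sets (distr \<Omega> ?B (\<lambda>\<omega>. (fst \<omega>, received \<omega>, side \<omega>))) = sets (density (distr \<Omega> input_space fst \<Otimes>\<^sub>M reference_law) noise_ratio)"
    by (simp cong: sets_pair_measure_cong)
  fix A assume "A \<in> sets (distr \<Omega> ?B (\<lambda>\<omega>. (fst \<omega>, received \<omega>, side \<omega>)))"
  then have A[measurable]: "A \<in> sets ?B" by simp
  define \<phi> :: "_ \<Rightarrow> _ \<Rightarrow> _ \<Rightarrow> ennreal" where "\<phi> x y u = indicator A (x, y, u)" for x y u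
  have \<phi>[measurable (raw)]: "(\<lambda>z. \<phi> (f z) (g z) (k z)) \<in> borel_measurable M"
    if [measurable]: "f \<in> M \<rightarrow>\<^sub>M input_space" "g \<in> M \<rightarrow>\<^sub>M data_noise_space" "k \<in> M \<rightarrow>\<^sub>M side_space"
    for f g k and M :: "'z measure"
    unfolding \<phi>_def by measurable
  let ?\<mu> = "\<lambda>x u. \<lambda>n. \<lambda>t\<in>?T. n t + mean_obs t x u"
  have \<mu>[measurable (raw)]: "(\<lambda>z. ?\<mu> (f z) (k z) (g z)) \<in> M \<rightarrow>\<^sub>M data_noise_space"
    if [measurable]: "f \<in> M \<rightarrow>\<^sub>M input_space" "g \<in> M \<rightarrow>\<^sub>M data_noise_space" "k \<in> M \<rightarrow>\<^sub>M side_space"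
    for f g k and M :: "'z measure"
    by measurable
  have mT: "(\<lambda>\<omega>. (fst \<omega>, received \<omega>, side \<omega>)) \<in> \<Omega> \<rightarrow>\<^sub>M ?B"
    by (intro measurable_Pair measurable_block_space_components measurable_received measurable_side)
  have "emeasure (distr \<Omega> ?B (\<lambda>\<omega>. (fst \<omega>, received \<omega>, side \<omega>))) A = (\<integral>\<^sup>+\<omega>. \<phi> (fst \<omega>) (received \<omega>) (side \<omega>) \<partial>\<Omega>)"
    unfolding \<phi>_def by (subst nn_integral_indicator[symmetric], simp, subst nn_integral_distr[OF mT]) simp_all
  also have "\<dots> = (\<integral>\<^sup>+x. \<integral>\<^sup>+h. \<integral>\<^sup>+nr. \<integral>\<^sup>+nd. \<phi> x (?\<mu> x (h, nr, restrict nd {..<2}) (restrict nd ?T)) (h, nr, restrict nd {..<2})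
      \<partial>noise_law {..<block_len p} \<partial>noise_law {..<block_len p} \<partial>fading_law \<partial>gauss_input p)"
  proof -
    define \<psi> where "\<psi> = (\<lambda>(x, h, nr, nd). \<phi> x (?\<mu> x (h, nr, restrict nd {..<2}) (restrict nd ?T)) (h, nr, restrict nd {..<2}))"
    have "received (x, h, nr, nd) = ?\<mu> x (h, nr, restrict nd {..<2}) (restrict nd ?T)" for x h nr nd
      by (simp add: received_def side_def cong: restrict_cong)
    then have eq: "\<phi> (fst \<omega>) (received \<omega>) (side \<omega>) = \<psi> \<omega>" for \<omega>
      by (cases \<omega>) (simp add: side_def \<psi>_def)
    have "(\<lambda>\<omega>. \<phi> (fst \<omega>) (received \<omega>) (side \<omega>)) \<in> borel_measurable \<Omega>"
      by (rule \<phi>[OF measurable_block_space_components(1) measurable_received measurable_side])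
    then have m: "\<psi> \<in> borel_measurable \<Omega>" by (simp only: eq)
    have "(\<integral>\<^sup>+\<omega>. \<psi> \<omega> \<partial>\<Omega>) = (\<integral>\<^sup>+x. \<integral>\<^sup>+h. \<integral>\<^sup>+nr. \<integral>\<^sup>+nd. \<psi> (x, h, nr, nd)
      \<partial>noise_law {..<block_len p} \<partial>noise_law {..<block_len p} \<partial>fading_law \<partial>gauss_input p)"
      unfolding block_space_def
      by (rule nn_integral_pair4[OF F.sigma_finite_measure_axioms N.sigma_finite_measure_axioms
        N.sigma_finite_measure_axioms m[unfolded block_space_def]])
    then show ?thesis by (simp only: eq) (simp only: \<psi>_def prod.case)
  qed
  also have "\<dots> = (\<integral>\<^sup>+x. \<integral>\<^sup>+h. \<integral>\<^sup>+nr. \<integral>\<^sup>+u. \<integral>\<^sup>+n. \<phi> x (?\<mu> x (h, nr, u) n) (h, nr, u)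
      \<partial>noise_law ?T \<partial>noise_law {..<2} \<partial>noise_law {..<block_len p} \<partial>fading_law \<partial>gauss_input p)"
  proof (intro nn_integral_cong nn_integral_noise_split)
    fix x h nr assume "x \<in> space (gauss_input p)" "h \<in> space fading_law" "nr \<in> space (noise_law {..<block_len p})"
    then have [measurable]: "x \<in> space input_space" "h \<in> space est_space" "nr \<in> space (\<Pi>\<^sub>M t\<in>{..<block_len p}. borel)"
      by (auto simp: gauss_input_def space_PiM)
    show "(\<lambda>(u, n). \<phi> x (?\<mu> x (h, nr, u) n) (h, nr, u)) \<in> borel_measurable ((\<Pi>\<^sub>M t\<in>{..<2}. borel) \<Otimes>\<^sub>M data_noise_space)"
      unfolding split_beta' by measurable
  qed
  also have "\<dots> = (\<integral>\<^sup>+x. \<integral>\<^sup>+u. \<integral>\<^sup>+n. \<phi> x (?\<mu> x u n) u \<partial>noise_law ?T \<partial>?S \<partial>gauss_input p)"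
  proof (intro nn_integral_cong)
    fix x assume "x \<in> space (gauss_input p)"
    then have x[measurable]: "x \<in> space input_space" by (auto simp: gauss_input_def space_PiM)
    let ?f = "\<lambda>u. \<integral>\<^sup>+n. \<phi> x (?\<mu> x u n) u \<partial>noise_law ?T"
    have f[measurable]: "?f \<in> borel_measurable side_space"
      by measurable
    interpret NN: pair_prob_space "noise_law {..<block_len p}" "noise_law {..<2}" ..
    have "(\<integral>\<^sup>+u. ?f u \<partial>?S) = (\<integral>\<^sup>+h. \<integral>\<^sup>+v. ?f (h, v) \<partial>(noise_law {..<block_len p} \<Otimes>\<^sub>M noise_law {..<2}) \<partial>fading_law)"
      by (rule NN.P.nn_integral_fst[symmetric]) measurable
    also have "\<dots> = (\<integral>\<^sup>+h. \<integral>\<^sup>+nr. \<integral>\<^sup>+u. ?f (h, nr, u) \<partial>noise_law {..<2} \<partial>noise_law {..<block_len p} \<partial>fading_law)"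
    proof (intro nn_integral_cong N2.nn_integral_fst[symmetric])
      fix h assume "h \<in> space fading_law"
      then have "h \<in> space est_space" by (simp add: space_PiM)
      from measurable_compose_Pair1[OF this f]
      show "(\<lambda>v. ?f (h, v)) \<in> borel_measurable (noise_law {..<block_len p} \<Otimes>\<^sub>M noise_law {..<2})"
        by (simp cong: measurable_cong_sets sets_pair_measure_cong)
    qed
    finally show "(\<integral>\<^sup>+h. \<integral>\<^sup>+nr. \<integral>\<^sup>+u. \<integral>\<^sup>+n. \<phi> x (?\<mu> x (h, nr, u) n) (h, nr, u)
      \<partial>noise_law ?T \<partial>noise_law {..<2} \<partial>noise_law {..<block_len p} \<partial>fading_law) = (\<integral>\<^sup>+u. ?f u \<partial>?S)" ..
  qed
  \<comment> \<open>The translation formula, used for fixed \<open>x\<close> and \<open>u\<close>;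
    the integration variable is now the received block.\<close>
  also have "\<dots> = (\<integral>\<^sup>+x. \<integral>\<^sup>+u. \<integral>\<^sup>+y. \<phi> x y u * ennreal (noise_ratio (x, y, u)) \<partial>noise_law ?T \<partial>?S \<partial>gauss_input p)"
  proof (rule nn_integral_cong, rule nn_integral_cong)
    fix x u assume "x \<in> space (gauss_input p)" "u \<in> space ?S"
    then have [measurable]: "x \<in> space input_space" "u \<in> space side_space"
      by (auto simp: gauss_input_def space_PiM space_pair_measure)
    show "(\<integral>\<^sup>+n. \<phi> x (?\<mu> x u n) u \<partial>noise_law ?T) = (\<integral>\<^sup>+y. \<phi> x y u * ennreal (noise_ratio (x, y, u)) \<partial>noise_law ?T)"
      using nn_integral_gauss_prod_shift[of ?T N0 "\<lambda>y. \<phi> x y u" "\<lambda>t. mean_obs t x u"] noise_var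
      by (simp add: noise_ratio_def)
  qed
  also have "\<dots> = (\<integral>\<^sup>+x. \<integral>\<^sup>+y. \<integral>\<^sup>+u. \<phi> x y u * ennreal (noise_ratio (x, y, u)) \<partial>?S \<partial>noise_law ?T \<partial>gauss_input p)"
  proof (rule nn_integral_cong)
    fix x assume "x \<in> space (gauss_input p)"
    then have [measurable]: "x \<in> space input_space" by (auto simp: gauss_input_def space_PiM)
    have "(\<lambda>(y, u). \<phi> x y u * ennreal (noise_ratio (x, y, u))) \<in> borel_measurable (noise_law ?T \<Otimes>\<^sub>M ?S)"
      unfolding split_beta' by measurable
    then show "(\<integral>\<^sup>+u. \<integral>\<^sup>+y. \<phi> x y u * ennreal (noise_ratio (x, y, u)) \<partial>noise_law ?T \<partial>?S) =
        (\<integral>\<^sup>+y. \<integral>\<^sup>+u. \<phi> x y u * ennreal (noise_ratio (x, y, u)) \<partial>?S \<partial>noise_law ?T)"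
      by (rule TS.Fubini')
  qed
  also have "\<dots> = (\<integral>\<^sup>+x. \<integral>\<^sup>+w. indicator A (x, w) * ennreal (noise_ratio (x, w)) \<partial>reference_law \<partial>gauss_input p)"
  proof (intro nn_integral_cong)
    fix x assume "x \<in> space (gauss_input p)"
    then have [measurable]: "x \<in> space input_space" by (auto simp: gauss_input_def space_PiM)
    show "(\<integral>\<^sup>+y. \<integral>\<^sup>+u. \<phi> x y u * ennreal (noise_ratio (x, y, u)) \<partial>?S \<partial>noise_law ?T) =
        (\<integral>\<^sup>+w. indicator A (x, w) * ennreal (noise_ratio (x, w)) \<partial>reference_law)"
      unfolding reference_law_def by (subst S.nn_integral_fst[symmetric]) (simp_all add: \<phi>_def)
  qed
  also have "\<dots> = (\<integral>\<^sup>+z. indicator A z * ennreal (noise_ratio z) \<partial>(gauss_input p \<Otimes>\<^sub>M reference_law))"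
    by (rule R.nn_integral_fst) measurable
  also have "\<dots> = emeasure (density (distr \<Omega> input_space fst \<Otimes>\<^sub>M reference_law) noise_ratio) A"
    unfolding distr_fst_block_space by (subst emeasure_density) (simp_all add: mult.commute cong: sets_pair_measure_cong)
  finally show "emeasure (distr \<Omega> ?B (\<lambda>\<omega>. (fst \<omega>, received \<omega>, side \<omega>))) A =
      emeasure (density (distr \<Omega> input_space fst \<Otimes>\<^sub>M reference_law) noise_ratio) A" .
qed

end

lemma sum_lessThan_add: "sum f {..<m + n} = sum f {..<m} + (\<Sum>k<n. f (m + k))" for f :: "nat \<Rightarrow> 'a :: comm_monoid_add"
  by (induction n) (simp_all add: add.assoc)

context af_network begin

subsection \<open>The test density\<close>

abbreviation "obs_space \<equiv> (\<Pi>\<^sub>M i\<in>{..<dim1 p}. (borel :: complex measure)) \<Otimes>\<^sub>M (\<Pi>\<^sub>M i\<in>{..<dim2 p}. (borel :: complex measure)) \<Otimes>\<^sub>M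
  (\<Pi>\<^sub>M i\<in>{..<dim2 p}. (borel :: complex measure))"

type_synonym obs = "(nat \<Rightarrow> complex) \<times> (nat \<Rightarrow> complex) \<times> (nat \<Rightarrow> complex)"

text \<open>The map \<open>\<zeta>\<close> of the variational bound: it forgets fading, pilots and
  relay noise except for what the estimates retain, and cuts the received block into its three
  parts.\<close>

definition decoder_view ::
  "(nat \<Rightarrow> complex) \<times> (link \<Rightarrow> complex) \<times> (nat \<Rightarrow> complex) \<times> (nat \<Rightarrow> complex) \<Rightarrow> obs \<times> (link \<Rightarrow> complex)" where
  "decoder_view = (\<lambda>(y, u). ((\<lambda>i\<in>{..<dim1 p}. y (2 + i), \<lambda>i\<in>{..<dim2 p}. y (2 + dim1 p + i),
     \<lambda>i\<in>{..<dim2 p}. y (2 + dim1 p + dim2 p + i)), side_est u))"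

definition post_var :: "nat \<Rightarrow> (link \<Rightarrow> complex) \<Rightarrow> real" where
  "post_var i z = (if i < dim1 p then mmse_direct z else if i < dim1 p + dim2 p then mmse_relayed z else mmse_overlapped z)"

text \<open>The symbols sent while the relay transmits are estimated last, after the contribution of the
  relayed symbol \<open>x (i - dim2 p)\<close> has been subtracted: this is the chain rule for the posterior.\<close>

definition post_mean :: "nat \<Rightarrow> (nat \<Rightarrow> complex) \<Rightarrow> obs \<times> (link \<Rightarrow> complex) \<Rightarrow> complex" where
  "post_mean i x = (\<lambda>((a, b, c), z).
     if i < dim1 p then w_direct z * a i
     else if i < dim1 p + dim2 p then w_relayed1 z * b (i - dim1 p) + w_relayed2 z * c (i - dim1 p)
     else w_overlapped z * (c (i - dim1 p - dim2 p) - relay_path z * x (i - dim2 p)))"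

definition test_density :: "(nat \<Rightarrow> complex) \<times> obs \<times> (link \<Rightarrow> complex) \<Rightarrow> real" where
  "test_density = (\<lambda>(x, v). \<Prod>i<data_len p. cg_density (post_mean i x v) (post_var i (snd v)) (x i) / cg_density 0 Es (x i))"

lemma post_var_pos: "0 < post_var i z"
  using mmse_pos[of z] by (simp add: post_var_def)

lemma test_density_pos: "0 < test_density z"
  unfolding test_density_def split_beta'
  by (intro prod_pos ballI divide_pos_pos cg_density_pos post_var_pos Es_pos)

text \<open>Links the description by time and side information, which carries the density, to the
  one by estimates and \<open>rest\<close>, which carries the moments.\<close>

lemma received_eq:
  "i < dim1 p + dim2 p \<Longrightarrow> received \<omega> (2 + i) = direct_obs i (mmse_ests p \<omega>) (rest \<omega>)"
  "k < dim2 p \<Longrightarrow> received \<omega> (2 + (dim1 p + dim2 p + k)) = relayed_obs k (mmse_ests p \<omega>) (rest \<omega>)"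
proof -
  obtain x h nr nd where \<omega>: "\<omega> = (x, h, nr, nd)" by (cases \<omega>)
  show "received \<omega> (2 + i) = direct_obs i (mmse_ests p \<omega>) (rest \<omega>)" if "i < dim1 p + dim2 p"
  proof -
    have i: "i < data_len p" using that data_len_eq by simp
    show ?thesis
      using that i add_two_less_block_len[OF i] unfolding \<omega>
      by (simp add: received_def mean_obs_def side_def direct_obs_def rest_simps)
  qed
  show "received \<omega> (2 + (dim1 p + dim2 p + k)) = relayed_obs k (mmse_ests p \<omega>) (rest \<omega>)" if "k < dim2 p"
  proof -
    have k: "dim1 p + dim2 p + k < data_len p" "dim1 p + k < data_len p" using that data_len_eq by simp_all
    have idx: "dim1 p + dim2 p + k - dim2 p = dim1 p + k" "2 + (dim1 p + dim2 p + k) - dim2 p = 2 + dim1 p + k" by simp_all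
    have "side_est (h, nr, restrict nd {..<2}) = mmse_ests p \<omega>"
      using side_est_side[of \<omega>] by (simp add: \<omega> side_def)
    then show ?thesis
      using that k add_two_less_block_len[OF k(1)] add_two_less_block_len[OF k(2)]
      unfolding received_def mean_obs_def
      by (simp add: idx \<omega> side_def relayed_obs_def relay_obs_def direct_obs_def rest_simps del: add_2_eq_Suc add_2_eq_Suc')
  qed
qed

lemma decoder_view_received:
  "decoder_view (received \<omega>, side \<omega>) = ((y_d1 p \<omega>, y_d2 p \<omega>, y_dr p gain \<omega>), mmse_ests p \<omega>)"
proof -
  obtain x h nr nd where \<omega>: "\<omega> = (x, h, nr, nd)" by (cases \<omega>)
  have len: "2 + i < block_len p" if "i < dim1 p + dim2 p + dim2 p" for i
    using that data_len_eq add_two_less_block_len[of i] by simp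
  have "received \<omega> (2 + i) = y_d1 p \<omega> i" if "i < dim1 p" for i
    using that len[of i] by (simp add: received_def mean_obs_def side_def y_d1_def \<omega>)
  then have 1: "(\<lambda>i\<in>{..<dim1 p}. received \<omega> (2 + i)) = y_d1 p \<omega>"
    by (auto simp: y_d1_def \<omega> fun_eq_iff)
  have "received \<omega> (2 + dim1 p + i) = y_d2 p \<omega> i" if "i < dim2 p" for i
    using that len[of "dim1 p + i"] by (simp add: received_def mean_obs_def side_def y_d2_def \<omega>)
  then have 2: "(\<lambda>i\<in>{..<dim2 p}. received \<omega> (2 + dim1 p + i)) = y_d2 p \<omega>"
    by (auto simp: y_d2_def \<omega> fun_eq_iff)
  have "received \<omega> (2 + dim1 p + dim2 p + i) = y_dr p gain \<omega> i" if "i < dim2 p" for i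
  proof -
    have "side_est (h, nr, restrict nd {..<2}) = mmse_ests p \<omega>"
      using side_est_side[of \<omega>] by (simp add: \<omega> side_def)
    moreover have "Suc (Suc (dim1 p + dim2 p + i)) - dim2 p = Suc (Suc (dim1 p + i))" by simp
    ultimately show ?thesis
      using that len[of "dim1 p + dim2 p + i"] by (simp add: received_def mean_obs_def side_def y_dr_def x_r_def y_r_def mmse_ests_def \<omega>)
  qed
  then have 3: "(\<lambda>i\<in>{..<dim2 p}. received \<omega> (2 + dim1 p + dim2 p + i)) = y_dr p gain \<omega>"
    by (auto simp: y_dr_def \<omega> fun_eq_iff)
  show ?thesis by (simp only: decoder_view_def prod.case 1 2 3 side_est_side)
qed

lemma measurable_decoder_view: "decoder_view \<in> data_noise_space \<Otimes>\<^sub>M side_space \<rightarrow>\<^sub>M obs_space \<Otimes>\<^sub>M est_space"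
proof -
  have "(\<lambda>w. fst w t) \<in> borel_measurable (data_noise_space \<Otimes>\<^sub>M side_space)" if "t \<in> {2..<block_len p}" for t
    using that by (intro measurable_compose[OF measurable_fst] measurable_component_singleton)
  moreover have "2 + i \<in> {2..<block_len p}" if "i < data_len p" for i
    using that add_two_less_block_len[of i] by simp
  ultimately have y: "(\<lambda>w. fst w (2 + i)) \<in> borel_measurable (data_noise_space \<Otimes>\<^sub>M side_space)" if "i < data_len p" for i
    using that by blast
  show ?thesis
    unfolding decoder_view_def split_beta' add.assoc
    by (intro measurable_Pair measurable_restrict y measurable_compose[OF measurable_snd measurable_side_est'])
       (simp_all add: data_len_eq)
qed

text \<open>The only data entry that can be read is \<open>i - dim2 p\<close>, so a prefix of length
  \<open>n > i\<close> is enough. Prefixes are what the measurability condition of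
  \<open>nn_integral_sequential_kernels\<close> asks for.\<close>

lemma measurable_post_mean:
  assumes i: "i < data_len p" "f \<in> M \<rightarrow>\<^sub>M (\<Pi>\<^sub>M j\<in>{..<n}. borel)" "n \<le> data_len p" "i < n"
    and g: "g \<in> M \<rightarrow>\<^sub>M obs_space \<Otimes>\<^sub>M est_space"
  shows "(\<lambda>x. post_mean i (f x) (g x)) \<in> borel_measurable M"
proof -
  note [measurable] = i(2) g
  have z[measurable]: "(\<lambda>x. snd (g x)) \<in> M \<rightarrow>\<^sub>M est_space" by measurable
  have a: "(\<lambda>x. fst (fst (g x)) j) \<in> borel_measurable M" if "j < dim1 p" for j
  proof -
    have [measurable]: "j \<in> {..<dim1 p}" using that by simp
    show ?thesis by measurable
  qed
  have b: "(\<lambda>x. fst (snd (fst (g x))) j) \<in> borel_measurable M" if "j < dim2 p" for j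
  proof -
    have [measurable]: "j \<in> {..<dim2 p}" using that by simp
    show ?thesis by measurable
  qed
  have c: "(\<lambda>x. snd (snd (fst (g x))) j) \<in> borel_measurable M" if "j < dim2 p" for j
  proof -
    have [measurable]: "j \<in> {..<dim2 p}" using that by simp
    show ?thesis by measurable
  qed
  have x: "(\<lambda>x. f x j) \<in> borel_measurable M" if "j < n" for j
  proof -
    have [measurable]: "j \<in> {..<n}" using that by simp
    show ?thesis by measurable
  qed
  consider "i < dim1 p" | "dim1 p \<le> i" "i < dim1 p + dim2 p" | "dim1 p + dim2 p \<le> i" by linarith
  then show ?thesis
  proof cases
    case 1
    then show ?thesis unfolding post_mean_def split_beta' using a[of i] by simp
  next
    case 2
    then have [measurable]: "(\<lambda>x. fst (snd (fst (g x))) (i - dim1 p)) \<in> borel_measurable M"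
      "(\<lambda>x. snd (snd (fst (g x))) (i - dim1 p)) \<in> borel_measurable M"
      by (auto intro!: b c)
    show ?thesis unfolding post_mean_def split_beta' using 2 by simp
  next
    case 3
    then have [measurable]: "(\<lambda>x. snd (snd (fst (g x))) (i - (dim1 p + dim2 p))) \<in> borel_measurable M"
      "(\<lambda>x. f x (i - dim2 p)) \<in> borel_measurable M"
      using i data_len_eq by (auto intro!: c x)
    show ?thesis unfolding post_mean_def split_beta' using 3 by simp
  qed
qed

lemma measurable_post_var[measurable]: "post_var i \<in> borel_measurable est_space"
  unfolding post_var_def by measurable

lemma measurable_test_density: "test_density \<in> borel_measurable (input_space \<Otimes>\<^sub>M obs_space \<Otimes>\<^sub>M est_space)"
proof -
  have [measurable]: "(\<lambda>x. post_mean i (fst x) (snd x)) \<in> borel_measurable (input_space \<Otimes>\<^sub>M obs_space \<Otimes>\<^sub>M est_space)"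
    if "i < data_len p" for i
    using that by (intro measurable_post_mean[where n="data_len p"]) simp_all
  show ?thesis unfolding test_density_def split_beta' by measurable
qed

lemma nn_integral_test_density:
  assumes v: "v \<in> space (obs_space \<Otimes>\<^sub>M est_space)"
  shows "(\<integral>\<^sup>+x. ennreal (test_density (x, v)) \<partial>gauss_input p) \<le> 1"
proof -
  \<comment> \<open>Beyond the data length the kernel is continued by prior over prior, which is
    constantly 1, since the sequential lemma quantifies over all indices.\<close>
  define k where "k i x = (if i < data_len p then ennreal (cg_density (post_mean i x v) (post_var i (snd v)) (x i) / cg_density 0 Es (x i)) else
     ennreal (cg_density 0 Es (x i) / cg_density 0 Es (x i)))" for i x
  have "(\<integral>\<^sup>+x. (\<Prod>i<data_len p. k i x) \<partial>gauss_prod {..<data_len p} (\<lambda>_. Es)) = 1"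
  proof (rule nn_integral_sequential_kernels)
    show "product_prob_space (\<lambda>_ :: nat. complex_gaussian 0 Es)"
      using Es_pos by (rule product_prob_space_complex_gaussian)
    fix i n :: nat assume "i < n"
    have [measurable]: "(\<lambda>x. x i) \<in> borel_measurable (gauss_prod {..<n} (\<lambda>_. Es))"
      using measurable_component_singleton[of i "{..<n}" "\<lambda>_. complex_gaussian 0 Es"] \<open>i < n\<close>
      by (simp cong: measurable_cong_sets)
    show "k i \<in> borel_measurable (gauss_prod {..<n} (\<lambda>_. Es))"
    proof (cases "i < data_len p")
      case True
      have "(\<lambda>x. restrict x {..<Suc i}) \<in> gauss_prod {..<n} (\<lambda>_. Es) \<rightarrow>\<^sub>M (\<Pi>\<^sub>M j\<in>{..<Suc i}. complex_gaussian 0 Es)"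
        using \<open>i < n\<close> by (intro measurable_restrict_subset) auto
      also have "gauss_prod {..<n} (\<lambda>_. Es) \<rightarrow>\<^sub>M (\<Pi>\<^sub>M j\<in>{..<Suc i}. complex_gaussian 0 Es) =
          gauss_prod {..<n} (\<lambda>_. Es) \<rightarrow>\<^sub>M (\<Pi>\<^sub>M j\<in>{..<Suc i}. borel)"
        by (intro measurable_cong_sets refl sets_PiM_cong) simp_all
      finally have r: "(\<lambda>x. restrict x {..<Suc i}) \<in> gauss_prod {..<n} (\<lambda>_. Es) \<rightarrow>\<^sub>M (\<Pi>\<^sub>M j\<in>{..<Suc i}. borel)" .
      have "(\<lambda>x. post_mean i (restrict x {..<Suc i}) v) \<in> borel_measurable (gauss_prod {..<n} (\<lambda>_. Es))"
        by (rule measurable_post_mean[OF True r _ _ measurable_const[OF v]]) (use True in simp_all)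
      moreover have "post_mean i (restrict x {..<Suc i}) v = post_mean i x v" for x
        by (simp add: post_mean_def split_beta' less_Suc_eq_le)
      ultimately have [measurable]: "(\<lambda>x. post_mean i x v) \<in> borel_measurable (gauss_prod {..<n} (\<lambda>_. Es))"
        by simp
      show ?thesis unfolding k_def[abs_def] using True by simp
    next
      case False
      then show ?thesis unfolding k_def[abs_def] by simp
    qed
  next
    fix i j :: nat and x y assume "i < j"
    \<comment> \<open>Factor \<open>i\<close> reads only the entries \<open>i\<close> and
      \<open>i - dim2 p\<close>, neither of which lies after \<open>i\<close>.\<close>
    then have "i \<noteq> j" "i - dim2 p \<noteq> j" by simp_all
    then show "k i (x(j := y)) = k i x"
      by (simp add: k_def post_mean_def split_beta')
  next
    fix i :: nat and x
    show "(\<integral>\<^sup>+y. k i (x(i := y)) \<partial>complex_gaussian 0 Es) = 1"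
    proof (cases "i < data_len p")
      case True
      \<comment> \<open>The posterior mean does not read entry \<open>i\<close> itself: where data
        are read at all, the index is \<open>i - dim2 p\<close>, which is smaller than
        \<open>i\<close> because \<open>dim2 p\<close> is positive.\<close>
      have "post_mean i (x(i := y)) v = post_mean i x v" for y
        using dim2_pos by (auto simp: post_mean_def split_beta')
      then show ?thesis
        using nn_integral_complex_gaussian_reweight[OF post_var_pos[of i "snd v"] Es_pos, of "post_mean i x v"] True
        by (simp add: k_def)
    next
      case False
      then show ?thesis
        using nn_integral_complex_gaussian_reweight[OF Es_pos Es_pos, of 0] by (simp add: k_def)
    qed
  qed
  also have "(\<integral>\<^sup>+x. (\<Prod>i<data_len p. k i x) \<partial>gauss_prod {..<data_len p} (\<lambda>_. Es)) =
      (\<integral>\<^sup>+x. ennreal (test_density (x, v)) \<partial>gauss_input p)"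
    unfolding gauss_input_def
    by (intro nn_integral_cong)
       (simp add: test_density_def k_def prod_ennreal post_var_pos Es_pos)
  finally show ?thesis by simp
qed

text \<open>The factors pi cancel between posterior and prior; the rest is a variance ratio and two
  quadratic forms per symbol.\<close>

lemma ln_test_density:
  "ln (test_density (x, v)) = (\<Sum>i<data_len p. ln (Es / post_var i (snd v)) -
     (cmod (x i - post_mean i x v))\<^sup>2 / post_var i (snd v) + (cmod (x i))\<^sup>2 / Es)"
proof -
  have ln_cg: "ln (cg_density m C y) = - (cmod (y - m))\<^sup>2 / C - ln pi - ln C" if "0 < C" for m C y
    using that by (simp add: cg_density_def ln_div ln_mult)
  have "ln (cg_density m C y / cg_density 0 Es y) = ln (Es / C) - (cmod (y - m))\<^sup>2 / C + (cmod y)\<^sup>2 / Es"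
    if "0 < C" for m C y
    using that Es_pos cg_density_pos[OF that, of m y] cg_density_pos[OF Es_pos, of 0 y]
    by (simp add: ln_div ln_cg)
  note * = this[OF post_var_pos]
  have nonzero: "cg_density m C y \<noteq> 0" if "0 < C" for m C y
    using cg_density_pos[OF that, of m y] by simp
  show ?thesis
    unfolding test_density_def prod.case
    by (subst ln_prod) (simp_all add: * nonzero[OF post_var_pos] nonzero[OF Es_pos])
qed

text \<open>For each symbol the normalised residual and the normalised data energy both have
  expectation 1 and enter with opposite signs, so only the logarithm of prior variance over MMSE
  remains.\<close>

lemma has_bochner_integral_ln_test_density:
  "has_bochner_integral \<Omega> (\<lambda>\<omega>. ln (test_density (fst \<omega>, decoder_view (received \<omega>, side \<omega>))))
     (real (dim1 p) * (\<integral>\<omega>. ln (Es / mmse_direct (mmse_ests p \<omega>)) \<partial>\<Omega>) +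
      real (dim2 p) * (\<integral>\<omega>. ln (Es / mmse_relayed (mmse_ests p \<omega>)) \<partial>\<Omega>) +
      real (dim2 p) * (\<integral>\<omega>. ln (Es / mmse_overlapped (mmse_ests p \<omega>)) \<partial>\<Omega>))"
proof -
  let ?I = "\<lambda>i. \<integral>\<omega>. ln (Es / post_var i (mmse_ests p \<omega>)) \<partial>\<Omega>"
  let ?m = "\<lambda>i \<omega>. post_mean i (fst \<omega>) (decoder_view (received \<omega>, side \<omega>))"
  have fst_rest: "fst \<omega> i = rest \<omega> (Rx i)" if "i < data_len p" for i \<omega>
    using that by (cases \<omega>) (simp add: rest_simps)
  have per_symbol: "has_bochner_integral \<Omega> (\<lambda>\<omega>. ln (Es / post_var i (mmse_ests p \<omega>)) -
     (cmod (fst \<omega> i - ?m i \<omega>))\<^sup>2 / post_var i (mmse_ests p \<omega>) + (cmod (fst \<omega> i))\<^sup>2 / Es) (?I i)"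
    if i: "i < data_len p" for i
  proof -
    have 1: "has_bochner_integral \<Omega> (\<lambda>\<omega>. ln (Es / post_var i (mmse_ests p \<omega>))) (?I i)"
      using integrable_rates
      by (cases "i < dim1 p"; cases "i < dim1 p + dim2 p") (simp_all add: has_bochner_integral_iff post_var_def)
    have 2: "has_bochner_integral \<Omega> (\<lambda>\<omega>. (cmod (fst \<omega> i - ?m i \<omega>))\<^sup>2 / post_var i (mmse_ests p \<omega>)) 1"
    proof -
      consider (direct) "i < dim1 p" | (relayed) k where "i = dim1 p + k" "k < dim2 p"
        | (overlapped) k where "i = dim1 p + dim2 p + k" "k < dim2 p"
      proof -
        have "i < dim1 p \<or> (\<exists>k<dim2 p. i = dim1 p + k) \<or> (\<exists>k<dim2 p. i = dim1 p + dim2 p + k)"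
          using i data_len_eq by presburger
        then show ?thesis using that by blast
      qed
      then show ?thesis
      proof cases
        case direct
        then have "?m i \<omega> = w_direct (mmse_ests p \<omega>) * direct_obs i (mmse_ests p \<omega>) (rest \<omega>)" for \<omega>
          by (simp add: post_mean_def decoder_view_def side_est_side received_eq(1)[symmetric])
        then show ?thesis
          using residual_direct[OF i] direct by (simp add: fst_rest[OF i] post_var_def)
      next
        case relayed
        have "?m i \<omega> = w_relayed1 (mmse_ests p \<omega>) * direct_obs (dim1 p + k) (mmse_ests p \<omega>) (rest \<omega>) +
            w_relayed2 (mmse_ests p \<omega>) * relayed_obs k (mmse_ests p \<omega>) (rest \<omega>)" for \<omega>
          using relayed by (simp add: post_mean_def decoder_view_def side_est_side received_eq[symmetric] add.assoc)
        then show ?thesis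
          using residual_relayed[OF relayed(2)] relayed by (simp add: fst_rest[OF i] fst_rest[OF i, unfolded relayed(1)] post_var_def)
      next
        case overlapped
        have j: "dim1 p + k < data_len p" using overlapped data_len_eq by simp
        have "?m i \<omega> = w_overlapped (mmse_ests p \<omega>) * (relayed_obs k (mmse_ests p \<omega>) (rest \<omega>) -
            relay_path (mmse_ests p \<omega>) * rest \<omega> (Rx (dim1 p + k)))" for \<omega>
          using overlapped by (simp add: post_mean_def decoder_view_def side_est_side received_eq[symmetric] add.assoc fst_rest[OF j])
        then show ?thesis
          using residual_overlapped[OF overlapped(2)] overlapped by (simp add: fst_rest[OF i] fst_rest[OF i, unfolded overlapped(1)] post_var_def)
      qed
    qed
    have 3: "has_bochner_integral \<Omega> (\<lambda>\<omega>. (cmod (fst \<omega> i))\<^sup>2 / Es) 1"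
      using has_bochner_integral_divide_zero[OF has_bochner_integral_coord_square[of "Rx i"], of Es] i Es_pos
      by (simp add: fst_rest)
    show ?thesis using has_bochner_integral_add[OF has_bochner_integral_diff[OF 1 2] 3] by simp
  qed
  have "has_bochner_integral \<Omega> (\<lambda>\<omega>. \<Sum>i<data_len p. ln (Es / post_var i (mmse_ests p \<omega>)) -
     (cmod (fst \<omega> i - ?m i \<omega>))\<^sup>2 / post_var i (mmse_ests p \<omega>) + (cmod (fst \<omega> i))\<^sup>2 / Es) (\<Sum>i<data_len p. ?I i)"
    by (intro has_bochner_integral_sum per_symbol) simp
  moreover have "snd (decoder_view (received \<omega>, side \<omega>)) = mmse_ests p \<omega>" for \<omega>
    by (simp add: decoder_view_def side_est_side)
  moreover have "(\<Sum>i<data_len p. ?I i) = real (dim1 p) * (\<integral>\<omega>. ln (Es / mmse_direct (mmse_ests p \<omega>)) \<partial>\<Omega>) +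
      real (dim2 p) * (\<integral>\<omega>. ln (Es / mmse_relayed (mmse_ests p \<omega>)) \<partial>\<Omega>) +
      real (dim2 p) * (\<integral>\<omega>. ln (Es / mmse_overlapped (mmse_ests p \<omega>)) \<partial>\<Omega>)"
    unfolding data_len_eq sum_lessThan_add by (simp add: post_var_def)
  ultimately show ?thesis by (simp only: ln_test_density)
qed

text \<open>The exponent is quadratic in the received symbols and, since received minus mean is the
  destination noise, in that noise. Both have finite second moments.\<close>

lemma integrable_ln_noise_ratio: "integrable \<Omega> (\<lambda>\<omega>. ln (noise_ratio (fst \<omega>, received \<omega>, side \<omega>)))"
proof -
  have "integrable \<Omega> (\<lambda>\<omega>. ((cmod (received \<omega> t))\<^sup>2 - (cmod (received \<omega> t - mean_obs t (fst \<omega>) (side \<omega>)))\<^sup>2) / N0)"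
    if t: "t \<in> {2..<block_len p}" for t
  proof -
    have "received \<omega> t - mean_obs t (fst \<omega>) (side \<omega>) = rest \<omega> (Rd t)" for \<omega>
      using t by (cases \<omega>) (simp add: received_def rest_simps)
    moreover have "integrable \<Omega> (\<lambda>\<omega>. (cmod (rest \<omega> (Rd t)))\<^sup>2)"
      using has_bochner_integral_coord_square[of "Rd t"] t by (simp add: has_bochner_integral_iff)
    moreover have "integrable \<Omega> (\<lambda>\<omega>. (cmod (received \<omega> t))\<^sup>2)"
    proof -
      have "t - 2 < data_len p" "t = 2 + (t - 2)" using t by (auto simp: data_len_def)
      then obtain i where i: "t = 2 + i" "i < data_len p" by blast
      show ?thesis
      proof (cases "i < dim1 p + dim2 p")
        case True
        then show ?thesis using integrable_direct_obs[OF i(2)] unfolding i(1) by (simp only: received_eq)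
      next
        case False
        then obtain k where k: "i = dim1 p + dim2 p + k" "k < dim2 p"
          using i(2) data_len_eq by (metis add_less_cancel_left le_Suc_ex linorder_not_less)
        then show ?thesis using integrable_relayed_obs[OF k(2)] unfolding i(1) k(1) by (simp only: received_eq)
      qed
    qed
    ultimately show ?thesis by simp
  qed
  then show ?thesis
    unfolding noise_ratio_def prod.case ln_exp by (rule Bochner_Integration.integrable_sum)
qed

subsection \<open>The information rate\<close>

text \<open>The data are among the coordinates collected in \<open>rest\<close>, hence independent
  of the estimates. This makes the mutual information between data and estimates vanish.\<close>

lemma distr_input_est:
  "distr \<Omega> (input_space \<Otimes>\<^sub>M est_space) (\<lambda>\<omega>. (fst \<omega>, mmse_ests p \<omega>)) = gauss_input p \<Otimes>\<^sub>M est_law"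
proof -
  let ?g = "\<lambda>r. \<lambda>i\<in>{..<data_len p}. r (Rx i)"
  have g: "?g \<in> rest_space \<rightarrow>\<^sub>M input_space"
    by (intro measurable_restrict measurable_component_singleton) simp
  have eq: "fst \<omega> = ?g (rest \<omega>)" if "\<omega> \<in> space \<Omega>" for \<omega>
  proof -
    have "fst \<omega> \<in> extensional {..<data_len p}"
      using that by (auto simp: block_space_def space_pair_measure gauss_input_def space_PiM PiE_iff)
    then show ?thesis by (cases \<omega>) (auto simp: rest_simps extensional_def fun_eq_iff)
  qed
  interpret X: prob_space "gauss_input p" by (rule prob_space_gauss_input)
  have nn: "(\<integral>\<^sup>+\<omega>. f (mmse_ests p \<omega>) (fst \<omega>) \<partial>\<Omega>) = (\<integral>\<^sup>+z. \<integral>\<^sup>+r. f z (?g r) \<partial>rest_law \<partial>est_law)"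
    if f: "case_prod f \<in> borel_measurable (est_space \<Otimes>\<^sub>M input_space)" for f :: "_ \<Rightarrow> _ \<Rightarrow> ennreal"
  proof -
    have "(\<lambda>x. (fst x, ?g (snd x))) \<in> est_space \<Otimes>\<^sub>M rest_space \<rightarrow>\<^sub>M est_space \<Otimes>\<^sub>M input_space"
      by (intro measurable_Pair measurable_fst measurable_compose[OF measurable_snd g])
    from measurable_compose[OF this f]
    have "(\<lambda>x. f (fst x) (?g (snd x))) \<in> borel_measurable (est_space \<Otimes>\<^sub>M rest_space)" by simp
    from nn_integral_est_rest[OF this] show ?thesis
      by (simp add: eq cong: nn_integral_cong)
  qed
  have law: "(\<integral>\<^sup>+r. f (?g r) \<partial>rest_law) = (\<integral>\<^sup>+x. f x \<partial>gauss_input p)"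
    if [measurable]: "f \<in> borel_measurable input_space" for f :: "_ \<Rightarrow> ennreal"
  proof -
    have "(\<integral>\<^sup>+x. f x \<partial>distr \<Omega> input_space fst) = (\<integral>\<^sup>+\<omega>. f (fst \<omega>) \<partial>\<Omega>)"
      by (rule nn_integral_distr[OF measurable_block_space_components(1)]) measurable
    then have "(\<integral>\<^sup>+x. f x \<partial>gauss_input p) = (\<integral>\<^sup>+\<omega>. f (fst \<omega>) \<partial>\<Omega>)"
      by (simp only: distr_fst_block_space)
    also have "\<dots> = (\<integral>\<^sup>+r. f (?g r) \<partial>rest_law)"
      using nn[of "\<lambda>z. f"] by (simp add: est.emeasure_space_1)
    finally show ?thesis ..
  qed
  show ?thesis
  proof (rule measure_eqI)
    show "sets (distr \<Omega> (input_space \<Otimes>\<^sub>M est_space) (\<lambda>\<omega>. (fst \<omega>, mmse_ests p \<omega>))) = sets (gauss_input p \<Otimes>\<^sub>M est_law)"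
      by (simp cong: sets_pair_measure_cong)
    fix A assume "A \<in> sets (distr \<Omega> (input_space \<Otimes>\<^sub>M est_space) (\<lambda>\<omega>. (fst \<omega>, mmse_ests p \<omega>)))"
    then have A[measurable]: "A \<in> sets (input_space \<Otimes>\<^sub>M est_space)" by simp
    have "emeasure (distr \<Omega> (input_space \<Otimes>\<^sub>M est_space) (\<lambda>\<omega>. (fst \<omega>, mmse_ests p \<omega>))) A =
        (\<integral>\<^sup>+\<omega>. indicator A (fst \<omega>, mmse_ests p \<omega>) \<partial>\<Omega>)"
      by (subst nn_integral_indicator[symmetric], simp, subst nn_integral_distr)
         (auto intro!: measurable_Pair measurable_block_space_components measurable_mmse_ests)
    also have "\<dots> = (\<integral>\<^sup>+z. \<integral>\<^sup>+r. indicator A (?g r, z) \<partial>rest_law \<partial>est_law)"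
      by (rule nn) measurable
    also have "\<dots> = (\<integral>\<^sup>+z. \<integral>\<^sup>+x. indicator A (x, z) \<partial>gauss_input p \<partial>est_law)"
    proof (rule nn_integral_cong)
      fix z assume "z \<in> space est_law"
      then have [measurable]: "z \<in> space est_space" by (simp add: space_PiM)
      show "(\<integral>\<^sup>+r. indicator A (?g r, z) \<partial>rest_law) = (\<integral>\<^sup>+x. indicator A (x, z) \<partial>gauss_input p)"
        by (rule law) measurable
    qed
    also have "\<dots> = emeasure (gauss_input p \<Otimes>\<^sub>M est_law) A"
    proof -
      interpret XE: pair_prob_space "gauss_input p" est_law ..
      show ?thesis by (subst XE.nn_integral_snd) (simp_all cong: sets_pair_measure_cong)
    qed
    finally show "emeasure (distr \<Omega> (input_space \<Otimes>\<^sub>M est_space) (\<lambda>\<omega>. (fst \<omega>, mmse_ests p \<omega>))) A =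
        emeasure (gauss_input p \<Otimes>\<^sub>M est_law) A" .
  qed
qed

lemma af_rate_ge:
  assumes bs: "1 < bs"
  shows "1 / real (block_len p) * (real (dim1 p) * (\<integral>\<omega>. ln (Es / mmse_direct (mmse_ests p \<omega>)) \<partial>\<Omega>) +
      real (dim2 p) * (\<integral>\<omega>. ln (Es / mmse_relayed (mmse_ests p \<omega>)) \<partial>\<Omega>) +
      real (dim2 p) * (\<integral>\<omega>. ln (Es / mmse_overlapped (mmse_ests p \<omega>)) \<partial>\<Omega>)) / ln bs
    \<le> af_rate bs p (gauss_input p) gain"
proof -
  interpret info: information_space \<Omega> bs by unfold_locales (rule bs)
  interpret X: prob_space "gauss_input p" by (rule prob_space_gauss_input)
  interpret XE: pair_prob_space "gauss_input p" est_law ..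
  have "(\<integral>\<omega>. log bs (test_density (fst \<omega>, decoder_view (received \<omega>, side \<omega>))) \<partial>\<Omega>) \<le>
    block.mutual_information bs input_space (obs_space \<Otimes>\<^sub>M est_space) fst (\<lambda>\<omega>. decoder_view (received \<omega>, side \<omega>))"
  proof (rule info.mutual_information_ge_test_density[where \<rho>=reference_law and s=noise_ratio])
    show "distr \<Omega> (input_space \<Otimes>\<^sub>M data_noise_space \<Otimes>\<^sub>M side_space) (\<lambda>\<omega>. (fst \<omega>, received \<omega>, side \<omega>)) =
      density (distr \<Omega> input_space fst \<Otimes>\<^sub>M reference_law) noise_ratio"
      by (rule distr_received)
    show "0 < noise_ratio z" for z by (simp add: noise_ratio_def split: prod.split)
    show "integrable \<Omega> (\<lambda>\<omega>. ln (test_density (fst \<omega>, decoder_view (received \<omega>, side \<omega>))))"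
      using has_bochner_integral_ln_test_density by (simp add: has_bochner_integral_iff)
    show "(\<integral>\<^sup>+x. ennreal (test_density (x, v)) \<partial>distr \<Omega> input_space fst) \<le> 1" if "v \<in> space (obs_space \<Otimes>\<^sub>M est_space)" for v
      unfolding distr_fst_block_space by (rule nn_integral_test_density[OF that])
  qed (fact measurable_block_space_components(1) measurable_received_side measurable_decoder_view
    prob_space_reference_law sets_reference_law measurable_noise_ratio integrable_ln_noise_ratio
    measurable_test_density test_density_pos)+
  \<comment> \<open>This is the term subtracted in the definition of conditional mutual information;
    since it is 0, the bound for the pair (received signals, estimates) is a bound for the
    conditional quantity.\<close>
  moreover have "block.mutual_information bs input_space est_space fst (mmse_ests p) = 0"
    unfolding block.mutual_information_def distr_fst_block_space distr_mmse_ests distr_input_est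
    by (rule XE.KL_same_eq_0)
  ultimately have le: "(\<integral>\<omega>. log bs (test_density (fst \<omega>, decoder_view (received \<omega>, side \<omega>))) \<partial>\<Omega>) / real (block_len p)
      \<le> af_rate bs p (gauss_input p) gain"
    unfolding af_rate_def block.conditional_mutual_information_def decoder_view_received
    by (simp add: divide_right_mono)
  have "(\<integral>\<omega>. log bs (test_density (fst \<omega>, decoder_view (received \<omega>, side \<omega>))) \<partial>\<Omega>) =
      (\<integral>\<omega>. ln (test_density (fst \<omega>, decoder_view (received \<omega>, side \<omega>))) \<partial>\<Omega>) / ln bs"
    by (simp add: log_def)
  note le[unfolded this has_bochner_integral_integral_eq[OF has_bochner_integral_ln_test_density]]
  then show ?thesis by (simp add: mult.commute)
qed

subsection \<open>Comparison with the claimed rate\<close>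

text \<open>In the notation of the theorem, \<open>a\<close>, \<open>b\<close>, \<open>c\<close>, \<open>d\<close> are the values of \<open>snr_direct\<close>,
  \<open>snr_overlap\<close>, \<open>snr_hop1\<close>, \<open>snr_hop2\<close> at the channel estimates.\<close>

definition snr_direct :: "(link \<Rightarrow> complex) \<Rightarrow> real" where
  "snr_direct z = Es * (cmod (z SD))\<^sup>2 / noise_direct"

text \<open>The part of \<open>noise_relayed\<close> that does not vary with the estimates, namely
  all but the forwarded relay noise. In the notation of the theorem it is
  \<open>D / ((m - 2) * A * B)\<close>.\<close>

definition noise_overlap :: real where
  "noise_overlap = err_var p SD * Es + N0 + err_var p RD * Er"

definition snr_overlap :: "(link \<Rightarrow> complex) \<Rightarrow> real" where
  "snr_overlap z = Es * (cmod (z SD))\<^sup>2 / noise_overlap"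

definition snr_hop1 :: "(link \<Rightarrow> complex) \<Rightarrow> real" where
  "snr_hop1 z = Es * (cmod (z SR))\<^sup>2 / (err_var p SR * Es + N0)"

definition snr_hop2 :: "(link \<Rightarrow> complex) \<Rightarrow> real" where
  "snr_hop2 z = Er * (cmod (z RD))\<^sup>2 / noise_overlap"

lemma noise_overlap_pos: "0 < noise_overlap"
  unfolding noise_overlap_def using err_var_pos[of SD] err_var_pos[of RD] Es_pos Er_pos noise_var
  by (intro add_pos_pos mult_pos_pos)

lemma mmse_direct_snr: "Es / mmse_direct z = 1 + snr_direct z"
  by (simp add: mmse_ratio snr_direct_def)

text \<open>With f = cd / (1 + c + d) and q = b (1 + c) / (1 + c + d), the two ratios are 1 + a + f
  / (1 + q) and 1 + q. The denominator 1 + q cancels in the product, leaving 1 + a + f + (1 + a)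
  q.\<close>

lemma mmse_relay_snr:
  fixes z :: "link \<Rightarrow> complex"
  defines "a \<equiv> snr_direct z" and "b \<equiv> snr_overlap z" and "c \<equiv> snr_hop1 z" and "d \<equiv> snr_hop2 z"
  shows "Es / mmse_relayed z * (Es / mmse_overlapped z) =
    1 + a + c * d / (1 + c + d) + (1 + a) * b * (1 + c) / (1 + c + d)"
proof -
  define S where "S = err_var p SR * Es + N0"
  define L where "L = noise_overlap"
  have S: "0 < S" unfolding S_def using err_var_pos[of SR] Es_pos noise_var by (intro add_pos_pos mult_pos_pos)
  have L: "0 < L" unfolding L_def by (rule noise_overlap_pos)
  have nn: "0 \<le> a" "0 \<le> b" "0 \<le> c" "0 \<le> d"
    using Es_pos Er_pos noise_direct_pos L S
    by (auto simp: a_def b_def c_def d_def snr_direct_def snr_overlap_def snr_hop1_def snr_hop2_def L_def S_def)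
  have cS: "Es * (cmod (z SR))\<^sup>2 = c * S" using S by (simp add: c_def snr_hop1_def S_def)
  have dL: "Er * (cmod (z RD))\<^sup>2 = d * L" using L by (simp add: d_def snr_hop2_def L_def)
  have bL: "Es * (cmod (z SD))\<^sup>2 = b * L" using L by (simp add: b_def snr_overlap_def L_def)
  \<comment> \<open>\<open>S * (1 + c)\<close> is the energy of a relay observation given the
    estimate; the gain normalises it to \<open>Er\<close>.\<close>
  have g: "(gain (z SR))\<^sup>2 * (S * (1 + c)) = Er"
    using gain_square[of "z SR"] cS by (simp add: S_def algebra_simps)
  then have gS: "(gain (z SR))\<^sup>2 * S = Er / (1 + c)"
    using nn by (simp add: field_simps)
  \<comment> \<open>The signal-to-noise ratio of the overlapping symbol once the relayed one is
    known: \<open>b\<close> is relative to the noise \<open>L\<close>, and the forwarded relay noise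
    enlarges \<open>L\<close> by the factor \<open>(1 + c + d) / (1 + c)\<close>.\<close>
  define q where "q = b * (1 + c) / (1 + c + d)"
  have q: "0 \<le> q" using nn by (simp add: q_def)
  have noise: "noise_relayed z = L * (1 + c + d) / (1 + c)"
  proof -
    have "noise_relayed z = L + (gain (z SR))\<^sup>2 * S * (cmod (z RD))\<^sup>2"
      by (simp add: noise_relayed_def L_def noise_overlap_def S_def mult_ac)
    also have "\<dots> = L + Er * (cmod (z RD))\<^sup>2 / (1 + c)" by (simp add: gS)
    also have "\<dots> = L * (1 + c + d) / (1 + c)" using nn by (simp add: dL field_simps)
    finally show ?thesis .
  qed
  have path: "Es * (cmod (relay_path z))\<^sup>2 = c * d * L / (1 + c)"
  proof -
    have "Es * (cmod (relay_path z))\<^sup>2 = (gain (z SR))\<^sup>2 * (Es * (cmod (z SR))\<^sup>2) * (cmod (z RD))\<^sup>2"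
      by (simp add: relay_path_def norm_mult power_mult_distrib)
    also have "\<dots> = (gain (z SR))\<^sup>2 * S * c * (cmod (z RD))\<^sup>2" by (simp add: cS)
    also have "\<dots> = c * (Er * (cmod (z RD))\<^sup>2) / (1 + c)" by (simp add: gS)
    also have "\<dots> = c * d * L / (1 + c)" by (simp add: dL)
    finally show ?thesis .
  qed
  have o: "Es / mmse_overlapped z = 1 + q"
    using nn L by (simp add: mmse_ratio bL noise q_def)
  have "(cmod (z SD))\<^sup>2 * Es + noise_relayed z = L * (1 + c + d) / (1 + c) * (1 + q)"
  proof -
    have "L * (1 + c + d) / (1 + c) * q = b * L" using nn by (simp add: q_def)
    then have "(cmod (z SD))\<^sup>2 * Es = L * (1 + c + d) / (1 + c) * q"
      using bL by (simp only: mult.commute[of _ Es])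
    then show ?thesis by (simp only: noise distrib_left mult_1_right add.commute)
  qed
  moreover have "c * d * L / (1 + c) / (L * (1 + c + d) / (1 + c) * (1 + q)) = c * d / (1 + c + d) / (1 + q)"
    using nn L q by (simp add: divide_simps)
  ultimately have r: "Es / mmse_relayed z = 1 + a + c * d / (1 + c + d) / (1 + q)"
    by (simp add: mmse_ratio path a_def snr_direct_def)
  have "(1 + a + f / (1 + q)) * (1 + q) = 1 + a + f + (1 + a) * q" for f
    using q by (simp add: field_simps)
  from this[of "c * d / (1 + c + d)"] show ?thesis unfolding r o by (simp add: q_def)
qed

text \<open>The variables \<open>w\<close> of the theorem are the normalised channel estimates:
  scaled by their standard deviations, they have the joint law of \<open>mmse_ests\<close>.\<close>

lemma integral_est_law:
  fixes G :: "(link \<Rightarrow> complex) \<Rightarrow> real"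
  assumes W: "prob_space W" "prob_space.indep_vars W (\<lambda>_. borel) w UNIV"
    and w: "\<And>l. distr W borel (w l) = complex_gaussian 0 1"
    and G[measurable]: "G \<in> borel_measurable est_space"
  shows "(\<integral>x. G (\<lambda>l. complex_of_real (sqrt (est_var p l)) * w l x) \<partial>W) = (\<integral>\<omega>. G (mmse_ests p \<omega>) \<partial>\<Omega>)"
proof -
  interpret W: prob_space W by fact
  have [measurable]: "w l \<in> borel_measurable W" for l
    using W(2) unfolding W.indep_vars_def by auto
  let ?u = "\<lambda>l x. complex_of_real (sqrt (est_var p l)) * w l x"
  have "W.indep_vars (\<lambda>_. borel) ?u UNIV"
    by (rule W.indep_vars_compose2[OF W(2)]) measurable
  then have "distr W est_space (\<lambda>x. \<lambda>l\<in>UNIV. ?u l x) = (\<Pi>\<^sub>M l\<in>UNIV. distr W borel (?u l))"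
    by (subst (asm) W.indep_vars_iff_distr_eq_PiM') auto
  also have "\<dots> = est_law"
  proof (rule PiM_cong[OF refl])
    fix l
    have "distr W borel (?u l) = distr (distr W borel (w l)) borel (\<lambda>z. complex_of_real (sqrt (est_var p l)) * z)"
      by (subst distr_distr) (auto simp: comp_def)
    also have "\<dots> = complex_gaussian 0 (est_var p l)"
      using distr_complex_gaussian_affine[of 1 "sqrt (est_var p l)" 0 0] est_var_pos[of l]
      by (simp add: w less_imp_le)
    finally show "distr W borel (?u l) = complex_gaussian 0 (est_var p l)" .
  qed
  finally have law: "distr W est_space (\<lambda>x l. ?u l x) = est_law" by (simp add: restrict_UNIV)
  have "(\<lambda>x. \<lambda>l\<in>UNIV. ?u l x) \<in> W \<rightarrow>\<^sub>M est_space" by measurable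
  then have m: "(\<lambda>x l. ?u l x) \<in> W \<rightarrow>\<^sub>M est_space" by (simp add: restrict_UNIV)
  have "(\<integral>x. G (\<lambda>l. ?u l x) \<partial>W) = (\<integral>z. G z \<partial>est_law)"
    unfolding law[symmetric] by (rule integral_distr[OF m G, symmetric])
  also have "\<dots> = (\<integral>\<omega>. G (mmse_ests p \<omega>) \<partial>\<Omega>)"
    unfolding distr_mmse_ests[symmetric] by (rule integral_distr[OF measurable_mmse_ests G])
  finally show ?thesis .
qed

lemma af_capacity_ge:
  assumes bs: "1 < bs"
    and W: "prob_space W" "prob_space.indep_vars W (\<lambda>_. borel) w UNIV"
      "\<And>l. distr W borel (w l) = complex_gaussian 0 1"
  defines "u \<equiv> \<lambda>x l. complex_of_real (sqrt (est_var p l)) * w l x"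
  shows "ereal (1 / real (block_len p) * (\<integral>x. real (dim1 p) * log bs (1 + snr_direct (u x)) + real (dim2 p) *
      log bs (1 + snr_direct (u x) + snr_hop1 (u x) * snr_hop2 (u x) / (1 + snr_hop1 (u x) + snr_hop2 (u x)) +
        (1 + snr_direct (u x)) * snr_overlap (u x) * (1 + snr_hop1 (u x)) / (1 + snr_hop1 (u x) + snr_hop2 (u x))) \<partial>W))
    \<le> af_capacity bs p"
proof -
  define G where "G z = (real (dim1 p) * ln (Es / mmse_direct z) + real (dim2 p) * ln (Es / mmse_relayed z) +
      real (dim2 p) * ln (Es / mmse_overlapped z)) / ln bs" for z
  have G: "G \<in> borel_measurable est_space" unfolding G_def by measurable
  \<comment> \<open>By \<open>mmse_relay_snr\<close> the second logarithm of the claimed rate splits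
    into the rates of the relayed and of the overlapping symbol, each occurring
    \<open>dim2 p\<close> times.\<close>
  have eq: "real (dim1 p) * log bs (1 + snr_direct z) + real (dim2 p) *
      log bs (1 + snr_direct z + snr_hop1 z * snr_hop2 z / (1 + snr_hop1 z + snr_hop2 z) +
        (1 + snr_direct z) * snr_overlap z * (1 + snr_hop1 z) / (1 + snr_hop1 z + snr_hop2 z)) = G z" for z
  proof -
    have "0 < Es / mmse_relayed z" "0 < Es / mmse_overlapped z" using mmse_pos[of z] Es_pos by auto
    then have "ln (Es / mmse_relayed z * (Es / mmse_overlapped z)) = ln (Es / mmse_relayed z) + ln (Es / mmse_overlapped z)"
      by (rule ln_mult_pos)
    then show ?thesis
      by (simp only: mmse_relay_snr[symmetric]) (simp only: mmse_direct_snr[symmetric] G_def log_def,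
        simp add: add_divide_distrib distrib_left)
  qed
  have "(\<integral>x. G (u x) \<partial>W) = (\<integral>\<omega>. G (mmse_ests p \<omega>) \<partial>\<Omega>)"
    unfolding u_def by (rule integral_est_law[OF W G])
  also have "\<dots> = (real (dim1 p) * (\<integral>\<omega>. ln (Es / mmse_direct (mmse_ests p \<omega>)) \<partial>\<Omega>) +
      real (dim2 p) * (\<integral>\<omega>. ln (Es / mmse_relayed (mmse_ests p \<omega>)) \<partial>\<Omega>) +
      real (dim2 p) * (\<integral>\<omega>. ln (Es / mmse_overlapped (mmse_ests p \<omega>)) \<partial>\<Omega>)) / ln bs"
    unfolding G_def using integrable_rates by simp
  finally have "1 / real (block_len p) * (\<integral>x. G (u x) \<partial>W) \<le> af_rate bs p (gauss_input p) gain"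
    using af_rate_ge[OF bs] by simp
  moreover have "ereal (af_rate bs p (gauss_input p) gain) \<le> af_capacity bs p"
    unfolding af_capacity_def
    by (rule SUP_upper2[where i="(gauss_input p, gain)"]) (simp_all add: admissible_gauss_input admissible_gain)
  ultimately show ?thesis
    unfolding eq by (meson ereal_less_eq(3) order_trans)
qed

end

section \<open>From the network parameters to the stated coefficients\<close>

text \<open>Denominators are cleared; the key identity is \<open>D = m * A * B * L\<close>. Here
  \<open>m\<close> stands for the number of data symbols, \<open>Es'\<close> and \<open>Er'\<close>
  for the total data energies, and \<open>es\<close>, \<open>er\<close> for the pilot
  energies.\<close>

lemma snr_coefficients:
  fixes m Es' Er' es er \<sigma> \<tau> \<alpha> N A B :: real
  assumes "0 < m" "0 < \<alpha>" "0 < N" "0 < A" "0 < B" "0 \<le> Es'" "0 \<le> Er'"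
  defines "Es \<equiv> Es' / m" and "Er \<equiv> Er' / (m * \<alpha>)"
  defines "L \<equiv> \<sigma>\<^sup>2 * N / A * Es + N + \<tau>\<^sup>2 * N / B * Er"
  defines "D \<equiv> m * A * B * N + Er' * \<tau>\<^sup>2 * N * A / \<alpha> + Es' * \<sigma>\<^sup>2 * N * B"
  shows "Es * (\<sigma>^4 * es / A) / (\<sigma>\<^sup>2 * N / A * Es + N) = es * Es' * \<sigma>^4 / (Es' * \<sigma>\<^sup>2 * N + m * A * N)"
    "Es * (\<sigma>^4 * es / A) / L = es * Es' * \<sigma>^4 * B / D"
    "Er * (\<tau>^4 * er / B) / L = (er * Er' * \<tau>^4 * A / \<alpha>) / D"
proof -
  have D: "D = m * A * B * L"
    using assms(1-5) by (simp add: D_def L_def Es_def Er_def field_simps)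
  have L: "0 < L"
    unfolding L_def Es_def Er_def using assms(1-7) by (intro add_nonneg_pos add_pos_nonneg) auto
  have pos: "0 < \<sigma>\<^sup>2 * N / A * Es + N"
    unfolding Es_def using assms(1-7) by (intro add_nonneg_pos) auto
  have "Es' * \<sigma>\<^sup>2 * N + m * A * N = m * A * (\<sigma>\<^sup>2 * N / A * Es + N)"
    using assms(1-5) by (simp add: Es_def field_simps)
  then show "Es * (\<sigma>^4 * es / A) / (\<sigma>\<^sup>2 * N / A * Es + N) = es * Es' * \<sigma>^4 / (Es' * \<sigma>\<^sup>2 * N + m * A * N)"
    by (simp add: Es_def)
  show "Es * (\<sigma>^4 * es / A) / L = es * Es' * \<sigma>^4 * B / D"
    "Er * (\<tau>^4 * er / B) / L = (er * Er' * \<tau>^4 * A / \<alpha>) / D"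
    using assms(1-5) L by (simp_all add: D Es_def Er_def mult_ac)
qed

theorem theorem1:
  fixes m :: nat
    and \<alpha> \<delta>\<^sub>s \<delta>\<^sub>r P\<^sub>s P\<^sub>r N\<^sub>0 \<sigma>\<^sub>s\<^sub>d \<sigma>\<^sub>s\<^sub>r \<sigma>\<^sub>r\<^sub>d bs A B D :: real
    and W :: "'w measure" and w :: "link \<Rightarrow> 'w \<Rightarrow> complex"
    and a b c d :: "'w \<Rightarrow> real" and f :: "real \<Rightarrow> real \<Rightarrow> real"
    and q :: "real \<Rightarrow> real \<Rightarrow> real \<Rightarrow> real \<Rightarrow> real"
  assumes "2 < m" and "0 < \<alpha>" and "\<alpha> \<le> 1 / 2"
    and "0 < \<delta>\<^sub>s" and "\<delta>\<^sub>s < 1" and "0 < \<delta>\<^sub>r" and "\<delta>\<^sub>r < 1"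
    and "0 < P\<^sub>s" and "0 < P\<^sub>r" and "0 < N\<^sub>0"
    and "0 < \<sigma>\<^sub>s\<^sub>d" and "0 < \<sigma>\<^sub>s\<^sub>r" and "0 < \<sigma>\<^sub>r\<^sub>d"
    and "(1 - 2 * \<alpha>) * (real m - 2) \<in> \<int>" and "\<alpha> * (real m - 2) \<in> \<int>"
    and "1 < bs"
    and "prob_space W" and "prob_space.indep_vars W (\<lambda>_. borel) w UNIV"
    and "\<And>l. distr W borel (w l) = complex_gaussian 0 1"
    and "A = \<sigma>\<^sub>s\<^sub>d\<^sup>2 * \<delta>\<^sub>s * m * P\<^sub>s + N\<^sub>0"
    and "B = \<sigma>\<^sub>r\<^sub>d\<^sup>2 * \<delta>\<^sub>r * m * P\<^sub>r + N\<^sub>0"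
    and "D = (real m - 2) * A * B * N\<^sub>0 + (1 - \<delta>\<^sub>r) * m * P\<^sub>r * \<sigma>\<^sub>r\<^sub>d\<^sup>2 * N\<^sub>0 * A / \<alpha>
             + (1 - \<delta>\<^sub>s) * m * P\<^sub>s * \<sigma>\<^sub>s\<^sub>d\<^sup>2 * N\<^sub>0 * B"
    and "a = (\<lambda>\<omega>. \<delta>\<^sub>s * (1 - \<delta>\<^sub>s) * m^2 * P\<^sub>s^2 * \<sigma>\<^sub>s\<^sub>d^4 /
           ((1 - \<delta>\<^sub>s) * m * P\<^sub>s * \<sigma>\<^sub>s\<^sub>d\<^sup>2 * N\<^sub>0 + (real m - 2) * (\<sigma>\<^sub>s\<^sub>d\<^sup>2 * \<delta>\<^sub>s * m * P\<^sub>s + N\<^sub>0) * N\<^sub>0)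
           * (cmod (w SD \<omega>))\<^sup>2)"
    and "c = (\<lambda>\<omega>. \<delta>\<^sub>s * (1 - \<delta>\<^sub>s) * m^2 * P\<^sub>s^2 * \<sigma>\<^sub>s\<^sub>r^4 /
           ((1 - \<delta>\<^sub>s) * m * P\<^sub>s * \<sigma>\<^sub>s\<^sub>r\<^sup>2 * N\<^sub>0 + (real m - 2) * (\<sigma>\<^sub>s\<^sub>r\<^sup>2 * \<delta>\<^sub>s * m * P\<^sub>s + N\<^sub>0) * N\<^sub>0)
           * (cmod (w SR \<omega>))\<^sup>2)"
    and "b = (\<lambda>\<omega>. \<delta>\<^sub>s * (1 - \<delta>\<^sub>s) * m^2 * P\<^sub>s^2 * \<sigma>\<^sub>s\<^sub>d^4 * B / D * (cmod (w SD \<omega>))\<^sup>2)"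
    and "d = (\<lambda>\<omega>. (\<delta>\<^sub>r * (1 - \<delta>\<^sub>r) * m^2 * P\<^sub>r^2 * \<sigma>\<^sub>r\<^sub>d^4 * A / \<alpha>) / D * (cmod (w RD \<omega>))\<^sup>2)"
    and "f = (\<lambda>x y. x * y / (1 + x + y))"
    and "q = (\<lambda>a b c d. (1 + a) * b * (1 + c) / (1 + c + d))"
  shows "ereal (1 / m * (\<integral>\<omega>. (1 - 2 * \<alpha>) * (real m - 2) * log bs (1 + a \<omega>)
            + (real m - 2) * \<alpha> * log bs (1 + a \<omega> + f (c \<omega>) (d \<omega>) + q (a \<omega>) (b \<omega>) (c \<omega>) (d \<omega>)) \<partial>W))
         \<le> af_capacity bs
              \<lparr>block_len = m, overlap = \<alpha>, src_train_frac = \<delta>\<^sub>s, rel_train_frac = \<delta>\<^sub>r,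
               src_power = P\<^sub>s, rel_power = P\<^sub>r, noise_var = N\<^sub>0,
               fading_sd = (\<lambda>l. case l of SR \<Rightarrow> \<sigma>\<^sub>s\<^sub>r | SD \<Rightarrow> \<sigma>\<^sub>s\<^sub>d | RD \<Rightarrow> \<sigma>\<^sub>r\<^sub>d)\<rparr>"
proof -
  define p where "p = \<lparr>block_len = m, overlap = \<alpha>, src_train_frac = \<delta>\<^sub>s, rel_train_frac = \<delta>\<^sub>r,
               src_power = P\<^sub>s, rel_power = P\<^sub>r, noise_var = N\<^sub>0,
               fading_sd = (\<lambda>l. case l of SR \<Rightarrow> \<sigma>\<^sub>s\<^sub>r | SD \<Rightarrow> \<sigma>\<^sub>s\<^sub>d | RD \<Rightarrow> \<sigma>\<^sub>r\<^sub>d)\<rparr>"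
  note par = assms(1-13)
  interpret af_network p
  proof
    fix l show "0 < fading_sd p l" using par by (cases l) (simp_all add: p_def)
  qed (use par assms(14,15) in \<open>simp_all add: p_def\<close>)
  let ?u = "\<lambda>x l. complex_of_real (sqrt (est_var p l)) * w l x"
  have norm: "(cmod (?u x l))\<^sup>2 = est_var p l * (cmod (w l x))\<^sup>2" for x l
    using est_var_pos[of l] by (simp add: norm_mult power_mult_distrib)
  let ?mm = "real m - 2" and ?Es = "(1 - \<delta>\<^sub>s) * m * P\<^sub>s" and ?Er = "(1 - \<delta>\<^sub>r) * m * P\<^sub>r"
  have mm: "0 < ?mm" using par by simp
  have AB: "0 < A" "0 < B" "A = \<sigma>\<^sub>s\<^sub>d\<^sup>2 * (\<delta>\<^sub>s * m * P\<^sub>s) + N\<^sub>0" "B = \<sigma>\<^sub>r\<^sub>d\<^sup>2 * (\<delta>\<^sub>r * m * P\<^sub>r) + N\<^sub>0"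
    using par assms(20,21) by (auto intro!: add_pos_pos)
  have C: "0 < \<sigma>\<^sub>s\<^sub>r\<^sup>2 * (\<delta>\<^sub>s * m * P\<^sub>s) + N\<^sub>0"
    using par by (auto intro!: add_pos_pos)
  have nn: "0 \<le> ?Es" "0 \<le> ?Er" using par by auto
  have D: "D = ?mm * A * B * N\<^sub>0 + ?Er * \<sigma>\<^sub>r\<^sub>d\<^sup>2 * N\<^sub>0 * A / \<alpha> + ?Es * \<sigma>\<^sub>s\<^sub>d\<^sup>2 * N\<^sub>0 * B"
    using assms(22) by simp
  have Es: "src_symbol_energy p = ?Es / ?mm" and Er: "rel_symbol_energy p = ?Er / (?mm * \<alpha>)"
    by (simp_all add: src_symbol_energy_def rel_symbol_energy_def p_def)
  have vars: "est_var p SD = \<sigma>\<^sub>s\<^sub>d^4 * (\<delta>\<^sub>s * m * P\<^sub>s) / A" "est_var p RD = \<sigma>\<^sub>r\<^sub>d^4 * (\<delta>\<^sub>r * m * P\<^sub>r) / B"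
    "est_var p SR = \<sigma>\<^sub>s\<^sub>r^4 * (\<delta>\<^sub>s * m * P\<^sub>s) / (\<sigma>\<^sub>s\<^sub>r\<^sup>2 * (\<delta>\<^sub>s * m * P\<^sub>s) + N\<^sub>0)"
    "err_var p SD = \<sigma>\<^sub>s\<^sub>d\<^sup>2 * N\<^sub>0 / A" "err_var p RD = \<sigma>\<^sub>r\<^sub>d\<^sup>2 * N\<^sub>0 / B"
    "err_var p SR = \<sigma>\<^sub>s\<^sub>r\<^sup>2 * N\<^sub>0 / (\<sigma>\<^sub>s\<^sub>r\<^sup>2 * (\<delta>\<^sub>s * m * P\<^sub>s) + N\<^sub>0)" "noise_var p = N\<^sub>0"
    by (simp_all add: est_var_def err_var_def p_def AB(3,4))
  note coeff = snr_coefficients[OF mm par(2) par(10) AB(1,2) nn]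
  note coeff_direct = coeff(1)[where \<sigma>=\<sigma>\<^sub>s\<^sub>d and es="\<delta>\<^sub>s * m * P\<^sub>s"]
  note coeff_overlap = coeff(2)[where \<sigma>=\<sigma>\<^sub>s\<^sub>d and es="\<delta>\<^sub>s * m * P\<^sub>s" and \<tau>=\<sigma>\<^sub>r\<^sub>d, folded D]
  \<comment> \<open>The source-relay hop follows the same formula as the direct link, with the pilot
    denominator of its own fading variance in the place of \<open>A\<close>.\<close>
  note coeff_hop1 = snr_coefficients(1)[OF mm par(2) par(10) C AB(2) nn, where \<sigma>=\<sigma>\<^sub>s\<^sub>r and es="\<delta>\<^sub>s * m * P\<^sub>s"]
  note coeff_hop2 = coeff(3)[where \<sigma>=\<sigma>\<^sub>s\<^sub>d and er="\<delta>\<^sub>r * m * P\<^sub>r" and \<tau>=\<sigma>\<^sub>r\<^sub>d, folded D]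
  have a: "snr_direct (?u x) = a x" for x
  proof -
    have "snr_direct (?u x) = src_symbol_energy p * est_var p SD / (noise_direct) * (cmod (w SD x))\<^sup>2"
      unfolding snr_direct_def norm by simp
    also have "\<dots> = a x"
      unfolding noise_direct_def Es Er vars coeff_direct assms(23) by (simp add: AB power2_eq_square mult_ac)
    finally show ?thesis .
  qed
  have b: "snr_overlap (?u x) = b x" for x
  proof -
    have "snr_overlap (?u x) = src_symbol_energy p * est_var p SD / (noise_overlap) * (cmod (w SD x))\<^sup>2"
      unfolding snr_overlap_def norm by simp
    also have "\<dots> = b x"
      unfolding noise_overlap_def Es Er vars coeff_overlap assms(25) by (simp add: AB power2_eq_square mult_ac)
    finally show ?thesis .
  qed
  have c: "snr_hop1 (?u x) = c x" for x
  proof -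
    have "snr_hop1 (?u x) = src_symbol_energy p * est_var p SR / (err_var p SR * src_symbol_energy p + noise_var p) * (cmod (w SR x))\<^sup>2"
      unfolding snr_hop1_def norm by simp
    also have "\<dots> = c x"
      unfolding Es Er vars coeff_hop1 assms(24) by (simp add: AB power2_eq_square mult_ac)
    finally show ?thesis .
  qed
  have d: "snr_hop2 (?u x) = d x" for x
  proof -
    have "snr_hop2 (?u x) = rel_symbol_energy p * est_var p RD / (noise_overlap) * (cmod (w RD x))\<^sup>2"
      unfolding snr_hop2_def norm by simp
    also have "\<dots> = d x"
      unfolding noise_overlap_def Es Er vars coeff_hop2 assms(26) by (simp add: AB power2_eq_square mult_ac)
    finally show ?thesis .
  qed
  have dims': "real (dim1 p) = (1 - 2 * \<alpha>) * (real m - 2)" "real (dim2 p) = (real m - 2) * \<alpha>" "real (block_len p) = m"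
    using dims by (simp_all add: p_def)
  show ?thesis
    using af_capacity_ge[OF assms(16,17,18,19)]
    unfolding a b c d dims' assms(27,28) p_def[symmetric] .
qed

end
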